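(* Let $G$ be a random graph generated from SBM$(n,p,q,k)$ with $$\frac{p-q}{\sqrt{p}}\ \ge\ \Omega\!\left(k^{\frac34}\,n^{-\frac14}\,(\log n)^{\frac14}\right).$$ Then there exists an algorithm in the $s$-space MPC model, where $s=\Omega(\log n)$, that outputs the $k$ hidden clusters within $O(\log_s n)$ rounds with high probability, and uses $\tilde O(m)$ total space.
   Context: SBM$(n,p,q,k)$: a vertex set $V$ of $kn$ vertices is partitioned into $k$ hidden clusters $V_1,\dots,V_k$, each of size $n$; independently for each pair of vertices $u,v$, the edge $(u,v)$ is present with probability $p$ if $u,v$ lie in the same cluster and with probability $q$ otherwise, where $0<q<p<1$. $m=\Theta(kn^2p+k^2n^2q)$ denotes the number of edges. The $s$-space MPC model: the input edges are arbitrarily distributed among machines, each having local memory of $s$ words of $O(\log n)$ bits; machines communicate in synchronous rounds, local computation is free, and the round complexity is the number of communication rounds; total space is the sum of memory used over all machines. "With high probability" means with probability at least $1-O(n^{-1})$. $\tilde O(\cdot)$ hides $\mathrm{poly}(\log kn)$ factors. Outputting the $k$ clusters means exactly recovering the partition $V_1,\dots,V_k$. *)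

theory Defs
  imports "HOL-Probability.Probability"
begin

definition vertex_pairs :: "nat \<Rightarrow> (nat \<times> nat) set" where
  "vertex_pairs N = {(u, v). u < v \<and> v < N}"

definition hidden_partition :: "nat \<Rightarrow> nat \<Rightarrow> (nat \<Rightarrow> nat set) \<Rightarrow> bool" where
  "hidden_partition n k V \<longleftrightarrow>
     (\<forall>i<k. card (V i) = n) \<and> disjoint_family_on V {..<k} \<and> (\<Union>i<k. V i) = {..<k * n}"

text \<open>A graph is its set of edges; an undirected edge is the pair of its endpoints in
  increasing order.\<close>

definition SBM :: "nat \<Rightarrow> real \<Rightarrow> real \<Rightarrow> nat \<Rightarrow> (nat \<Rightarrow> nat set) \<Rightarrow> (nat \<times> nat) set pmf" where
  "SBM n p q k V =
     map_pmf (\<lambda>present. {e \<in> vertex_pairs (k * n). present e})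
       (Pi_pmf (vertex_pairs (k * n)) False
         (\<lambda>(u, v). bernoulli_pmf (if \<exists>i<k. u \<in> V i \<and> v \<in> V i then p else q)))"

text \<open>Words are natural numbers (their size is bounded by \<open>within_memory\<close> below), and a memory
  content is a list of words. In an outbox, \<open>(j, x)\<close> stands for the one-word message \<open>x\<close>
  addressed to machine \<open>j\<close>.\<close>

type_synonym memory = "nat list"
type_synonym outbox = "(nat \<times> nat) list"
type_synonym configuration = "nat \<Rightarrow> memory"

text \<open>Local computation is free, hence arbitrary; it may use private coins. In round \<open>t\<close>,
  machine \<open>i\<close> with memory \<open>x\<close> draws from \<open>local_step A t i x\<close> the words it keeps and the
  messages it sends. After the last round it writes its share of the output, drawn from
  \<open>local_output A i x\<close>.\<close>

record mpc_algorithm =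
  num_machines :: nat
  word_bits :: nat
  num_rounds :: nat
  local_step :: "nat \<Rightarrow> nat \<Rightarrow> memory \<Rightarrow> (memory \<times> outbox) pmf"
  local_output :: "nat \<Rightarrow> memory \<Rightarrow> memory pmf"

definition before_delivery :: "(nat \<Rightarrow> memory \<times> outbox) \<Rightarrow> configuration" where
  "before_delivery x i = fst (x i) @ map snd (snd (x i))"

definition after_delivery :: "nat \<Rightarrow> (nat \<Rightarrow> memory \<times> outbox) \<Rightarrow> configuration" where
  "after_delivery M x j =
     fst (x j) @ concat (map (\<lambda>i. map snd (filter (\<lambda>msg. fst msg = j) (snd (x i)))) [0..<M])"

text \<open>The history of an execution lists the memory contents at the start and, for each round,
  before and after the delivery of messages.\<close>

primrec mpc_rounds ::
  "mpc_algorithm \<Rightarrow> configuration \<Rightarrow> nat \<Rightarrow> configuration list pmf" where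
  "mpc_rounds A c 0 = return_pmf [c]"
| "mpc_rounds A c (Suc t) =
     bind_pmf (mpc_rounds A c t) (\<lambda>h.
       map_pmf (\<lambda>x. h @ [before_delivery x, after_delivery (num_machines A) x])
         (Pi_pmf {..<num_machines A} ([], []) (\<lambda>i. local_step A t i (last h i))))"

definition mpc_execution :: "mpc_algorithm \<Rightarrow> configuration \<Rightarrow> configuration list pmf" where
  "mpc_execution A c =
     bind_pmf (mpc_rounds A c (num_rounds A)) (\<lambda>h.
       map_pmf (\<lambda>y. h @ [y])
         (Pi_pmf {..<num_machines A} [] (\<lambda>i. local_output A i (last h i))))"

definition within_memory :: "mpc_algorithm \<Rightarrow> nat \<Rightarrow> configuration list \<Rightarrow> bool" where
  "within_memory A s h \<longleftrightarrow>
     (\<forall>c\<in>set h. \<forall>i<num_machines A. length (c i) \<le> s \<and> (\<forall>x\<in>set (c i). x < 2 ^ word_bits A))"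

text \<open>The total space is the peak number of words held by a machine, summed over all machines.\<close>

definition total_space :: "mpc_algorithm \<Rightarrow> configuration list \<Rightarrow> nat" where
  "total_space A h = (\<Sum>i<num_machines A. Max ((\<lambda>c. length (c i)) ` set h))"

text \<open>Both the input edges and the output (vertex, cluster name) pairs take two words each.\<close>

definition pair_words :: "(nat \<times> nat) list \<Rightarrow> memory" where
  "pair_words xs = concat (map (\<lambda>(u, v). [u, v]) xs)"

definition distributes ::
  "nat \<Rightarrow> nat \<Rightarrow> (nat \<times> nat) set \<Rightarrow> (nat \<Rightarrow> (nat \<times> nat) list) \<Rightarrow> bool" where
  "distributes M s E D \<longleftrightarrow>
     distinct (concat (map D [0..<M])) \<and> set (concat (map D [0..<M])) = E \<and>
     (\<forall>i<M. length (pair_words (D i)) \<le> s)"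

text \<open>An arbitrary distribution of the input, given as a function of the graph. It has to respect
  the local memories whenever this is possible at all.\<close>

definition input_distribution ::
  "nat \<Rightarrow> nat \<Rightarrow> ((nat \<times> nat) set \<Rightarrow> nat \<Rightarrow> (nat \<times> nat) list) \<Rightarrow> bool" where
  "input_distribution M s D \<longleftrightarrow>
     (\<forall>E. (\<exists>D'. distributes M s E D') \<longrightarrow> distributes M s E (D E))"

text \<open>The output is distributed over the machines. It names exactly one cluster for each vertex,
  and the sets of vertices that get the same name are the clusters in \<open>P\<close>.\<close>

definition outputs_clusters :: "nat \<Rightarrow> configuration \<Rightarrow> nat set set \<Rightarrow> bool" where
  "outputs_clusters M c P \<longleftrightarrow>
     (\<exists>L. (\<forall>i<M. c i = pair_words (L i)) \<and>
          single_valued (\<Union>i<M. set (L i)) \<and>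
          (\<lambda>a. {v. (v, a) \<in> (\<Union>i<M. set (L i))}) ` Range (\<Union>i<M. set (L i)) = P)"

text \<open>The random graph together with the history of the execution on it; the coins of the
  machines are independent of the graph.\<close>

definition SBM_execution ::
  "mpc_algorithm \<Rightarrow> ((nat \<times> nat) set \<Rightarrow> nat \<Rightarrow> (nat \<times> nat) list) \<Rightarrow>
   (nat \<times> nat) set pmf \<Rightarrow> ((nat \<times> nat) set \<times> configuration list) pmf" where
  "SBM_execution A D G =
     bind_pmf G (\<lambda>E. map_pmf (\<lambda>h. (E, h)) (mpc_execution A (\<lambda>i. pair_words (D E i))))"

text \<open>If there are too few machines to hold the input, or if some machine exceeds its memory, the
  execution counts as a failure. The parameter \<open>B\<close> bounds the total space in terms of the number
  of edges.\<close>

definition succeeds ::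
  "mpc_algorithm \<Rightarrow> nat \<Rightarrow> ((nat \<times> nat) set \<Rightarrow> nat \<Rightarrow> (nat \<times> nat) list) \<Rightarrow> nat set set \<Rightarrow>
   (nat \<Rightarrow> real) \<Rightarrow> (nat \<times> nat) set \<Rightarrow> configuration list \<Rightarrow> bool" where
  "succeeds A s D P B E h \<longleftrightarrow>
     distributes (num_machines A) s E (D E) \<and>
     within_memory A s h \<and>
     real (total_space A h) \<le> B (card E) \<and>
     outputs_clusters (num_machines A) (last h) P"

end

theory Submission
  imports Defs
begin

text \<open>Keep every edge independently with probability \<open>1 / k\<close>; the gap condition is just strong enough that
  in the sparsified graph two vertices of the same cluster still have, with high probability, at
  least \<open>\<tau>\<close> common neighbours, and two vertices of different clusters fewer than \<open>\<tau>\<close>. Draw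
  \<open>K = O(k ln n)\<close> uniformly random reference vertices, so that every cluster contains one of them,
  and name each vertex after the first reference vertex with which it has at least \<open>\<tau>\<close> common
  neighbours. Sparsification makes this cheap: each of the \<open>O(m / k)\<close> surviving edges is copied to
  all \<open>K\<close> slots, and each of the \<open>K\<close> reference vertices has \<open>O(d / k)\<close> neighbours, where \<open>d\<close> is the
  expected degree, each of which is announced to all \<open>k n\<close> vertices; both amount to
  \<open>O(m ln n)\<close> words. Copying, counting common neighbours and finding the first matching slot are
  done along \<open>s\<close>-ary trees of height \<open>O(log\<^sub>s n)\<close>. If a single machine can hold the whole graph,
  it computes the answer locally. This is needed because for \<open>s\<close> beyond a fixed power of \<open>n\<close> the
  bound \<open>O(log\<^sub>s n)\<close> allows no round at all.\<close>

section \<open>Concentration\<close>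

lemma exp_le_quadratic:
  fixes x :: real
  assumes "\<bar>x\<bar> \<le> 1"
  shows "exp x \<le> 1 + x + x\<^sup>2"
proof (cases "x \<ge> 0")
  case True
  then show ?thesis using exp_bound[of x] assms by auto
next
  case False
  define y where "y = - x"
  have y: "0 < y" "y \<le> 1" using False assms by (auto simp: y_def)
  have "1 \<le> (1 - y + y\<^sup>2) * (1 + y)"
    using y by (simp add: algebra_simps power2_eq_square)
  also have "\<dots> \<le> (1 - y + y\<^sup>2) * exp y"
    using y exp_ge_add_one_self[of y] by (intro mult_left_mono) auto
  finally have "exp (- y) \<le> 1 - y + y\<^sup>2"
    by (simp add: exp_minus field_simps)
  then show ?thesis by (simp add: y_def)
qed

text \<open>The parameter \<open>\<sigma> = \<plusminus>1\<close> selects the upper or the lower tail.\<close>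

lemma chernoff:
  fixes P :: "'a pmf" and Y :: "'w \<Rightarrow> 'a \<Rightarrow> bool" and \<sigma> U t :: real
  assumes indep: "prob_space.indep_vars (measure_pmf P) (\<lambda>_. count_space UNIV) Y W"
    and fin: "finite W"
    and mu: "\<mu> = (\<Sum>w\<in>W. measure_pmf.prob P {x. Y w x})"
    and U: "\<mu> \<le> U" "0 < U" and t: "0 \<le> t" "t \<le> 2 * U" and \<sigma>: "\<bar>\<sigma>\<bar> = 1"
  shows "measure_pmf.prob P {x. \<sigma> * (real (card {w\<in>W. Y w x}) - \<mu>) \<ge> t} \<le> exp (- t\<^sup>2 / (4 * U))"
proof -
  define l where "l = t / (2 * U)"
  have l: "0 \<le> l" "l \<le> 1" using t U by (auto simp: l_def)
  have sq: "\<sigma>\<^sup>2 = 1" using \<sigma> by (metis power2_abs one_power2)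
  define \<pi> where "\<pi> w = measure_pmf.prob P {x. Y w x}" for w
  define Z where "Z w x = exp (l * \<sigma> * of_bool (Y w x))" for w x
  have bnd: "norm (Z w x) \<le> exp 1" for w x
    using l \<sigma> by (auto simp: Z_def abs_if split: if_splits)
  have intZ: "integrable (measure_pmf P) (Z w)" for w
    by (rule measure_pmf.integrable_const_bound[where B="exp 1"]) (use bnd in auto)
  have indZ: "prob_space.indep_vars (measure_pmf P) (\<lambda>_. borel) Z W"
    unfolding Z_def
    by (rule prob_space.indep_vars_compose2[OF measure_pmf.prob_space_axioms indep]) auto
  have EZ: "measure_pmf.expectation P (Z w) \<le> exp (\<pi> w * (l * \<sigma> + l\<^sup>2))" for w
  proof -
    have eq: "Z w = (\<lambda>x. 1 + (exp (l * \<sigma>) - 1) * indicator {x. Y w x} x)"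
      by (auto simp: Z_def indicator_def fun_eq_iff)
    have "integrable (measure_pmf P) (\<lambda>x. (exp (l * \<sigma>) - 1) * indicator {x. Y w x} x)"
      by (intro integrable_mult_right measure_pmf.integrable_const_bound[where B=1]) auto
    then have "measure_pmf.expectation P (Z w) = 1 + (exp (l * \<sigma>) - 1) * \<pi> w"
      unfolding eq by (subst Bochner_Integration.integral_add) (auto simp: \<pi>_def)
    also have "\<dots> \<le> 1 + (l * \<sigma> + l\<^sup>2) * \<pi> w"
      using exp_le_quadratic[of "l * \<sigma>"] l \<sigma> sq
      by (intro add_left_mono mult_right_mono) (auto simp: \<pi>_def abs_mult power_mult_distrib)
    also have "\<dots> \<le> exp (\<pi> w * (l * \<sigma> + l\<^sup>2))"
      by (metis exp_ge_add_one_self mult.commute)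
    finally show ?thesis .
  qed
  have prodZ: "(\<Prod>w\<in>W. Z w x) = exp (l * \<sigma> * real (card {w\<in>W. Y w x}))" for x
    using fin by (simp add: Z_def exp_sum[symmetric] sum_distrib_left[symmetric] sum.If_cases of_bool_def Int_def)
  have EP: "measure_pmf.expectation P (\<lambda>x. \<Prod>w\<in>W. Z w x) \<le> exp (\<mu> * (l * \<sigma> + l\<^sup>2))"
  proof -
    have "measure_pmf.expectation P (\<lambda>x. \<Prod>w\<in>W. Z w x) = (\<Prod>w\<in>W. measure_pmf.expectation P (Z w))"
      by (rule prob_space.indep_vars_lebesgue_integral[OF measure_pmf.prob_space_axioms fin indZ intZ])
    also have "\<dots> \<le> (\<Prod>w\<in>W. exp (\<pi> w * (l * \<sigma> + l\<^sup>2)))"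
      using EZ by (intro prod_mono conjI integral_nonneg_AE) (auto simp: Z_def)
    also have "\<dots> = exp (\<mu> * (l * \<sigma> + l\<^sup>2))"
      using fin by (simp add: exp_sum[symmetric] mu \<pi>_def sum_distrib_right)
    finally show ?thesis .
  qed
  have intP: "integrable (measure_pmf P) (\<lambda>x. \<Prod>w\<in>W. Z w x)"
    by (rule prob_space.indep_vars_integrable[OF measure_pmf.prob_space_axioms fin indZ intZ])
  let ?c = "exp (l * (t + \<sigma> * \<mu>))"
  have "measure_pmf.prob P {x. \<sigma> * (real (card {w\<in>W. Y w x}) - \<mu>) \<ge> t}
      \<le> measure_pmf.prob P {x\<in>space (measure_pmf P). ?c \<le> (\<Prod>w\<in>W. Z w x)}"
  proof (rule measure_pmf.finite_measure_mono, safe)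
    fix x assume "\<sigma> * (real (card {w\<in>W. Y w x}) - \<mu>) \<ge> t"
    then have "t + \<sigma> * \<mu> \<le> \<sigma> * real (card {w\<in>W. Y w x})" by (simp add: algebra_simps)
    from mult_left_mono[OF this l(1)] show "?c \<le> (\<Prod>w\<in>W. Z w x)"
      unfolding prodZ by (simp add: mult.assoc)
  qed auto
  also have "\<dots> \<le> measure_pmf.expectation P (\<lambda>x. \<Prod>w\<in>W. Z w x) / ?c"
    by (rule integral_Markov_inequality_measure[OF intP, where A="{}"])
       (auto simp: Z_def prod_nonneg)
  also have "\<dots> \<le> exp (\<mu> * (l * \<sigma> + l\<^sup>2)) / ?c"
    using EP by (intro divide_right_mono) auto
  also have "\<dots> = exp (\<mu> * l\<^sup>2 - l * t)"
    by (simp add: exp_diff[symmetric] algebra_simps)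
  also have "\<dots> \<le> exp (U * l\<^sup>2 - l * t)"
    using U by (simp add: mult_right_mono)
  also have "U * l\<^sup>2 - l * t = - t\<^sup>2 / (4 * U)"
    using U by (simp add: l_def power2_eq_square field_simps)
  finally show ?thesis .
qed

lemma indep_vars_Pi_pmf_blocks:
  assumes fin: "finite I" and K: "\<And>j. j \<in> L \<Longrightarrow> K j \<subseteq> I" "disjoint_family_on K L"
    and dep: "\<And>j x y. j \<in> L \<Longrightarrow> (\<And>i. i \<in> K j \<Longrightarrow> x i = y i) \<Longrightarrow> f j x = f j y"
    and countK: "\<And>j. j \<in> L \<Longrightarrow> finite (K j)"
  shows "prob_space.indep_vars (measure_pmf (Pi_pmf I d p :: ('i \<Rightarrow> bool) pmf))
           (\<lambda>_. count_space UNIV) (f :: 'j \<Rightarrow> ('i \<Rightarrow> bool) \<Rightarrow> bool) L"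
proof -
  have ind: "prob_space.indep_vars (measure_pmf (Pi_pmf I d p))
      (\<lambda>j. PiM (K j) (\<lambda>_. count_space UNIV)) (\<lambda>j x. restrict (\<lambda>i. x i) (K j)) L"
    by (rule prob_space.indep_vars_restrict[OF measure_pmf.prob_space_axioms indep_vars_Pi_pmf[OF fin] K])
  have "prob_space.indep_vars (measure_pmf (Pi_pmf I d p))
      (\<lambda>_. count_space UNIV) (\<lambda>j x. f j (restrict (\<lambda>i. x i) (K j))) L"
  proof (rule prob_space.indep_vars_compose2[OF measure_pmf.prob_space_axioms ind])
    fix j assume j: "j \<in> L"
    have "PiM (K j) (\<lambda>_. count_space UNIV) = (count_space (PiE (K j) (\<lambda>_. UNIV)) :: ('i \<Rightarrow> bool) measure)"
      using countK[OF j] by (rule count_space_PiM_finite) auto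
    then show "f j \<in> PiM (K j) (\<lambda>_. count_space UNIV) \<rightarrow>\<^sub>M count_space UNIV" by simp
  qed
  moreover have "f j (restrict (\<lambda>i. x i) (K j)) = f j x" if "j \<in> L" for j x
    by (rule dep[OF that]) auto
  ultimately show ?thesis
    by (subst prob_space.indep_vars_cong[OF measure_pmf.prob_space_axioms refl _ refl, where Y="\<lambda>j x. f j (restrict (\<lambda>i. x i) (K j))"]) auto
qed

section \<open>The stochastic block model\<close>

definition adj :: "(nat \<times> nat) set \<Rightarrow> nat \<Rightarrow> nat \<Rightarrow> bool" where
  "adj E u v \<longleftrightarrow> (u, v) \<in> E \<or> (v, u) \<in> E"

definition vertex_degree :: "(nat \<times> nat) set \<Rightarrow> nat \<Rightarrow> nat" where
  "vertex_degree E u = card {w. adj E u w}"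

definition common :: "(nat \<times> nat) set \<Rightarrow> nat \<Rightarrow> nat \<Rightarrow> nat" where
  "common E u v = card {w. adj E u w \<and> adj E w v}"

definition same_cluster :: "nat \<Rightarrow> (nat \<Rightarrow> nat set) \<Rightarrow> nat \<Rightarrow> nat \<Rightarrow> bool" where
  "same_cluster k V u v \<longleftrightarrow> (\<exists>i<k. u \<in> V i \<and> v \<in> V i)"

definition normal_pair :: "nat \<Rightarrow> nat \<Rightarrow> nat \<times> nat" where
  "normal_pair u v = (min u v, max u v)"

lemma finite_vertex_pairs [simp]: "finite (vertex_pairs N)"
  by (rule finite_subset[of _ "{..<N} \<times> {..<N}"]) (auto simp: vertex_pairs_def)

lemma adj_sym: "adj E u v \<longleftrightarrow> adj E v u"
  by (auto simp: adj_def)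

lemma adj_less: "E \<subseteq> vertex_pairs N \<Longrightarrow> adj E u v \<Longrightarrow> u < N \<and> v < N \<and> u \<noteq> v"
  by (auto simp: adj_def vertex_pairs_def)

lemma finite_adj: "E \<subseteq> vertex_pairs N \<Longrightarrow> finite {w. adj E u w}"
  by (rule finite_subset[of _ "{..<N}"]) (auto dest: adj_less)

lemma hidden_partition_unique:
  "hidden_partition n k V \<Longrightarrow> i < k \<Longrightarrow> j < k \<Longrightarrow> u \<in> V i \<Longrightarrow> u \<in> V j \<Longrightarrow> i = j"
  unfolding hidden_partition_def disjoint_family_on_def by (metis disjoint_iff lessThan_iff)

lemma hidden_partition_cover: "hidden_partition n k V \<Longrightarrow> u < k * n \<Longrightarrow> \<exists>i<k. u \<in> V i"
  unfolding hidden_partition_def by (metis UN_E lessThan_iff)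

lemma hidden_partition_less: "hidden_partition n k V \<Longrightarrow> i < k \<Longrightarrow> u \<in> V i \<Longrightarrow> u < k * n"
  unfolding hidden_partition_def by blast

lemma prob_union_bound:
  assumes "finite I" "\<And>i. i \<in> I \<Longrightarrow> measure_pmf.prob P {x. A i x} \<le> c"
  shows "measure_pmf.prob P {x. \<exists>i\<in>I. A i x} \<le> real (card I) * c"
proof -
  have "{x. \<exists>i\<in>I. A i x} = (\<Union>i\<in>I. {x. A i x})" by auto
  then have "measure_pmf.prob P {x. \<exists>i\<in>I. A i x} \<le> (\<Sum>i\<in>I. measure_pmf.prob P {x. A i x})"
    using measure_pmf.finite_measure_subadditive_finite[OF assms(1), of "\<lambda>i. {x. A i x}"] by simp
  also have "\<dots> \<le> (\<Sum>i\<in>I. c)" using assms(2) by (rule sum_mono)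
  finally show ?thesis by simp
qed

lemma prob_Pi_pmf_all:
  assumes "finite I" "J \<subseteq> I" "\<And>e. e \<in> I \<Longrightarrow> 0 \<le> \<rho> e \<and> \<rho> e \<le> 1"
  shows "measure_pmf.prob (Pi_pmf I d (\<lambda>e. bernoulli_pmf (\<rho> e))) {x. \<forall>e\<in>J. x e} = (\<Prod>e\<in>J. \<rho> e)"
proof -
  have "{x. \<forall>e\<in>J. x e} = Pi I (\<lambda>e. if e \<in> J then {True} else UNIV)"
    using assms(2) by (auto simp: Pi_def split: if_splits)
  then have "measure_pmf.prob (Pi_pmf I d (\<lambda>e. bernoulli_pmf (\<rho> e))) {x. \<forall>e\<in>J. x e}
      = (\<Prod>e\<in>I. measure_pmf.prob (bernoulli_pmf (\<rho> e)) (if e \<in> J then {True} else UNIV))"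
    using assms(1) by (simp add: measure_Pi_pmf_Pi)
  also have "\<dots> = (\<Prod>e\<in>I. if e \<in> J then \<rho> e else 1)"
    using assms(3) by (intro prod.cong) (auto simp: measure_pmf_single)
  also have "\<dots> = (\<Prod>e\<in>J. \<rho> e)"
    using assms(1,2) by (subst prod.inter_restrict[symmetric]) (auto simp: Int_absorb1)
  finally show ?thesis .
qed

definition separates :: "nat \<Rightarrow> nat \<Rightarrow> (nat \<Rightarrow> nat set) \<Rightarrow> real \<Rightarrow> (nat \<times> nat) set \<Rightarrow> bool" where
  "separates N k V \<tau> E \<longleftrightarrow>
     (\<forall>u<N. \<forall>v<N. u \<noteq> v \<longrightarrow> (\<tau> \<le> real (common E u v) \<longleftrightarrow> same_cluster k V u v))"

locale sbm =
  fixes n k :: nat and p q :: real and V :: "nat \<Rightarrow> nat set"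
  assumes part: "hidden_partition n k V" and q: "0 < q" and qp: "q < p" and p1: "p < 1"
    and n2: "2 \<le> n" and k1: "1 \<le> k"
begin

abbreviation "N \<equiv> k * n"
abbreviation "same \<equiv> same_cluster k V"

definition edge_prob :: "nat \<Rightarrow> nat \<Rightarrow> real" where
  "edge_prob u v = (if same u v then p else q)"

definition mean_degree :: real where
  "mean_degree = real n * p + (real N - real n) * q"

text \<open>The midpoint between the expected numbers of common neighbours of two vertices in different
  clusters and in the same cluster.\<close>

definition threshold :: real where
  "threshold = 2 * real n * p * q + (real N - 2 * real n) * q\<^sup>2 + real n * (p - q)\<^sup>2 / 2"

lemma N_ge_n: "n \<le> N" using k1 by simp

lemma cluster: assumes "u < N" obtains i where "i < k" "u \<in> V i"
  using hidden_partition_cover[OF part assms] by blast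

lemma cluster_unique: "i < k \<Longrightarrow> j < k \<Longrightarrow> u \<in> V i \<Longrightarrow> u \<in> V j \<Longrightarrow> i = j"
  by (rule hidden_partition_unique[OF part])

lemma cluster_subset: "i < k \<Longrightarrow> V i \<subseteq> {..<N}"
  using hidden_partition_less[OF part] by blast

lemma card_cluster: "i < k \<Longrightarrow> card (V i) = n"
  using part unfolding hidden_partition_def by blast

lemma finite_cluster: "i < k \<Longrightarrow> finite (V i)"
  using cluster_subset finite_subset by blast

lemma same_iff: "i < k \<Longrightarrow> u \<in> V i \<Longrightarrow> same u w \<longleftrightarrow> w \<in> V i"
  using cluster_unique by (auto simp: same_cluster_def)

lemma same_refl: "u < N \<Longrightarrow> same u u"
  by (metis cluster same_cluster_def)

lemma same_sym: "same u v \<longleftrightarrow> same v u"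
  by (auto simp: same_cluster_def)

lemma edge_prob_sym: "edge_prob u v = edge_prob v u"
  by (simp add: edge_prob_def same_sym)

lemma edge_prob_bounds: "0 < edge_prob u v" "edge_prob u v \<le> p" "edge_prob u v \<le> 1"
  using q qp p1 by (auto simp: edge_prob_def)

lemma sum_edge_prob:
  assumes u: "u < N"
  shows "(\<Sum>w<N. edge_prob u w) = mean_degree"
proof -
  obtain i where i: "i < k" "u \<in> V i" using cluster u by metis
  have "(\<Sum>w<N. edge_prob u w) = (\<Sum>w<N. if w \<in> V i then p else q)"
    using same_iff[OF i] by (simp add: edge_prob_def)
  also have "\<dots> = real n * p + real (card ({..<N} - V i)) * q"
    using cluster_subset[OF i(1)] card_cluster[OF i(1)]
    by (subst sum.If_cases) (auto simp: Int_absorb1 Diff_eq[symmetric])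
  also have "card ({..<N} - V i) = N - n"
    using card_Diff_subset[OF finite_cluster cluster_subset] i card_cluster by simp
  finally show ?thesis using N_ge_n by (simp add: mean_degree_def of_nat_diff)
qed

lemma sum_edge_prob_same:
  assumes u: "u < N" and s: "same u v"
  shows "(\<Sum>w<N. edge_prob u w * edge_prob v w) = threshold + real n * (p - q)\<^sup>2 / 2"
proof -
  obtain i where i: "i < k" "u \<in> V i" "v \<in> V i" using s by (auto simp: same_cluster_def)
  have "(\<Sum>w<N. edge_prob u w * edge_prob v w) = (\<Sum>w<N. if w \<in> V i then p\<^sup>2 else q\<^sup>2)"
    using same_iff i by (intro sum.cong) (auto simp: edge_prob_def power2_eq_square)
  also have "\<dots> = real n * p\<^sup>2 + real (card ({..<N} - V i)) * q\<^sup>2"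
    using cluster_subset[OF i(1)] card_cluster[OF i(1)]
    by (subst sum.If_cases) (auto simp: Int_absorb1 Diff_eq[symmetric])
  also have "card ({..<N} - V i) = N - n"
    using card_Diff_subset[OF finite_cluster cluster_subset] i card_cluster by simp
  finally show ?thesis using N_ge_n
    by (simp add: threshold_def of_nat_diff power2_eq_square field_simps)
qed

lemma sum_edge_prob_diff:
  assumes u: "u < N" "v < N" and s: "\<not> same u v"
  shows "(\<Sum>w<N. edge_prob u w * edge_prob v w) = threshold - real n * (p - q)\<^sup>2 / 2"
proof -
  obtain i where i: "i < k" "u \<in> V i" using cluster u by metis
  obtain j where j: "j < k" "v \<in> V j" using cluster u by metis
  have ij: "V i \<inter> V j = {}" using s i j cluster_unique
    by (metis disjoint_iff same_iff)
  define C where "C = V i \<union> V j"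
  have c2: "card C = 2 * n" unfolding C_def
    using card_Un_disjoint[OF finite_cluster finite_cluster ij] i j card_cluster by simp
  have CN: "C \<subseteq> {..<N}" "finite C"
    using cluster_subset i j finite_cluster by (auto simp: C_def)
  have "(\<Sum>w<N. edge_prob u w * edge_prob v w) = (\<Sum>w<N. if w \<in> C then p * q else q\<^sup>2)"
    using same_iff[OF i] same_iff[OF j] ij
    by (intro sum.cong) (auto simp: edge_prob_def power2_eq_square C_def)
  also have "\<dots> = real (2 * n) * (p * q) + real (card ({..<N} - C)) * q\<^sup>2"
    using CN(1) c2 by (subst sum.If_cases) (auto simp: Int_absorb1 Diff_eq[symmetric])
  also have "card ({..<N} - C) = N - 2 * n"
    using card_Diff_subset[OF CN(2,1)] c2 by simp
  also have "real (N - 2 * n) = real N - 2 * real n"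
  proof -
    have "2 * n \<le> N" using card_mono[OF _ CN(1)] c2 by simp
    then show ?thesis by (simp add: of_nat_diff)
  qed
  finally show ?thesis
    by (simp add: threshold_def power2_eq_square field_simps)
qed

lemma threshold_pos: "0 < threshold"
proof -
  have "2 * real n * p * q + (real N - 2 * real n) * q\<^sup>2 \<ge> 2 * real n * p * q + (real n - 2 * real n) * q\<^sup>2"
    using of_nat_mono[OF N_ge_n, where 'a=real]
    by (intro add_left_mono mult_right_mono diff_right_mono) auto
  moreover have "2 * real n * p * q + (real n - 2 * real n) * q\<^sup>2 = real n * q * (2 * p - q)"
    by (simp add: power2_eq_square algebra_simps)
  moreover have "real n * q * (2 * p - q) > 0" using n2 q qp by simp
  moreover have "real n * (p - q)\<^sup>2 / 2 \<ge> 0" by simp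
  ultimately show ?thesis unfolding threshold_def by linarith
qed

abbreviation "G \<equiv> SBM n p q k V"
abbreviation "coins \<equiv> Pi_pmf (vertex_pairs N) False (\<lambda>(u, v). bernoulli_pmf (edge_prob u v))"

lemma G_eq: "G = map_pmf (\<lambda>x. {e \<in> vertex_pairs N. x e}) coins"
  unfolding SBM_def by (simp add: edge_prob_def same_cluster_def)

lemma prob_G: "measure_pmf.prob G A = measure_pmf.prob coins {x. {e \<in> vertex_pairs N. x e} \<in> A}"
  by (simp add: G_eq vimage_def)

lemma set_G: "E \<in> set_pmf G \<Longrightarrow> E \<subseteq> vertex_pairs N"
  by (auto simp: G_eq)

lemma prob_coins_all:
  "J \<subseteq> vertex_pairs N \<Longrightarrow> measure_pmf.prob coins {x. \<forall>e\<in>J. x e} = (\<Prod>(u, v)\<in>J. edge_prob u v)"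
  using prob_Pi_pmf_all[of "vertex_pairs N" J "\<lambda>(u, v). edge_prob u v" False] edge_prob_bounds
  by (auto simp: less_imp_le case_prod_unfold)

lemma normal_pair_in: "u < N \<Longrightarrow> v < N \<Longrightarrow> u \<noteq> v \<Longrightarrow> normal_pair u v \<in> vertex_pairs N"
  by (auto simp: normal_pair_def vertex_pairs_def)

lemma normal_pair_eq_iff: "normal_pair u v = normal_pair u' v' \<longleftrightarrow> (u = u' \<and> v = v') \<or> (u = v' \<and> v = u')"
  by (auto simp: normal_pair_def min_def max_def split: if_splits)

lemma edge_prob_normal_pair: "(case normal_pair u v of (a, b) \<Rightarrow> edge_prob a b) = edge_prob u v"
  by (auto simp: normal_pair_def min_def max_def edge_prob_sym)

lemma adj_random: "adj {e \<in> vertex_pairs N. x e} u v \<longleftrightarrow> u < N \<and> v < N \<and> u \<noteq> v \<and> x (normal_pair u v)"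
  by (auto simp: adj_def vertex_pairs_def normal_pair_def min_def max_def)

lemma degree_tail:
  fixes \<sigma> t :: real
  assumes u: "u < N" and t: "0 \<le> t" "t \<le> 2 * mean_degree" and \<sigma>: "\<bar>\<sigma>\<bar> = 1"
  shows "measure_pmf.prob G {E. \<sigma> * (real (vertex_degree E u) - (mean_degree - p)) \<ge> t}
           \<le> exp (- t\<^sup>2 / (4 * mean_degree))"
proof -
  let ?W = "{..<N} - {u}"
  have eq: "{w. adj {e \<in> vertex_pairs N. x e} u w} = {w\<in>?W. x (normal_pair u w)}" for x
    using u by (auto simp: adj_random)
  have md: "0 < mean_degree" unfolding mean_degree_def using q qp n2 N_ge_n
    by (intro add_pos_nonneg mult_pos_pos mult_nonneg_nonneg) auto
  have mu: "mean_degree - p = (\<Sum>w\<in>?W. measure_pmf.prob coins {x. x (normal_pair u w)})"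
  proof -
    have "(\<Sum>w\<in>?W. measure_pmf.prob coins {x. x (normal_pair u w)}) = (\<Sum>w\<in>?W. edge_prob u w)"
      using prob_coins_all[of "{normal_pair u w}" for w] u normal_pair_in edge_prob_normal_pair
      by (intro sum.cong) auto
    also have "\<dots> = mean_degree - p"
      using sum_edge_prob[OF u] u same_refl[OF u] by (simp add: sum_diff1 edge_prob_def)
    finally show ?thesis by simp
  qed
  have "prob_space.indep_vars (measure_pmf coins) (\<lambda>_. count_space UNIV) (\<lambda>w x. x (normal_pair u w)) ?W"
    using u normal_pair_in normal_pair_eq_iff
    by (intro indep_vars_Pi_pmf_blocks[where K="\<lambda>w. {normal_pair u w}"])
       (auto simp: disjoint_family_on_def)
  from chernoff[OF this _ mu _ md t \<sigma>]
  show ?thesis unfolding prob_G vertex_degree_def mem_Collect_eq eq using q qp by simp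
qed

lemma common_tail:
  fixes \<sigma> t U :: real
  assumes u: "u < N" "v < N" "u \<noteq> v" and t: "0 \<le> t" "t \<le> 2 * U" and \<sigma>: "\<bar>\<sigma>\<bar> = 1"
    and mu: "\<mu> = (\<Sum>w\<in>{..<N} - {u, v}. edge_prob u w * edge_prob v w)" and U: "\<mu> \<le> U" "0 < U"
  shows "measure_pmf.prob G {E. \<sigma> * (real (common E u v) - \<mu>) \<ge> t} \<le> exp (- t\<^sup>2 / (4 * U))"
proof -
  let ?W = "{..<N} - {u, v}"
  let ?Y = "\<lambda>w x. x (normal_pair u w) \<and> x (normal_pair v w)"
  have eq: "{w. adj {e \<in> vertex_pairs N. x e} u w \<and> adj {e \<in> vertex_pairs N. x e} w v} = {w\<in>?W. ?Y w x}" for x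
    using u by (subst adj_sym[of _ _ v]) (auto simp: adj_random)
  have mu': "\<mu> = (\<Sum>w\<in>?W. measure_pmf.prob coins {x. ?Y w x})"
    unfolding mu
  proof (rule sum.cong[OF refl])
    fix w assume w: "w \<in> ?W"
    have "normal_pair u w \<noteq> normal_pair v w" using u w by (auto simp: normal_pair_eq_iff)
    then show "edge_prob u w * edge_prob v w = measure_pmf.prob coins {x. ?Y w x}"
      using prob_coins_all[of "{normal_pair u w, normal_pair v w}"] u w normal_pair_in edge_prob_normal_pair
      by simp
  qed
  have "prob_space.indep_vars (measure_pmf coins) (\<lambda>_. count_space UNIV) ?Y ?W"
    using u normal_pair_in normal_pair_eq_iff
    by (intro indep_vars_Pi_pmf_blocks[where K="\<lambda>w. {normal_pair u w, normal_pair v w}"])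
       (auto simp: disjoint_family_on_def)
  from chernoff[OF this _ mu' U t \<sigma>]
  show ?thesis unfolding prob_G common_def mem_Collect_eq eq by simp
qed

lemma mean_degree_ge: "2 * p \<le> mean_degree"
proof -
  have "2 * p \<le> real n * p" using n2 q qp by (intro mult_right_mono) auto
  moreover have "0 \<le> (real N - real n) * q"
    using of_nat_mono[OF N_ge_n, where 'a=real] q by (intro mult_nonneg_nonneg) auto
  ultimately show ?thesis unfolding mean_degree_def by linarith
qed

lemma prob_degree_large:
  "measure_pmf.prob G {E. \<exists>u\<in>{..<N}. real (vertex_degree E u) \<ge> 2 * mean_degree} \<le> real N * exp (- mean_degree / 4)"
proof -
  have md: "0 < mean_degree" using mean_degree_ge q qp by linarith
  have "measure_pmf.prob G {E. real (vertex_degree E u) \<ge> 2 * mean_degree} \<le> exp (- mean_degree / 4)"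
    if u: "u \<in> {..<N}" for u
  proof -
    have "measure_pmf.prob G {E. real (vertex_degree E u) \<ge> 2 * mean_degree}
        \<le> measure_pmf.prob G {E. 1 * (real (vertex_degree E u) - (mean_degree - p)) \<ge> mean_degree}"
      using q qp by (intro measure_pmf.finite_measure_mono) auto
    also have "\<dots> \<le> exp (- mean_degree\<^sup>2 / (4 * mean_degree))"
      using u md by (intro degree_tail) auto
    also have "- mean_degree\<^sup>2 / (4 * mean_degree) = - mean_degree / 4"
      using md by (simp add: power2_eq_square)
    finally show ?thesis .
  qed
  from prob_union_bound[of "{..<N}" G "\<lambda>u E. real (vertex_degree E u) \<ge> 2 * mean_degree", OF _ this] show ?thesis by simp
qed

lemma prob_degree_small:
  "measure_pmf.prob G {E. \<exists>u\<in>{..<N}. real (vertex_degree E u) \<le> mean_degree / 4} \<le> real N * exp (- mean_degree / 64)"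
proof -
  have md: "0 < mean_degree" using mean_degree_ge q qp by linarith
  have "measure_pmf.prob G {E. real (vertex_degree E u) \<le> mean_degree / 4} \<le> exp (- mean_degree / 64)"
    if u: "u \<in> {..<N}" for u
  proof -
    have "measure_pmf.prob G {E. real (vertex_degree E u) \<le> mean_degree / 4}
        \<le> measure_pmf.prob G {E. (-1) * (real (vertex_degree E u) - (mean_degree - p)) \<ge> mean_degree / 4}"
      using mean_degree_ge by (intro measure_pmf.finite_measure_mono) auto
    also have "\<dots> \<le> exp (- (mean_degree / 4)\<^sup>2 / (4 * mean_degree))"
      using u md by (intro degree_tail) auto
    also have "- (mean_degree / 4)\<^sup>2 / (4 * mean_degree) = - mean_degree / 64"
      using md by (simp add: power2_eq_square)
    finally show ?thesis .
  qed
  from prob_union_bound[of "{..<N}" G "\<lambda>u E. real (vertex_degree E u) \<le> mean_degree / 4", OF _ this] show ?thesis by simp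
qed

lemma prob_not_separates:
  assumes gap: "8 * p\<^sup>2 \<le> real n * (p - q)\<^sup>2"
  shows "measure_pmf.prob G {E. \<not> separates N k V threshold E}
           \<le> (real N)\<^sup>2 * exp (- (real n * (p - q)\<^sup>2)\<^sup>2 / (64 * (real N * p\<^sup>2)))"
proof -
  define g where "g = real n * (p - q)\<^sup>2"
  define U where "U = real N * p\<^sup>2"
  have N0: "0 < N" using n2 k1 by auto
  have U0: "0 < U" using N0 q qp by (simp add: U_def)
  have g0: "0 < g" using n2 qp by (simp add: g_def)
  have "(p - q)\<^sup>2 \<le> p\<^sup>2" using q qp by (intro power_mono) auto
  then have gU: "g \<le> U"
    unfolding g_def U_def using of_nat_mono[OF N_ge_n, where 'a=real] by (intro mult_mono) auto
  have bad: "measure_pmf.prob G {E. \<not> (threshold \<le> real (common E (fst e) (snd e)) \<longleftrightarrow> same (fst e) (snd e))}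
      \<le> exp (- g\<^sup>2 / (64 * U))"
    if e: "e \<in> {e \<in> {..<N} \<times> {..<N}. fst e \<noteq> snd e}" for e
  proof -
    obtain u v where uv: "e = (u, v)" by fastforce
    have u: "u < N" "v < N" "u \<noteq> v" using e uv by auto
    define \<mu> where "\<mu> = (\<Sum>w\<in>{..<N} - {u, v}. edge_prob u w * edge_prob v w)"
    have full: "(\<Sum>w<N. edge_prob u w * edge_prob v w) = \<mu> + (\<Sum>w\<in>{u, v}. edge_prob u w * edge_prob v w)"
      unfolding \<mu>_def using u by (intro sum.subset_diff) auto
    have pp: "0 \<le> edge_prob u w * edge_prob v w" "edge_prob u w * edge_prob v w \<le> p\<^sup>2" for w
      using edge_prob_bounds[of u w] edge_prob_bounds[of v w] by (auto simp: power2_eq_square intro!: mult_mono)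
    have rem: "0 \<le> (\<Sum>w\<in>{u, v}. edge_prob u w * edge_prob v w)"
       "(\<Sum>w\<in>{u, v}. edge_prob u w * edge_prob v w) \<le> 2 * p\<^sup>2"
      using u pp(1)[of u] pp(1)[of v] pp(2)[of u] pp(2)[of v] by auto
    have muU: "\<mu> \<le> U"
    proof -
      have "(\<Sum>w<N. edge_prob u w * edge_prob v w) \<le> (\<Sum>w<N. p\<^sup>2)" by (intro sum_mono pp)
      then show ?thesis using full rem by (simp add: U_def)
    qed
    show ?thesis
    proof (cases "same u v")
      case True
      have mu: "threshold + g / 4 \<le> \<mu>"
        using sum_edge_prob_same[OF u(1) True] full rem gap by (simp add: g_def)
      have "measure_pmf.prob G {E. \<not> (threshold \<le> real (common E (fst e) (snd e)) \<longleftrightarrow> same (fst e) (snd e))}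
          \<le> measure_pmf.prob G {E. (-1) * (real (common E u v) - \<mu>) \<ge> g / 4}"
        using mu True uv by (intro measure_pmf.finite_measure_mono) auto
      also have "\<dots> \<le> exp (- (g / 4)\<^sup>2 / (4 * U))"
        using u g0 gU U0 muU by (intro common_tail[OF u _ _ _ \<mu>_def]) auto
      also have "- (g / 4)\<^sup>2 / (4 * U) = - g\<^sup>2 / (64 * U)"
        by (simp add: power2_eq_square)
      finally show ?thesis .
    next
      case False
      have mu: "\<mu> \<le> threshold - g / 4"
        using sum_edge_prob_diff[OF u(1,2) False] full rem g0 by (simp add: g_def)
      have "measure_pmf.prob G {E. \<not> (threshold \<le> real (common E (fst e) (snd e)) \<longleftrightarrow> same (fst e) (snd e))}
          \<le> measure_pmf.prob G {E. 1 * (real (common E u v) - \<mu>) \<ge> g / 4}"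
        using mu False uv by (intro measure_pmf.finite_measure_mono) auto
      also have "\<dots> \<le> exp (- (g / 4)\<^sup>2 / (4 * U))"
        using u g0 gU U0 muU by (intro common_tail[OF u _ _ _ \<mu>_def]) auto
      also have "- (g / 4)\<^sup>2 / (4 * U) = - g\<^sup>2 / (64 * U)"
        by (simp add: power2_eq_square)
      finally show ?thesis .
    qed
  qed
  have "measure_pmf.prob G {E. \<not> separates N k V threshold E}
      \<le> measure_pmf.prob G {E. \<exists>e\<in>{e \<in> {..<N} \<times> {..<N}. fst e \<noteq> snd e}.
           \<not> (threshold \<le> real (common E (fst e) (snd e)) \<longleftrightarrow> same (fst e) (snd e))}"
    by (intro measure_pmf.finite_measure_mono) (auto simp: separates_def)
  also have "\<dots> \<le> real (card {e \<in> {..<N} \<times> {..<N}. fst e \<noteq> snd e}) * exp (- g\<^sup>2 / (64 * U))"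
    by (rule prob_union_bound[OF _ bad]) auto
  also have "\<dots> \<le> real (card ({..<N} \<times> {..<N})) * exp (- g\<^sup>2 / (64 * U))"
    by (intro mult_right_mono of_nat_mono card_mono) auto
  finally show ?thesis by (simp add: g_def U_def power2_eq_square)
qed

end

lemma bernoulli_pmf_mult:
  assumes "0 \<le> a" "a \<le> 1" "0 \<le> b" "b \<le> 1"
  shows "bernoulli_pmf (a * b) = bind_pmf (bernoulli_pmf b) (\<lambda>x. bind_pmf (bernoulli_pmf a) (\<lambda>y. return_pmf (x \<and> y)))"
proof -
  have "a * b \<le> 1" using assms mult_mono[of a 1 b 1] by simp
  then have "pmf (bernoulli_pmf (a * b)) z
      = pmf (bind_pmf (bernoulli_pmf b) (\<lambda>x. bind_pmf (bernoulli_pmf a) (\<lambda>y. return_pmf (x \<and> y)))) z" for z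
    using assms by (cases z) (simp_all add: pmf_bind measure_pmf_single algebra_simps)
  then show ?thesis by (rule pmf_eqI)
qed

lemma SBM_sparsify:
  assumes "0 \<le> f" "f \<le> 1" "0 \<le> p" "p \<le> 1" "0 \<le> q" "q \<le> 1"
  shows "map_pmf (\<lambda>(E, c). {e \<in> E. c e})
           (pair_pmf (SBM n p q k V) (Pi_pmf (vertex_pairs (k * n)) False (\<lambda>_. bernoulli_pmf f)))
         = SBM n (f * p) (f * q) k V"
proof -
  let ?I = "vertex_pairs (k * n)"
  define \<rho> where "\<rho> = (\<lambda>(u, v). if \<exists>i<k. u \<in> V i \<and> v \<in> V i then p else q)"
  have \<rho>: "0 \<le> \<rho> e \<and> \<rho> e \<le> 1" for e using assms by (auto simp: \<rho>_def split: prod.split)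
  have eq: "(\<lambda>(u, v). bernoulli_pmf (if \<exists>i<k. u \<in> V i \<and> v \<in> V i then f * p else f * q))
      = (\<lambda>e. bernoulli_pmf (f * \<rho> e))"
    "(\<lambda>(u, v). bernoulli_pmf (if \<exists>i<k. u \<in> V i \<and> v \<in> V i then p else q)) = (\<lambda>e. bernoulli_pmf (\<rho> e))"
    by (auto simp: \<rho>_def fun_eq_iff)
  have "Pi_pmf ?I False (\<lambda>e. bernoulli_pmf (f * \<rho> e))
      = bind_pmf (Pi_pmf ?I False (\<lambda>e. bernoulli_pmf (\<rho> e))) (\<lambda>x.
          bind_pmf (Pi_pmf ?I False (\<lambda>_. bernoulli_pmf f)) (\<lambda>c.
            return_pmf (\<lambda>e. if e \<in> ?I then x e \<and> c e else False)))"
    using assms(1,2) \<rho>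
    by (simp add: bernoulli_pmf_mult Pi_pmf_bind[where d'=False])
  then show ?thesis
    unfolding SBM_def eq pair_pmf_def
    by (simp add: map_bind_pmf bind_map_pmf) (simp add: map_pmf_def conj_assoc conj_commute cong: conj_cong)
qed

section \<open>Protocols as MPC algorithms\<close>

lemma Pi_pmf_map_dependent:
  assumes "finite A"
  shows "Pi_pmf A d (\<lambda>i. map_pmf (g i) (p i)) = map_pmf (\<lambda>x i. if i \<in> A then g i (x i) else d) (Pi_pmf A d' p)"
proof -
  have "Pi_pmf A d (\<lambda>i. map_pmf (g i) (p i)) = Pi_pmf A d (\<lambda>i. bind_pmf (p i) (\<lambda>x. return_pmf (g i x)))"
    by (simp add: map_pmf_def)
  also have "\<dots> = map_pmf (\<lambda>x i. if i \<in> A then g i (x i) else d) (Pi_pmf A d' p)"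
    by (subst Pi_pmf_bind[OF assms, where d'=d']) (simp add: assms map_pmf_def)
  finally show ?thesis .
qed

fun unpair_words :: "memory \<Rightarrow> (nat \<times> nat) list" where
  "unpair_words (u # v # xs) = (u, v) # unpair_words xs"
| "unpair_words _ = []"

lemma pair_words_simps [simp]:
  "pair_words [] = []" "pair_words ((u, v) # xs) = u # v # pair_words xs"
  by (simp_all add: pair_words_def)

lemma unpair_pair_words [simp]: "unpair_words (pair_words xs) = xs"
  by (induction xs) auto

lemma length_pair_words [simp]: "length (pair_words xs) = 2 * length xs"
  by (induction xs) auto

lemma set_pair_words: "set (pair_words xs) = fst ` set xs \<union> snd ` set xs"
proof (induction xs)
  case (Cons e xs)
  then show ?case by (cases e) (simp add: insert_commute)
qed simp

lemma length_after_delivery_sum: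
  "(\<Sum>j<M. length (after_delivery M x j)) \<le> (\<Sum>j<M. length (fst (x j))) + (\<Sum>i<M. length (snd (x i)))"
proof -
  have filter_sum: "(\<Sum>j<M. length (filter (\<lambda>m. fst m = j) l)) \<le> length l" for l :: outbox
  proof (induction l)
    case (Cons a l)
    have "(\<Sum>j<M. length (filter (\<lambda>m. fst m = j) (a # l)))
        = (\<Sum>j<M. (if fst a = j then 1 else 0) + length (filter (\<lambda>m. fst m = j) l))"
      by (intro sum.cong) auto
    also have "\<dots> \<le> 1 + length l" unfolding sum.distrib using Cons.IH by (intro add_mono) simp_all
    finally show ?case by simp
  qed simp
  have "(\<Sum>j<M. length (after_delivery M x j))
      = (\<Sum>j<M. length (fst (x j))) + (\<Sum>j<M. \<Sum>i<M. length (filter (\<lambda>m. fst m = j) (snd (x i))))"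
    by (simp add: after_delivery_def length_concat comp_def sum.distrib sum_list_sum_nth atLeast0LessThan)
  also have "(\<Sum>j<M. \<Sum>i<M. length (filter (\<lambda>m. fst m = j) (snd (x i))))
      = (\<Sum>i<M. \<Sum>j<M. length (filter (\<lambda>m. fst m = j) (snd (x i))))"
    by (rule sum.swap)
  also have "\<dots> \<le> (\<Sum>i<M. length (snd (x i)))"
    by (intro sum_mono filter_sum)
  finally show ?thesis by simp
qed

lemma total_space_le:
  assumes "\<And>c. c \<in> set h \<Longrightarrow> (\<Sum>i<num_machines A. length (c i)) \<le> B" and "h \<noteq> []"
  shows "total_space A h \<le> length h * B"
proof -
  have "total_space A h \<le> (\<Sum>i<num_machines A. \<Sum>c\<in>set h. length (c i))"
    unfolding total_space_def
    using assms(2) by (intro sum_mono) (auto intro!: Max.boundedI member_le_sum)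
  also have "\<dots> = (\<Sum>c\<in>set h. \<Sum>i<num_machines A. length (c i))" by (rule sum.swap)
  also have "\<dots> \<le> card (set h) * B" using sum_bounded_above[of "set h" _ B] assms(1) by simp
  also have "\<dots> \<le> length h * B" using card_length by (intro mult_right_mono) auto
  finally show ?thesis .
qed

definition deliver :: "nat \<Rightarrow> (nat \<Rightarrow> nat \<Rightarrow> memory \<Rightarrow> memory \<times> outbox) \<Rightarrow> nat \<Rightarrow> configuration \<Rightarrow> nat \<Rightarrow> memory \<times> outbox" where
  "deliver M F t c = (\<lambda>i. if i < M then F t i (c i) else ([], []))"

primrec det_history ::
  "nat \<Rightarrow> (nat \<Rightarrow> nat \<Rightarrow> memory \<Rightarrow> memory \<times> outbox) \<Rightarrow> configuration \<Rightarrow> nat \<Rightarrow> configuration list" where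
  "det_history M F c 0 = [c]"
| "det_history M F c (Suc t) = det_history M F c t @
     [before_delivery (deliver M F t (last (det_history M F c t))),
      after_delivery M (deliver M F t (last (det_history M F c t)))]"

lemma det_history_cong:
  "(\<And>r. r < t \<Longrightarrow> F r = F' r) \<Longrightarrow> det_history M F c t = det_history M F' c t"
proof (induction t)
  case (Suc t)
  then have eq: "F t = F' t" "det_history M F c t = det_history M F' c t" by simp_all
  have "deliver M F t = deliver M F' t" unfolding deliver_def eq ..
  then show ?case using eq by simp
qed simp

lemma length_det_history [simp]: "length (det_history M F c t) = 2 * t + 1"
  by (induction t) auto

lemma mpc_rounds_coin_in_round_1:
  assumes step: "\<And>t i x. local_step A t i x = map_pmf (\<lambda>c. F c t i x) (if t = 1 then coin i else return_pmf 0)"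
    and indep: "\<And>c t. t \<noteq> 1 \<Longrightarrow> F c t = F 0 t"
  shows "mpc_rounds A c t = map_pmf (\<lambda>\<omega>. det_history (num_machines A) (\<lambda>t i. F (\<omega> i) t i) c t)
           (Pi_pmf {..<num_machines A} (0::nat) coin)"
proof (induction t)
  case 0
  show ?case by (simp add: map_pmf_const)
next
  case (Suc t)
  let ?M = "num_machines A"
  let ?P = "Pi_pmf {..<?M} (0::nat) coin"
  let ?H = "\<lambda>\<omega>. det_history ?M (\<lambda>t i. F (\<omega> i) t i) c"
  have IH: "mpc_rounds A c t = bind_pmf ?P (\<lambda>\<omega>. return_pmf (?H \<omega> t))"
    using Suc.IH by (simp only: map_pmf_def)
  define h0 where "h0 = ?H (\<lambda>_. 0) 1"
  let ?next = "\<lambda>h x. h @ [before_delivery x, after_delivery ?M x]"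
  show ?case
  proof (cases "t = 1")
    case True
    have const: "?H \<omega> 1 = h0" for \<omega>
      unfolding h0_def by (intro det_history_cong ext fun_cong[OF indep]) simp
    have "mpc_rounds A c (Suc 1) = map_pmf (?next h0)
        (Pi_pmf {..<?M} ([], []) (\<lambda>i. map_pmf (\<lambda>c. F c 1 i (last h0 i)) (coin i)))"
      unfolding mpc_rounds.simps IH[unfolded True const] bind_pmf_const bind_return_pmf
      by (simp only: step if_True simp_thms)
    also have "\<dots> = map_pmf (\<lambda>\<omega>. ?next h0 (deliver ?M (\<lambda>t i. F (\<omega> i) t i) 1 (last h0))) ?P"
      by (subst Pi_pmf_map_dependent[where d'=0]) (simp_all add: pmf.map_comp o_def deliver_def del: One_nat_def)
    also have "\<dots> = map_pmf (\<lambda>\<omega>. ?H \<omega> (Suc 1)) ?P"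
      unfolding det_history.simps const ..
    finally show ?thesis unfolding True .
  next
    case False
    have ret: "Pi_pmf {..<?M} ([], []) (\<lambda>i. local_step A t i (last h i))
        = return_pmf (deliver ?M (\<lambda>t i. F (\<omega> i) t i) t (last h))" for h \<omega>
    proof -
      have "local_step A t i (last h i) = return_pmf (F (\<omega> i) t i (last h i))" for i
        unfolding step indep[OF False, of "\<omega> i"] using False by simp
      then show ?thesis by (simp add: deliver_def)
    qed
    have "mpc_rounds A c (Suc t) = bind_pmf ?P (\<lambda>\<omega>. map_pmf (?next (?H \<omega> t))
        (Pi_pmf {..<?M} ([], []) (\<lambda>i. local_step A t i (last (?H \<omega> t) i))))"
      unfolding mpc_rounds.simps IH bind_assoc_pmf bind_return_pmf ..
    also have "\<dots> = bind_pmf ?P (\<lambda>\<omega>. return_pmf (?H \<omega> (Suc t)))"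
    proof (rule bind_pmf_cong[OF refl])
      fix \<omega>
      show "map_pmf (?next (?H \<omega> t)) (Pi_pmf {..<?M} ([], []) (\<lambda>i. local_step A t i (last (?H \<omega> t) i)))
          = return_pmf (?H \<omega> (Suc t))"
        unfolding ret[of "?H \<omega> t" \<omega>] map_return_pmf det_history.simps ..
    qed
    finally show ?thesis unfolding map_pmf_def .
  qed
qed

lemma mpc_execution_coin_in_round_1:
  assumes step: "\<And>t i x. local_step A t i x = map_pmf (\<lambda>c. F c t i x) (if t = 1 then coin i else return_pmf 0)"
    and indep: "\<And>c t. t \<noteq> 1 \<Longrightarrow> F c t = F 0 t"
    and out: "\<And>i x. local_output A i x = return_pmf (f i x)"
  shows "mpc_execution A c = map_pmf (\<lambda>\<omega>.
           let h = det_history (num_machines A) (\<lambda>t i. F (\<omega> i) t i) c (num_rounds A)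
           in h @ [\<lambda>i. if i < num_machines A then f i (last h i) else []])
         (Pi_pmf {..<num_machines A} (0::nat) coin)"
  unfolding mpc_execution_def
  by (simp add: mpc_rounds_coin_in_round_1[OF step indep] out bind_map_pmf Let_def)
     (simp add: map_pmf_def)

text \<open>A protocol runs on abstract nodes, one per machine. In every round a node replaces its memory
  by a value that depends on the set of (sender, value) pairs just received, and sends this value
  to a set of nodes. A message carries its sender: the word \<open>i * Q + a\<close> is the value \<open>a\<close> sent by
  machine \<open>i\<close>. Round 0 moves each input edge to its own node, and coins are only
  used in round 1.\<close>

locale protocol =
  fixes nodes :: "'a set" and code :: "'a \<Rightarrow> nat" and M Q T wb :: nat
    and target :: "nat \<times> nat \<Rightarrow> 'a"
    and start :: "'a \<Rightarrow> nat \<Rightarrow> bool \<Rightarrow> nat option"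
    and upd :: "nat \<Rightarrow> 'a \<Rightarrow> ('a \<times> nat) set \<Rightarrow> nat option"
    and out :: "nat \<Rightarrow> 'a \<Rightarrow> nat \<Rightarrow> 'a set"
    and coin :: "'a \<Rightarrow> nat pmf"
    and result :: "'a \<Rightarrow> nat \<Rightarrow> (nat \<times> nat) list"
  assumes finite_nodes: "finite nodes" and code: "bij_betw code nodes {..<M}" and T: "2 \<le> T"
begin

definition node :: "nat \<Rightarrow> 'a" where
  "node = inv_into nodes code"

definition heard :: "memory \<Rightarrow> ('a \<times> nat) set" where
  "heard x = (\<lambda>w. (node (w div Q), w mod Q)) ` set x"

definition send :: "nat \<Rightarrow> nat \<Rightarrow> nat option \<Rightarrow> outbox" where
  "send t i v = (case v of None \<Rightarrow> []
     | Some a \<Rightarrow> map (\<lambda>j. (j, i * Q + a)) (sorted_list_of_set (code ` out t (node i) a)))"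

definition route :: "memory \<Rightarrow> outbox" where
  "route x = map (\<lambda>e. (code (target e), 0)) (unpair_words x)"

definition step :: "nat \<Rightarrow> nat \<Rightarrow> nat \<Rightarrow> memory \<Rightarrow> memory \<times> outbox" where
  "step c t i x = ([],
     if t = 0 then route x
     else if t = 1 then send 1 i (start (node i) c (x \<noteq> []))
     else send t i (upd t (node i) (heard x)))"

definition write_result :: "nat \<Rightarrow> memory \<Rightarrow> memory" where
  "write_result i x = (case upd T (node i) (heard x) of None \<Rightarrow> []
     | Some a \<Rightarrow> pair_words (result (node i) a))"

definition algorithm :: mpc_algorithm where
  "algorithm = \<lparr> num_machines = M, word_bits = wb, num_rounds = T,
     local_step = (\<lambda>t i x. map_pmf (\<lambda>c. step c t i x) (if t = 1 then coin (node i) else return_pmf 0)),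
     local_output = (\<lambda>i x. return_pmf (write_result i x)) \<rparr>"

lemma algorithm_simps [simp]:
  "num_machines algorithm = M" "word_bits algorithm = wb" "num_rounds algorithm = T"
  by (simp_all add: algorithm_def)

definition run :: "configuration \<Rightarrow> (nat \<Rightarrow> nat) \<Rightarrow> configuration list" where
  "run c \<omega> = (let h = det_history M (\<lambda>t i. step (\<omega> i) t i) c T
     in h @ [\<lambda>i. if i < M then write_result i (last h i) else []])"

lemma mpc_execution_algorithm:
  "mpc_execution algorithm c = map_pmf (run c) (Pi_pmf {..<M} 0 (\<lambda>i. coin (node i)))"
proof -
  have "step c' t = step 0 t" if "t \<noteq> 1" for c' t
    using that by (simp add: step_def fun_eq_iff)
  from mpc_execution_coin_in_round_1[of algorithm step "\<lambda>i. coin (node i)" write_result c, OF _ this]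
  show ?thesis by (simp add: algorithm_def run_def[abs_def])
qed

lemma node_code [simp]: "x \<in> nodes \<Longrightarrow> node (code x) = x"
  using code by (auto simp: node_def bij_betw_def)

lemma code_node [simp]: "i < M \<Longrightarrow> code (node i) = i"
  using code by (auto simp: node_def bij_betw_def f_inv_into_f)

lemma node_in [simp]: "i < M \<Longrightarrow> node i \<in> nodes"
  using code by (auto simp: node_def bij_betw_def inv_into_into)

lemma code_less [simp]: "x \<in> nodes \<Longrightarrow> code x < M"
  using code by (auto simp: bij_betw_def)

lemma bij_node: "bij_betw node {..<M} nodes"
  unfolding node_def using code by (rule bij_betw_inv_into)

lemma sum_node: "(\<Sum>i<M. f (node i)) = (\<Sum>x\<in>nodes. f x)"
  using sum.reindex_bij_betw[OF bij_node] .

end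

locale protocol_run = protocol +
  fixes E :: "(nat \<times> nat) set" and D :: "nat \<Rightarrow> (nat \<times> nat) list" and s B :: nat
    and \<omega> :: "nat \<Rightarrow> nat" and st :: "nat \<Rightarrow> 'a \<Rightarrow> nat option"
  assumes dist: "distributes M s E D" and finE: "finite E"
    and target: "target ` E \<subseteq> nodes" "inj_on target E"
    and st_1: "\<And>x. x \<in> nodes \<Longrightarrow> st 1 x = start x (\<omega> (code x)) (x \<in> target ` E)"
    and st_Suc: "\<And>t x. 1 \<le> t \<Longrightarrow> t < T \<Longrightarrow> x \<in> nodes \<Longrightarrow>
      st (Suc t) x = upd (Suc t) x {(y, a). y \<in> nodes \<and> st t y = Some a \<and> x \<in> out t y a}"
    and out_nodes: "\<And>t x a. 1 \<le> t \<Longrightarrow> t < T \<Longrightarrow> x \<in> nodes \<Longrightarrow> st t x = Some a \<Longrightarrow> out t x a \<subseteq> nodes"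
    and value_less: "\<And>t x a. 1 \<le> t \<Longrightarrow> t < T \<Longrightarrow> x \<in> nodes \<Longrightarrow> st t x = Some a \<Longrightarrow> a < Q"
    and outdegree: "\<And>t x a. 1 \<le> t \<Longrightarrow> t < T \<Longrightarrow> x \<in> nodes \<Longrightarrow> st t x = Some a \<Longrightarrow> card (out t x a) \<le> s"
    and indegree: "\<And>t x. 1 \<le> t \<Longrightarrow> t < T \<Longrightarrow> x \<in> nodes \<Longrightarrow>
      card {(y, a). y \<in> nodes \<and> st t y = Some a \<and> x \<in> out t y a} \<le> s"
    and messages: "\<And>t. 1 \<le> t \<Longrightarrow> t < T \<Longrightarrow>
      card {(x, y). x \<in> nodes \<and> (\<exists>a. st t x = Some a \<and> y \<in> out t x a)} \<le> B"
    and input_B: "2 * card E \<le> B"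
    and words: "M * Q \<le> 2 ^ wb" "E \<subseteq> {..<2 ^ wb} \<times> {..<2 ^ wb}"
    and s1: "1 \<le> s"
    and result_words: "\<And>x a. x \<in> nodes \<Longrightarrow> st T x = Some a \<Longrightarrow>
      2 * length (result x a) \<le> s \<and> set (result x a) \<subseteq> {..<2 ^ wb} \<times> {..<2 ^ wb}"
    and result_B: "(\<Sum>x\<in>nodes. case st T x of None \<Rightarrow> 0 | Some a \<Rightarrow> 2 * length (result x a)) \<le> B"
begin

abbreviation "received t x \<equiv> {(y, a). y \<in> nodes \<and> st t y = Some a \<and> x \<in> out t y a}"

definition mail :: "nat \<Rightarrow> nat \<Rightarrow> outbox" where
  "mail t i = (if t = 0 then route (pair_words (D i)) else send t i (st t (node i)))"

definition traffic :: "nat \<Rightarrow> nat \<Rightarrow> memory \<times> outbox" where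
  "traffic t i = ([], if i < M then mail t i else [])"

lemma before_traffic: "before_delivery (traffic t) i = (if i < M then map snd (mail t i) else [])"
  by (simp add: before_delivery_def traffic_def)

lemma after_traffic:
  "after_delivery M (traffic t) j = concat (map (\<lambda>i. map snd (filter (\<lambda>m. fst m = j) (mail t i))) [0..<M])"
  by (auto simp: after_delivery_def traffic_def intro!: arg_cong[where f=concat])

lemma after_0:
  assumes "j < M"
  shows "after_delivery M (traffic 0) j = map (\<lambda>_. 0) (filter (\<lambda>e. code (target e) = j) (concat (map D [0..<M])))"
  by (simp add: after_traffic mail_def route_def filter_map comp_def map_concat filter_concat)

lemma filter_target:
  assumes "j < M"
  shows "set (filter (\<lambda>e. code (target e) = j) (concat (map D [0..<M]))) = {e\<in>E. target e = node j}"
proof -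
  have "set (concat (map D [0..<M])) = E" using dist by (simp add: distributes_def)
  then have "set (filter (\<lambda>e. code (target e) = j) (concat (map D [0..<M]))) = {e\<in>E. code (target e) = j}"
    by (simp only: set_filter)
  also have "\<dots> = {e\<in>E. target e = node j}" using assms target(1) by auto
  finally show ?thesis .
qed

lemma length_after_0: "j < M \<Longrightarrow> length (after_delivery M (traffic 0) j) \<le> 1"
proof -
  assume j: "j < M"
  let ?L = "filter (\<lambda>e. code (target e) = j) (concat (map D [0..<M]))"
  have "distinct ?L" using dist unfolding distributes_def by (intro distinct_filter) simp
  then have "length ?L = card {e\<in>E. target e = node j}"
    using distinct_card[of ?L] filter_target[OF j] by simp
  also have "\<dots> \<le> 1"
  proof -
    have "\<forall>e\<in>{e\<in>E. target e = node j}. \<forall>e'\<in>{e\<in>E. target e = node j}. e = e'"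
      using target(2) unfolding inj_on_def by simp
    from card_le_Suc0_iff_eq[THEN iffD2, OF finite_subset[OF _ finE] this] show ?thesis by auto
  qed
  finally show ?thesis by (simp add: after_0[OF j])
qed

lemma after_0_nonempty: "j < M \<Longrightarrow> after_delivery M (traffic 0) j \<noteq> [] \<longleftrightarrow> node j \<in> target ` E"
proof -
  assume j: "j < M"
  have "after_delivery M (traffic 0) j \<noteq> [] \<longleftrightarrow> {e\<in>E. target e = node j} \<noteq> {}"
    unfolding after_0[OF j] filter_target[OF j, symmetric] map_is_Nil_conv set_empty ..
  also have "\<dots> \<longleftrightarrow> (\<exists>e\<in>E. target e = node j)" by blast
  finally show ?thesis by (metis (no_types, lifting) image_iff)
qed

lemma filter_send:
  assumes "1 \<le> t" "t < T" "i < M" "j < M"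
  shows "map snd (filter (\<lambda>m. fst m = j) (send t i (st t (node i))))
    = (if \<exists>a. st t (node i) = Some a \<and> node j \<in> out t (node i) a then [i * Q + the (st t (node i))] else [])"
proof (cases "st t (node i)")
  case None
  then show ?thesis by (simp add: send_def)
next
  case (Some a)
  let ?S = "code ` out t (node i) a"
  have sub: "out t (node i) a \<subseteq> nodes" using out_nodes assms Some by simp
  then have fin: "finite ?S" using finite_nodes finite_subset by blast
  have "filter (\<lambda>m. fst m = j) (map (\<lambda>j. (j, i * Q + a)) L) = (if j \<in> set L then [(j, i * Q + a)] else [])"
    if "distinct L" for L
    using that by (induction L) auto
  moreover have "j \<in> ?S \<longleftrightarrow> node j \<in> out t (node i) a"
    using sub assms(4) by (metis code_node imageE image_eqI node_code subsetD)
  ultimately show ?thesis using fin Some by (simp add: send_def)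
qed

lemma after_pos:
  assumes "1 \<le> t" "t < T" "j < M"
  shows "after_delivery M (traffic t) j = map (\<lambda>i. i * Q + the (st t (node i)))
    (filter (\<lambda>i. \<exists>a. st t (node i) = Some a \<and> node j \<in> out t (node i) a) [0..<M])"
proof -
  have c: "concat (map (\<lambda>i. if P i then [f i] else []) xs) = map f (filter P xs)" for P and f :: "nat \<Rightarrow> nat" and xs
    by (induction xs) auto
  have "after_delivery M (traffic t) j = concat (map (\<lambda>i. if \<exists>a. st t (node i) = Some a \<and> node j \<in> out t (node i) a
      then [i * Q + the (st t (node i))] else []) [0..<M])"
    unfolding after_traffic using assms
    by (intro arg_cong[where f=concat] map_cong refl) (simp add: mail_def filter_send)
  then show ?thesis unfolding c .
qed

lemma received_eq:
  assumes "j < M"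
  shows "received t (node j) = (\<lambda>i. (node i, the (st t (node i)))) `
    {i. i < M \<and> (\<exists>a. st t (node i) = Some a \<and> node j \<in> out t (node i) a)}"
proof -
  have "(y, a) \<in> received t (node j) \<longleftrightarrow> (y, a) \<in> (\<lambda>i. (node i, the (st t (node i)))) `
    {i. i < M \<and> (\<exists>a. st t (node i) = Some a \<and> node j \<in> out t (node i) a)}" (is "?L \<longleftrightarrow> ?R") for y a
  proof
    assume ?L
    then show ?R by (intro image_eqI[of _ _ "code y"]) auto
  qed auto
  then show ?thesis by auto
qed

lemma heard_after:
  assumes "1 \<le> t" "t < T" "j < M"
  shows "heard (after_delivery M (traffic t) j) = received t (node j)"
proof -
  have "(node ((i * Q + the (st t (node i))) div Q), (i * Q + the (st t (node i))) mod Q) = (node i, the (st t (node i)))"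
    if "i < M" "st t (node i) = Some a" for i a
  proof -
    have "a < Q" using value_less assms that node_in by blast
    then have "(i * Q + a) div Q = i" "(i * Q + a) mod Q = a" by (cases "Q = 0"; simp)+
    then show ?thesis using that by simp
  qed
  then show ?thesis
    unfolding received_eq[OF assms(3)] heard_def after_pos[OF assms] set_map image_image set_filter
    by (intro image_cong) auto
qed

lemma length_after_pos:
  assumes "1 \<le> t" "t < T" "j < M"
  shows "length (after_delivery M (traffic t) j) \<le> s"
proof -
  let ?I = "{i. i < M \<and> (\<exists>a. st t (node i) = Some a \<and> node j \<in> out t (node i) a)}"
  have "length (after_delivery M (traffic t) j) = card ?I"
    unfolding after_pos[OF assms] length_map by (subst distinct_card[symmetric]) auto
  also have "\<dots> = card (received t (node j))"
    unfolding received_eq[OF assms(3)]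
    by (intro card_image[symmetric] inj_onI) (metis (no_types, lifting) code_node mem_Collect_eq prod.inject)
  finally show ?thesis using indegree[OF assms(1,2) node_in[OF assms(3)]] by simp
qed

lemma deliver_step:
  "t < T \<Longrightarrow> deliver M (\<lambda>t i. step (\<omega> i) t i) t (last (det_history M (\<lambda>t i. step (\<omega> i) t i) (\<lambda>i. pair_words (D i)) t)) = traffic t"
proof (induction t)
  case 0
  show ?case by (auto simp: deliver_def traffic_def step_def mail_def)
next
  case (Suc t)
  then have IH: "deliver M (\<lambda>t i. step (\<omega> i) t i) t (last (det_history M (\<lambda>t i. step (\<omega> i) t i) (\<lambda>i. pair_words (D i)) t)) = traffic t"
    by simp
  have "step (\<omega> i) (Suc t) i (after_delivery M (traffic t) i) = ([], mail (Suc t) i)" if i: "i < M" for i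
  proof (cases "t = 0")
    case True
    then show ?thesis using st_1[OF node_in[OF i]] after_0_nonempty[OF i] i
      by (simp add: step_def mail_def)
  next
    case False
    then show ?thesis using st_Suc[of t "node i"] heard_after[of t i] i Suc.prems
      by (simp add: step_def mail_def)
  qed
  then show ?case
    unfolding det_history.simps IH by (auto simp: deliver_def traffic_def)
qed

lemma length_mail:
  assumes "i < M" "t < T"
  shows "length (mail t i) = (if t = 0 then length (D i) else card {y. \<exists>a. st t (node i) = Some a \<and> y \<in> out t (node i) a})"
proof (cases "st t (node i)")
  case (Some a)
  have "card (code ` out t (node i) a) = card (out t (node i) a)" if "t \<noteq> 0"
    using out_nodes[of t "node i" a] that assms Some code
    by (intro card_image) (auto simp: bij_betw_def intro: inj_on_subset)
  then show ?thesis using Some by (auto simp: mail_def route_def send_def)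
qed (auto simp: mail_def route_def send_def)

lemma card_E: "(\<Sum>i<M. length (D i)) = card E"
proof -
  have "card E = length (concat (map D [0..<M]))"
    using dist unfolding distributes_def by (metis distinct_card)
  then show ?thesis by (simp add: length_concat comp_def sum_list_sum_nth atLeast0LessThan)
qed

lemma sum_length_mail:
  assumes "t < T"
  shows "(\<Sum>i<M. length (mail t i)) \<le> B"
proof (cases "t = 0")
  case True
  have "(\<Sum>i<M. length (mail t i)) = (\<Sum>i<M. length (D i))"
    using True assms by (intro sum.cong) (auto simp: length_mail)
  then show ?thesis using card_E input_B by simp
next
  case False
  let ?R = "\<lambda>x. {y. \<exists>a. st t x = Some a \<and> y \<in> out t x a}"
  have fin: "finite (?R x)" if "x \<in> nodes" for x
  proof (rule finite_subset[OF _ finite_nodes])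
    show "?R x \<subseteq> nodes" using out_nodes[of t x] False assms that by auto
  qed
  have "(\<Sum>i<M. length (mail t i)) = (\<Sum>i<M. card (?R (node i)))"
    using False assms by (intro sum.cong) (auto simp: length_mail)
  also have "\<dots> = (\<Sum>x\<in>nodes. card (?R x))" by (rule sum_node)
  also have "\<dots> = card (SIGMA x:nodes. ?R x)"
    using finite_nodes fin by (subst card_SigmaI) auto
  also have "(SIGMA x:nodes. ?R x) = {(x, y). x \<in> nodes \<and> (\<exists>a. st t x = Some a \<and> y \<in> out t x a)}" by auto
  finally show ?thesis using messages[of t] False assms by simp
qed

lemma length_mail_le: "i < M \<Longrightarrow> t < T \<Longrightarrow> length (mail t i) \<le> s"
proof -
  assume i: "i < M" and t: "t < T"
  have "2 * length (D i) \<le> s" using dist i by (simp add: distributes_def)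
  then have *: "length (D i) \<le> s" by simp
  have "card {y. \<exists>a. st t (node i) = Some a \<and> y \<in> out t (node i) a} \<le> s" if "t \<noteq> 0"
    using outdegree[of t "node i"] that i t by (cases "st t (node i)") auto
  then show ?thesis using * by (auto simp: length_mail[OF i t])
qed

lemma word_less: "i < M \<Longrightarrow> a < Q \<Longrightarrow> i * Q + a < 2 ^ wb"
proof -
  assume "i < M" "a < Q"
  then have "i * Q + a < (i + 1) * Q" by simp
  also have "\<dots> \<le> M * Q" using \<open>i < M\<close> by (intro mult_right_mono) auto
  finally show ?thesis using words(1) by simp
qed

lemma mail_words: "i < M \<Longrightarrow> t < T \<Longrightarrow> x \<in> snd ` set (mail t i) \<Longrightarrow> x < 2 ^ wb"
proof -
  assume i: "i < M" "t < T" and x: "x \<in> snd ` set (mail t i)"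
  show "x < 2 ^ wb"
  proof (cases "t = 0")
    case True
    then show ?thesis using x by (auto simp: mail_def route_def)
  next
    case False
    then obtain a where "st t (node i) = Some a" "x = i * Q + a"
      using x by (cases "st t (node i)") (auto simp: mail_def send_def)
    then show ?thesis using word_less[OF i(1)] value_less[of t "node i" a] False i by simp
  qed
qed

lemma after_words:
  assumes "t < T" "j < M" "x \<in> set (after_delivery M (traffic t) j)"
  shows "x < 2 ^ wb"
proof -
  obtain i where "i < M" "x \<in> snd ` set (mail t i)"
    using assms(3) unfolding after_traffic by fastforce
  then show ?thesis using mail_words assms(1) by blast
qed

definition admissible :: "configuration \<Rightarrow> bool" where
  "admissible c \<longleftrightarrow> (\<forall>i<M. length (c i) \<le> s \<and> (\<forall>x\<in>set (c i). x < 2 ^ wb)) \<and> (\<Sum>i<M. length (c i)) \<le> B"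

lemma admissible_history:
  "t \<le> T \<Longrightarrow> c \<in> set (det_history M (\<lambda>t i. step (\<omega> i) t i) (\<lambda>i. pair_words (D i)) t) \<Longrightarrow> admissible c"
proof (induction t arbitrary: c)
  case 0
  have "set (D i) \<subseteq> E" if "i < M" for i
    using dist that unfolding distributes_def by fastforce
  then have "\<forall>x\<in>set (pair_words (D i)). x < 2 ^ wb" if "i < M" for i
    using words(2) that by (fastforce simp: set_pair_words)
  moreover have "(\<Sum>i<M. length (pair_words (D i))) \<le> B"
    using card_E input_B by (simp add: sum_distrib_left[symmetric])
  ultimately show ?case using 0 dist by (auto simp: admissible_def distributes_def)
next
  case (Suc t)
  have t: "t < T" using Suc.prems by simp
  have "admissible (before_delivery (traffic t))"
    using length_mail_le[OF _ t] mail_words[OF _ t] sum_length_mail[OF t]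
    by (auto simp: admissible_def before_traffic)
  moreover have "admissible (after_delivery M (traffic t))"
    unfolding admissible_def
  proof (intro conjI allI impI ballI)
    fix j assume j: "j < M"
    show "length (after_delivery M (traffic t) j) \<le> s"
      using length_after_0[OF j] length_after_pos[of t j] s1 j t by (cases "t = 0") auto
    show "x < 2 ^ wb" if "x \<in> set (after_delivery M (traffic t) j)" for x
      using after_words[OF t j that] .
  next
    have "(\<Sum>j<M. length (after_delivery M (traffic t) j)) \<le> (\<Sum>i<M. length (mail t i))"
      using length_after_delivery_sum[of M "traffic t"] by (simp add: traffic_def)
    then show "(\<Sum>j<M. length (after_delivery M (traffic t) j)) \<le> B"
      using sum_length_mail[OF t] by simp
  qed
  ultimately show ?case using Suc deliver_step[OF t] by auto
qed

lemma final_configuration: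
  assumes "i < M"
  shows "last (run (\<lambda>i. pair_words (D i)) \<omega>) i
    = (case st T (node i) of None \<Rightarrow> [] | Some a \<Rightarrow> pair_words (result (node i) a))"
proof -
  obtain t where t: "T = Suc t" "1 \<le> t" using T by (cases T) auto
  have "upd T (node i) (heard (last (det_history M (\<lambda>t i. step (\<omega> i) t i) (\<lambda>i. pair_words (D i)) T) i)) = st T (node i)"
    using deliver_step[of t] heard_after[of t i] st_Suc[of t "node i"] assms t by simp
  then show ?thesis using assms by (simp add: run_def Let_def write_result_def)
qed

lemma admissible_run: "c \<in> set (run (\<lambda>i. pair_words (D i)) \<omega>) \<Longrightarrow> admissible c"
proof -
  let ?h = "run (\<lambda>i. pair_words (D i)) \<omega>"
  assume "c \<in> set ?h"
  then consider "c \<in> set (det_history M (\<lambda>t i. step (\<omega> i) t i) (\<lambda>i. pair_words (D i)) T)" | "c = last ?h"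
    by (auto simp: run_def Let_def)
  then show ?thesis
  proof cases
    case 1
    then show ?thesis using admissible_history by blast
  next
    case 2
    have c: "c i = (case st T (node i) of None \<Rightarrow> [] | Some a \<Rightarrow> pair_words (result (node i) a))" if "i < M" for i
      using final_configuration[OF that] 2 by simp
    have "length (c i) \<le> s \<and> (\<forall>x\<in>set (c i). x < 2 ^ wb)" if i: "i < M" for i
    proof (cases "st T (node i)")
      case (Some a)
      then have "2 * length (result (node i) a) \<le> s" "set (result (node i) a) \<subseteq> {..<2 ^ wb} \<times> {..<2 ^ wb}"
        using result_words[OF node_in[OF i]] by auto
      then show ?thesis using Some by (auto simp: c[OF i] set_pair_words)
    qed (simp add: c[OF i])
    moreover have "(\<Sum>i<M. length (c i)) \<le> B"
    proof -
      have "(\<Sum>i<M. length (c i)) = (\<Sum>i<M. case st T (node i) of None \<Rightarrow> 0 | Some a \<Rightarrow> 2 * length (result (node i) a))"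
        by (intro sum.cong) (auto simp: c split: option.split)
      then show ?thesis
        using sum_node[of "\<lambda>x. case st T x of None \<Rightarrow> 0 | Some a \<Rightarrow> 2 * length (result x a)"] result_B by simp
    qed
    ultimately show ?thesis by (auto simp: admissible_def)
  qed
qed

lemma within_memory_run: "within_memory algorithm s (run (\<lambda>i. pair_words (D i)) \<omega>)"
  using admissible_run by (auto simp: within_memory_def admissible_def)

lemma total_space_run: "total_space algorithm (run (\<lambda>i. pair_words (D i)) \<omega>) \<le> (2 * T + 2) * B"
proof -
  have "length (run (\<lambda>i. pair_words (D i)) \<omega>) = 2 * T + 2" by (simp add: run_def Let_def)
  moreover have "run (\<lambda>i. pair_words (D i)) \<omega> \<noteq> []" by (simp add: run_def Let_def)
  ultimately show ?thesis
    using total_space_le[of "run (\<lambda>i. pair_words (D i)) \<omega>" algorithm B] admissible_run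
    by (simp add: admissible_def)
qed

end

section \<open>The clustering protocol\<close>

datatype node =
    Input nat nat
  | Slot nat
  | Edge nat nat nat
  | Ref nat nat nat
  | Join nat nat nat
  | Wedge nat nat nat
  | Count nat nat nat
  | Name nat nat

primrec arguments_below :: "nat \<Rightarrow> node \<Rightarrow> bool" where
  "arguments_below R (Input u v) \<longleftrightarrow> u < R \<and> v < R"
| "arguments_below R (Slot j) \<longleftrightarrow> j < R"
| "arguments_below R (Edge u v j) \<longleftrightarrow> u < R \<and> v < R \<and> j < R"
| "arguments_below R (Ref j u v) \<longleftrightarrow> j < R \<and> u < R \<and> v < R"
| "arguments_below R (Join j u v) \<longleftrightarrow> j < R \<and> u < R \<and> v < R"
| "arguments_below R (Wedge j w v) \<longleftrightarrow> j < R \<and> w < R \<and> v < R"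
| "arguments_below R (Count j v w) \<longleftrightarrow> j < R \<and> v < R \<and> w < R"
| "arguments_below R (Name v j) \<longleftrightarrow> v < R \<and> j < R"

definition node_set :: "nat \<Rightarrow> node set" where
  "node_set R = {x. arguments_below R x}"

lemma node_set_finite_card: "finite (node_set R) \<and> card (node_set R) \<le> 8 * R ^ 3 \<and> R ^ 2 \<le> card (node_set R)"
proof -
  define f where "f = (\<lambda>(t::nat, a, b, c). if t = 0 then Input a b else if t = 1 then Slot a
     else if t = 2 then Edge a b c else if t = 3 then Ref a b c else if t = 4 then Join a b c
     else if t = 5 then Wedge a b c else if t = 6 then Count a b c else Name a b)"
  let ?A = "{..<8::nat} \<times> {..<R} \<times> {..<R} \<times> {..<R}"
  have sub: "node_set R \<subseteq> f ` ?A"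
  proof
    fix x assume x: "x \<in> node_set R"
    show "x \<in> f ` ?A"
    proof (cases x)
      case (Input u v)
      then show ?thesis using x by (intro image_eqI[of _ _ "(0, u, v, u)"]) (auto simp: f_def node_set_def)
    next
      case (Slot j)
      then show ?thesis using x by (intro image_eqI[of _ _ "(1, j, j, j)"]) (auto simp: f_def node_set_def)
    next
      case (Edge u v j)
      then show ?thesis using x by (intro image_eqI[of _ _ "(2, u, v, j)"]) (auto simp: f_def node_set_def)
    next
      case (Ref j u v)
      then show ?thesis using x by (intro image_eqI[of _ _ "(3, j, u, v)"]) (auto simp: f_def node_set_def)
    next
      case (Join j u v)
      then show ?thesis using x by (intro image_eqI[of _ _ "(4, j, u, v)"]) (auto simp: f_def node_set_def)
    next
      case (Wedge j w v)
      then show ?thesis using x by (intro image_eqI[of _ _ "(5, j, w, v)"]) (auto simp: f_def node_set_def)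
    next
      case (Count j v w)
      then show ?thesis using x by (intro image_eqI[of _ _ "(6, j, v, w)"]) (auto simp: f_def node_set_def)
    next
      case (Name v j)
      then show ?thesis using x by (intro image_eqI[of _ _ "(7, v, j, v)"]) (auto simp: f_def node_set_def)
    qed
  qed
  have fin: "finite (node_set R)" by (rule finite_subset[OF sub]) auto
  have "card (node_set R) \<le> card (f ` ?A)" by (rule card_mono[OF _ sub]) auto
  also have "\<dots> \<le> card ?A" by (rule card_image_le) auto
  also have "\<dots> = 8 * R ^ 3" by (simp add: card_cartesian_product power3_eq_cube)
  finally have le: "card (node_set R) \<le> 8 * R ^ 3" .
  have "R ^ 2 = card ((\<lambda>(u, v). Input u v) ` ({..<R} \<times> {..<R}))"
    by (subst card_image) (auto simp: inj_on_def power2_eq_square)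
  also have "\<dots> \<le> card (node_set R)"
    by (rule card_mono[OF fin]) (auto simp: node_set_def)
  finally show ?thesis using fin le by simp
qed

definition children :: "nat \<Rightarrow> nat \<Rightarrow> nat \<Rightarrow> nat set" where
  "children b X y = {z. z < X \<and> z div b = y}"

lemma div_eq_interval: "0 < b \<Longrightarrow> {z::nat. z div b = y} = {y * b..<y * b + b}"
proof -
  assume b: "0 < b"
  have "z div b = y \<longleftrightarrow> y \<le> z div b \<and> z div b < Suc y" for z by auto
  then have "z div b = y \<longleftrightarrow> y * b \<le> z \<and> z < Suc y * b" for z
    using b by (simp only: less_eq_div_iff_mult_less_eq div_less_iff_less_mult)
  then show ?thesis
    by (simp only: set_eq_iff mem_Collect_eq atLeastLessThan_iff mult_Suc add.commute simp_thms)
qed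

lemma div_less_power_Suc: "0 < b \<Longrightarrow> (z::nat) div b < b ^ l \<longleftrightarrow> z < b ^ Suc l"
  by (simp add: div_less_iff_less_mult mult.commute)

lemma card_fibres:
  fixes f :: "'a \<Rightarrow> 'b" and g :: "'b \<Rightarrow> 'c"
  assumes "finite A"
  shows "(\<Sum>y'\<in>{y'. g y' = y \<and> 0 < card {w\<in>A. f w = y'}}. card {w\<in>A. f w = y'}) = card {w\<in>A. g (f w) = y}"
proof -
  have pos: "0 < card {w\<in>A. f w = y'} \<longleftrightarrow> y' \<in> f ` A" for y'
    using assms by (auto simp: card_gt_0_iff)
  have "card {w\<in>A. g (f w) = y} = (\<Sum>y'\<in>{y'\<in>f ` A. g y' = y}. card {w\<in>{w\<in>A. g (f w) = y}. f w = y'})"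
  proof -
    have "card (\<Union>y'\<in>{y'\<in>f ` A. g y' = y}. {w\<in>{w\<in>A. g (f w) = y}. f w = y'})
        = (\<Sum>y'\<in>{y'\<in>f ` A. g y' = y}. card {w\<in>{w\<in>A. g (f w) = y}. f w = y'})"
      using assms by (intro card_UN_disjoint) auto
    moreover have "(\<Union>y'\<in>{y'\<in>f ` A. g y' = y}. {w\<in>{w\<in>A. g (f w) = y}. f w = y'}) = {w\<in>A. g (f w) = y}" by auto
    ultimately show ?thesis by simp
  qed
  also have "\<dots> = (\<Sum>y'\<in>{y'. g y' = y \<and> 0 < card {w\<in>A. f w = y'}}. card {w\<in>A. f w = y'})"
    unfolding pos by (intro sum.cong) (auto intro!: arg_cong[where f=card])
  finally show ?thesis by simp
qed

lemma card_Union_list_le: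
  assumes "\<And>S. S \<in> set L \<Longrightarrow> card S \<le> c"
  shows "card (\<Union>(set L)) \<le> length L * c"
  using assms
proof (induction L)
  case (Cons S L)
  have "card (\<Union>(set (S # L))) \<le> card S + card (\<Union>(set L))" by (simp add: card_Un_le)
  then show ?case using Cons by (simp add: add_mono le_trans)
qed simp

lemma Min_Min:
  fixes A :: "'b \<Rightarrow> nat set"
  assumes "finite (\<Union>y\<in>Y. A y)" "\<And>y. y \<in> Y \<Longrightarrow> A y \<noteq> {}" "Y \<noteq> {}" "finite Y"
  shows "Min ((\<lambda>y. Min (A y)) ` Y) = Min (\<Union>y\<in>Y. A y)"
proof -
  have fin: "finite (A y)" if "y \<in> Y" for y by (rule finite_subset[OF _ assms(1)]) (use that in auto)
  have ne: "(\<Union>y\<in>Y. A y) \<noteq> {}" using assms(2,3) by auto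
  show ?thesis
  proof (rule antisym)
    show "Min ((\<lambda>y. Min (A y)) ` Y) \<le> Min (\<Union>y\<in>Y. A y)"
    proof (rule Min.boundedI[OF assms(1) ne])
      fix a assume "a \<in> (\<Union>y\<in>Y. A y)"
      then obtain y where y: "y \<in> Y" "a \<in> A y" by auto
      have "Min ((\<lambda>y. Min (A y)) ` Y) \<le> Min (A y)" using y assms(4) by (intro Min_le) auto
      also have "\<dots> \<le> a" using y fin by (intro Min_le) auto
      finally show "Min ((\<lambda>y. Min (A y)) ` Y) \<le> a" .
    qed
    have "Min ((\<lambda>y. Min (A y)) ` Y) \<in> (\<lambda>y. Min (A y)) ` Y"
      using assms(3,4) by (intro Min_in) auto
    then obtain y where y: "y \<in> Y" "Min ((\<lambda>y. Min (A y)) ` Y) = Min (A y)" by auto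
    have "Min (A y) \<in> A y" using fin assms(2) y(1) by (intro Min_in) auto
    then show "Min (\<Union>y\<in>Y. A y) \<le> Min ((\<lambda>y. Min (A y)) ` Y)"
      unfolding y(2) using y(1) by (intro Min_le[OF assms(1)]) auto
  qed
qed

text \<open>The rounds of the clustering protocol, for trees with \<open>h\<close> levels and branching \<open>b\<close>, on the
  sparsified graph: an edge \<open>uv\<close> is broadcast to the nodes \<open>Edge u v j\<close> of all slots \<open>j < K\<close>, while
  slot \<open>j\<close> broadcasts its reference vertex \<open>r j\<close> to the nodes \<open>Ref j (r j) w\<close>; if \<open>w\<close> turns out
  to be a neighbour of \<open>r j\<close>, this is broadcast to the nodes \<open>Wedge j w v\<close> and meets the edges \<open>wv\<close>
  in \<open>Count j v w\<close>. Sums over \<open>w\<close> count the common neighbours of \<open>r j\<close> and \<open>v\<close>, and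
  the name of \<open>v\<close> is the least slot \<open>j\<close> for which this number reaches the threshold \<open>\<tau>\<close>.\<close>

locale clustering =
  fixes N K b h :: nat and \<tau> :: real
  assumes b: "2 \<le> b" and N: "1 \<le> N" "N \<le> b ^ h" and K: "1 \<le> K" "K \<le> b ^ h" and \<tau>: "0 < \<tau>"
begin

fun out :: "nat \<Rightarrow> node \<Rightarrow> nat \<Rightarrow> node set" where
  "out t (Input u v) a = {Edge u v 0, Edge v u 0}"
| "out t (Slot j) a = {Ref j a 0}"
| "out t (Edge u v y) a = (if t < 2 + h then Edge u v ` children b K y else {Join y u v})"
| "out t (Ref j u y) a = (if t < 2 + h then Ref j u ` children b N y else {Join j u y})"
| "out t (Join j u v) a =
     (if t = 3 + h then insert (Join j u v) (if a = 1 then {Wedge j v 0} else {})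
      else if t < 4 + 2 * h then {Join j u v} else {Count j v u})"
| "out t (Wedge j w y) a = (if t < 4 + 2 * h then Wedge j w ` children b N y else {Count j y w})"
| "out t (Count j v y) a =
     (if t < 5 + 3 * h then {Count j v (y div b)} else if \<tau> \<le> real a then {Name v j} else {})"
| "out t (Name v y) a = {Name v (y div b)}"

fun start :: "node \<Rightarrow> nat \<Rightarrow> bool \<Rightarrow> nat option" where
  "start (Input u v) c got = (if got \<and> c = 1 then Some 0 else None)"
| "start (Slot j) c got = (if j < K then Some c else None)"
| "start _ c got = None"

fun upd :: "nat \<Rightarrow> node \<Rightarrow> (node \<times> nat) set \<Rightarrow> nat option" where
  "upd t (Input u v) S = None"
| "upd t (Slot j) S = None"
| "upd t (Join j u v) S =
     (if t = 3 + h
      then if \<exists>a. (Edge u v j, a) \<in> S then Some (if \<exists>a. (Ref j u v, a) \<in> S then 1 else 0) else None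
      else if S = {} then None else Some 0)"
| "upd t (Count j v w) S =
     (if t = 5 + 2 * h
      then if (\<exists>a. (Join j w v, a) \<in> S) \<and> (\<exists>a. (Wedge j w v, a) \<in> S) then Some 1 else None
      else if S = {} then None else Some (\<Sum>x\<in>S. snd x))"
| "upd t (Name v y) S =
     (if S = {} then None else if t = 6 + 3 * h then Some y else Some (Min (snd ` S)))"
| "upd t _ S = (if S = {} then None else Some 0)"

fun result :: "node \<Rightarrow> nat \<Rightarrow> (nat \<times> nat) list" where
  "result (Name v y) a = [(v, a)]"
| "result _ a = []"

abbreviation "R \<equiv> max N K"
abbreviation "nodes \<equiv> node_set R"
abbreviation "T \<equiv> 6 + 4 * h"

end

locale clustering_run = clustering +
  fixes F :: "(nat \<times> nat) set" and r :: "nat \<Rightarrow> nat"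
  assumes F: "F \<subseteq> vertex_pairs N" and r: "\<And>j. j < K \<Longrightarrow> r j < N"
begin

definition partial_count :: "nat \<Rightarrow> nat \<Rightarrow> nat \<Rightarrow> nat \<Rightarrow> nat" where
  "partial_count l j v y = card {w. adj F (r j) w \<and> adj F w v \<and> w div b ^ l = y}"

definition matching_slots :: "nat \<Rightarrow> nat \<Rightarrow> nat \<Rightarrow> nat set" where
  "matching_slots l v y = {j. j < K \<and> \<tau> \<le> real (common F (r j) v) \<and> j div b ^ l = y}"

text \<open>The value of a node after \<open>t\<close> rounds; \<open>None\<close> means that the node is silent.\<close>

fun st :: "nat \<Rightarrow> node \<Rightarrow> nat option" where
  "st t (Input u v) = (if t = 1 \<and> (u, v) \<in> F then Some 0 else None)"
| "st t (Slot j) = (if t = 1 \<and> j < K then Some (r j) else None)"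
| "st t (Edge u v y) =
     (if 2 \<le> t \<and> t \<le> 2 + h \<and> adj F u v \<and> y < K \<and> y < b ^ (t - 2) then Some 0 else None)"
| "st t (Ref j u y) =
     (if 2 \<le> t \<and> t \<le> 2 + h \<and> j < K \<and> u = r j \<and> y < N \<and> y < b ^ (t - 2) then Some 0 else None)"
| "st t (Join j u v) =
     (if 3 + h \<le> t \<and> t \<le> 4 + 2 * h \<and> j < K \<and> adj F u v
      then Some (if t = 3 + h \<and> u = r j then 1 else 0) else None)"
| "st t (Wedge j w y) =
     (if 4 + h \<le> t \<and> t \<le> 4 + 2 * h \<and> j < K \<and> adj F (r j) w \<and> y < N \<and> y < b ^ (t - (4 + h))
      then Some 0 else None)"
| "st t (Count j v y) =
     (if 5 + 2 * h \<le> t \<and> t \<le> 5 + 3 * h \<and> j < K \<and> 0 < partial_count (t - (5 + 2 * h)) j v y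
      then Some (partial_count (t - (5 + 2 * h)) j v y) else None)"
| "st t (Name v y) =
     (if 6 + 3 * h \<le> t \<and> t \<le> 6 + 4 * h \<and> matching_slots (t - (6 + 3 * h)) v y \<noteq> {}
      then Some (Min (matching_slots (t - (6 + 3 * h)) v y)) else None)"

definition inbox :: "nat \<Rightarrow> node \<Rightarrow> (node \<times> nat) set" where
  "inbox t x = {(y, a). st t y = Some a \<and> x \<in> out t y a}"

lemma adjF: "adj F u v \<Longrightarrow> u < N \<and> v < N"
  using adj_less[OF F] by blast

lemma b0: "0 < b" using b by simp

lemma finite_wedges: "finite {w. adj F u w \<and> adj F w v \<and> P w}"
  by (rule finite_subset[of _ "{..<N}"]) (auto dest: adjF)

lemma partial_count_top: "partial_count h j v y = (if y = 0 then common F (r j) v else 0)"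
proof -
  have "w div b ^ h = 0" if "w < N" for w using that N by simp
  then have "{w. adj F (r j) w \<and> adj F w v \<and> w div b ^ h = y} = (if y = 0 then {w. adj F (r j) w \<and> adj F w v} else {})"
    by (auto dest: adjF)
  then show ?thesis by (simp add: partial_count_def common_def)
qed

lemma partial_count_0: "partial_count 0 j v w = (if adj F (r j) w \<and> adj F w v then 1 else 0)"
proof -
  have "{w'. adj F (r j) w' \<and> adj F w' v \<and> w' div b ^ 0 = w} = (if adj F (r j) w \<and> adj F w v then {w} else {})"
    by auto
  then show ?thesis by (simp add: partial_count_def)
qed

lemma partial_count_Suc:
  "(\<Sum>y'\<in>{y'. y' div b = y \<and> 0 < partial_count l j v y'}. partial_count l j v y') = partial_count (Suc l) j v y"
proof -
  have eq: "partial_count l' j v y' = card {w\<in>{w. adj F (r j) w \<and> adj F w v}. w div b ^ l' = y'}" for l' y'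
    unfolding partial_count_def by (rule arg_cong[where f=card]) auto
  have d: "w div b ^ Suc l = (w div b ^ l) div b" for w by (metis div_mult2_eq power_Suc2)
  show ?thesis unfolding eq d
    using finite_wedges[of "r j" v "\<lambda>_. True"] by (intro card_fibres) auto
qed

lemma matching_common_pos: "j \<in> matching_slots l v y \<Longrightarrow> 0 < common F (r j) v"
  using \<tau> by (cases "common F (r j) v = 0") (auto simp: matching_slots_def)

lemma common_pos_less: "0 < common F u v \<Longrightarrow> v < N"
  unfolding common_def by (auto simp: card_gt_0_iff dest: adjF)

lemma matching_slots_0: "matching_slots 0 v y = (if y < K \<and> \<tau> \<le> real (common F (r y) v) then {y} else {})"
  by (auto simp: matching_slots_def)

lemma finite_matching_slots [simp]: "finite (matching_slots l v y)"
  by (rule finite_subset[of _ "{..<K}"]) (auto simp: matching_slots_def)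

lemma matching_slots_Suc:
  "matching_slots (Suc l) v y = (\<Union>y'\<in>{y'. y' div b = y \<and> matching_slots l v y' \<noteq> {}}. matching_slots l v y')"
proof -
  have d: "j div b ^ Suc l = (j div b ^ l) div b" for j by (metis div_mult2_eq power_Suc2)
  show ?thesis by (auto simp: matching_slots_def d simp del: power_Suc)
qed

lemma finite_div_eq: "finite {y'. y' div b = y}"
  using div_eq_interval[OF b0, of y] by simp

lemma Min_matching_slots_Suc:
  assumes "matching_slots (Suc l) v y \<noteq> {}"
  shows "Min ((\<lambda>y'. Min (matching_slots l v y')) ` {y'. y' div b = y \<and> matching_slots l v y' \<noteq> {}})
    = Min (matching_slots (Suc l) v y)"
  unfolding matching_slots_Suc
proof (rule Min_Min)
  show "finite (\<Union>y'\<in>{y'. y' div b = y \<and> matching_slots l v y' \<noteq> {}}. matching_slots l v y')"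
    using finite_matching_slots[of "Suc l" v y] by (simp add: matching_slots_Suc)
  show "{y'. y' div b = y \<and> matching_slots l v y' \<noteq> {}} \<noteq> {}"
    using assms by (auto simp: matching_slots_Suc)
qed (auto intro: finite_subset[OF _ finite_div_eq])

lemma inbox_Input: "inbox t (Input u v) = {}"
proof -
  have "(y, a) \<notin> inbox t (Input u v)" for y a
    by (cases y) (auto simp: inbox_def split: if_splits)
  then show ?thesis by auto
qed

lemma inbox_Slot: "inbox t (Slot j) = {}"
proof -
  have "(y, a) \<notin> inbox t (Slot j)" for y a
    by (cases y) (auto simp: inbox_def split: if_splits)
  then show ?thesis by auto
qed

lemma inbox_Edge: "(y, a) \<in> inbox t (Edge u v z) \<longleftrightarrow>
    t = 1 \<and> z = 0 \<and> a = 0 \<and> (y = Input u v \<and> (u, v) \<in> F \<or> y = Input v u \<and> (v, u) \<in> F) \<or>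
    2 \<le> t \<and> t < 2 + h \<and> a = 0 \<and> y = Edge u v (z div b) \<and> adj F u v \<and> z < K \<and> z < b ^ (Suc t - 2)"
proof (cases "2 \<le> t")
  case True
  then have "Suc t - 2 = Suc (t - 2)" by simp
  then have *: "z < b ^ (Suc t - 2) \<longleftrightarrow> z div b < b ^ (t - 2)" using div_less_power_Suc[OF b0] by simp
  have "z div b < K" if "z < K" using that div_le_dividend[of z b] by linarith
  then show ?thesis unfolding * using True
    by (cases y) (auto simp: inbox_def children_def split: if_splits)
next
  case False
  then show ?thesis
    by (cases y) (auto simp: inbox_def children_def split: if_splits)
qed

lemma inbox_Ref: "(y, a) \<in> inbox t (Ref j u z) \<longleftrightarrow>
    t = 1 \<and> z = 0 \<and> a = u \<and> y = Slot j \<and> j < K \<and> u = r j \<or>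
    2 \<le> t \<and> t < 2 + h \<and> a = 0 \<and> y = Ref j u (z div b) \<and> j < K \<and> u = r j \<and> z < N \<and> z < b ^ (Suc t - 2)"
proof (cases "2 \<le> t")
  case True
  then have "Suc t - 2 = Suc (t - 2)" by simp
  then have *: "z < b ^ (Suc t - 2) \<longleftrightarrow> z div b < b ^ (t - 2)" using div_less_power_Suc[OF b0] by simp
  have "z div b < N" if "z < N" using that div_le_dividend[of z b] by linarith
  then show ?thesis unfolding * using True
    by (cases y) (auto simp: inbox_def children_def split: if_splits)
next
  case False
  then show ?thesis
    by (cases y) (auto simp: inbox_def children_def split: if_splits)
qed

lemma inbox_Join: "(y, a) \<in> inbox t (Join j u v) \<longleftrightarrow>
    t = 2 + h \<and> a = 0 \<and> j < K \<and> (y = Edge u v j \<and> adj F u v \<or> y = Ref j u v \<and> u = r j \<and> v < N) \<or>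
    3 + h \<le> t \<and> t < 4 + 2 * h \<and> y = Join j u v \<and> j < K \<and> adj F u v \<and> a = (if t = 3 + h \<and> u = r j then 1 else 0)"
  using K(2) N(2)
  by (cases y) (auto simp: inbox_def children_def split: if_splits)

lemma inbox_Wedge: "(y, a) \<in> inbox t (Wedge j w z) \<longleftrightarrow>
    t = 3 + h \<and> z = 0 \<and> a = 1 \<and> y = Join j (r j) w \<and> j < K \<and> adj F (r j) w \<or>
    4 + h \<le> t \<and> t < 4 + 2 * h \<and> a = 0 \<and> y = Wedge j w (z div b) \<and> j < K \<and> adj F (r j) w \<and> z < N \<and> z < b ^ (Suc t - (4 + h))"
proof (cases "4 + h \<le> t")
  case True
  then have "Suc t - (4 + h) = Suc (t - (4 + h))" by simp
  then have *: "z < b ^ (Suc t - (4 + h)) \<longleftrightarrow> z div b < b ^ (t - (4 + h))" using div_less_power_Suc[OF b0] by simp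
  have "z div b < N" if "z < N" using that div_le_dividend[of z b] by linarith
  then show ?thesis unfolding * using True
    by (cases y) (auto simp: inbox_def children_def split: if_splits)
next
  case False
  then show ?thesis
    by (cases y) (auto simp: inbox_def children_def split: if_splits)
qed

lemma inbox_Count: "(y, a) \<in> inbox t (Count j v z) \<longleftrightarrow>
    t = 4 + 2 * h \<and> j < K \<and> a = 0 \<and> (y = Join j z v \<and> adj F z v \<or> y = Wedge j z v \<and> adj F (r j) z \<and> v < N) \<or>
    5 + 2 * h \<le> t \<and> t < 5 + 3 * h \<and> j < K \<and>
      (\<exists>z'. z' div b = z \<and> y = Count j v z' \<and> a = partial_count (t - (5 + 2 * h)) j v z' \<and> 0 < a)"
  using N(2)
  by (cases y) (auto simp: inbox_def children_def split: if_splits)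

lemma inbox_Name: "(y, a) \<in> inbox t (Name v z) \<longleftrightarrow>
    t = 5 + 3 * h \<and> z < K \<and> \<tau> \<le> real (common F (r z) v) \<and> y = Count z v 0 \<and> a = common F (r z) v \<or>
    6 + 3 * h \<le> t \<and> t \<le> 6 + 4 * h \<and>
      (\<exists>z'. z' div b = z \<and> y = Name v z' \<and> matching_slots (t - (6 + 3 * h)) v z' \<noteq> {} \<and>
         a = Min (matching_slots (t - (6 + 3 * h)) v z'))"
proof -
  have "5 + 3 * h - (5 + 2 * h) = h" by simp
  then show ?thesis using \<tau>
    by (cases y) (auto simp: inbox_def children_def partial_count_top split: if_splits)
qed

lemma inbox_empty: "inbox t x = {} \<longleftrightarrow> \<not> (\<exists>y a. (y, a) \<in> inbox t x)"
  by auto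

lemma inbox_Count_image:
  assumes "5 + 2 * h \<le> t" "t < 5 + 3 * h" "j < K"
  shows "inbox t (Count j v z) = (\<lambda>z'. (Count j v z', partial_count (t - (5 + 2 * h)) j v z')) `
    {z'. z' div b = z \<and> 0 < partial_count (t - (5 + 2 * h)) j v z'}" (is "_ = ?I")
proof -
  have "(y, a) \<in> inbox t (Count j v z) \<longleftrightarrow> (y, a) \<in> ?I" for y a
    unfolding inbox_Count using assms by auto
  then show ?thesis by auto
qed

lemma inbox_Name_image:
  assumes "6 + 3 * h \<le> t" "t \<le> 6 + 4 * h"
  shows "inbox t (Name v z) = (\<lambda>z'. (Name v z', Min (matching_slots (t - (6 + 3 * h)) v z'))) `
    {z'. z' div b = z \<and> matching_slots (t - (6 + 3 * h)) v z' \<noteq> {}}" (is "_ = ?I")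
proof -
  have "(y, a) \<in> inbox t (Name v z) \<longleftrightarrow> (y, a) \<in> ?I" for y a
    unfolding inbox_Name using assms by auto
  then show ?thesis by auto
qed

lemma st_Suc_Edge: "1 \<le> t \<Longrightarrow> st (Suc t) (Edge u v z) = upd (Suc t) (Edge u v z) (inbox t (Edge u v z))"
proof -
  assume t: "1 \<le> t"
  have "inbox t (Edge u v z) \<noteq> {} \<longleftrightarrow> 2 \<le> Suc t \<and> Suc t \<le> 2 + h \<and> adj F u v \<and> z < K \<and> z < b ^ (Suc t - 2)"
    unfolding inbox_empty inbox_Edge using t K(1) by (cases "t = 1") (auto simp: adj_def)
  then show ?thesis by auto
qed

lemma st_Suc_Ref: "1 \<le> t \<Longrightarrow> st (Suc t) (Ref j u z) = upd (Suc t) (Ref j u z) (inbox t (Ref j u z))"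
proof -
  assume t: "1 \<le> t"
  have "inbox t (Ref j u z) \<noteq> {} \<longleftrightarrow> 2 \<le> Suc t \<and> Suc t \<le> 2 + h \<and> j < K \<and> u = r j \<and> z < N \<and> z < b ^ (Suc t - 2)"
    unfolding inbox_empty inbox_Ref using t N(1) by (cases "t = 1") auto
  then show ?thesis by auto
qed

lemma st_Suc_Wedge: "1 \<le> t \<Longrightarrow> st (Suc t) (Wedge j w z) = upd (Suc t) (Wedge j w z) (inbox t (Wedge j w z))"
proof -
  assume t: "1 \<le> t"
  have "inbox t (Wedge j w z) \<noteq> {} \<longleftrightarrow> 4 + h \<le> Suc t \<and> Suc t \<le> 4 + 2 * h \<and> j < K \<and> adj F (r j) w \<and>
      z < N \<and> z < b ^ (Suc t - (4 + h))"
    unfolding inbox_empty inbox_Wedge using t N(1) by (cases "t = 3 + h") auto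
  then show ?thesis by auto
qed

lemma st_Suc_Join: "1 \<le> t \<Longrightarrow> st (Suc t) (Join j u v) = upd (Suc t) (Join j u v) (inbox t (Join j u v))"
proof (cases "t = 2 + h")
  case True
  then show ?thesis by (auto simp: inbox_Join dest: adjF)
next
  case False
  then have "inbox t (Join j u v) \<noteq> {} \<longleftrightarrow> 3 + h \<le> t \<and> t < 4 + 2 * h \<and> j < K \<and> adj F u v"
    unfolding inbox_empty inbox_Join by auto
  then show ?thesis using False by auto
qed

lemma st_Suc_Count: "1 \<le> t \<Longrightarrow> st (Suc t) (Count j v z) = upd (Suc t) (Count j v z) (inbox t (Count j v z))"
proof -
  consider "t = 4 + 2 * h" | "5 + 2 * h \<le> t" "t < 5 + 3 * h" "j < K"
    | "t \<noteq> 4 + 2 * h" "\<not> (5 + 2 * h \<le> t \<and> t < 5 + 3 * h \<and> j < K)" by blast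
  then show ?thesis
  proof cases
    case 1
    then show ?thesis by (auto simp: inbox_Count partial_count_0 dest: adjF)
  next
    case 2
    define l where "l = t - (5 + 2 * h)"
    have l: "Suc t - (5 + 2 * h) = Suc l" using 2 by (simp add: l_def)
    let ?Z = "{z'. z' div b = z \<and> 0 < partial_count l j v z'}"
    have I: "inbox t (Count j v z) = (\<lambda>z'. (Count j v z', partial_count l j v z')) ` ?Z"
      using inbox_Count_image[OF 2] by (simp add: l_def)
    have fin: "finite ?Z" by (rule finite_subset[OF _ finite_div_eq[of z]]) auto
    have S: "(\<Sum>x\<in>inbox t (Count j v z). snd x) = partial_count (Suc l) j v z"
    proof -
      have "inj_on (\<lambda>z'. (Count j v z', partial_count l j v z')) ?Z" by (simp add: inj_on_def)
      from sum.reindex[OF this, of snd] show ?thesis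
        unfolding I by (simp add: partial_count_Suc)
    qed
    have iff: "0 < partial_count (Suc l) j v z \<longleftrightarrow> ?Z \<noteq> {}"
    proof -
      have "0 < (\<Sum>z'\<in>?Z. partial_count l j v z') \<longleftrightarrow> ?Z \<noteq> {}"
      proof (cases "?Z = {}")
        case True
        then show ?thesis by (simp only: sum.empty) simp
      next
        case False
        then have "0 < (\<Sum>z'\<in>?Z. partial_count l j v z')" by (intro sum_pos fin) auto
        then show ?thesis using False by (simp only: simp_thms)
      qed
      then show ?thesis by (simp only: partial_count_Suc)
    qed
    have ne: "inbox t (Count j v z) = {} \<longleftrightarrow> \<not> 0 < partial_count (Suc l) j v z"
      unfolding I image_is_empty iff by (rule not_not[symmetric])
    show ?thesis unfolding st.simps upd.simps S ne l using 2 by auto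
  next
    case 3
    then have "inbox t (Count j v z) = {}" unfolding inbox_empty inbox_Count by auto
    then show ?thesis using 3 by auto
  qed
qed

lemma st_Suc_Name:
  assumes "t < 6 + 4 * h"
  shows "1 \<le> t \<Longrightarrow> st (Suc t) (Name v z) = upd (Suc t) (Name v z) (inbox t (Name v z))"
proof -
  consider "t = 5 + 3 * h" | "6 + 3 * h \<le> t" "t \<le> 6 + 4 * h"
    | "t \<noteq> 5 + 3 * h" "\<not> (6 + 3 * h \<le> t)" using assms by linarith
  then show ?thesis
  proof cases
    case 1
    then have "inbox t (Name v z) \<noteq> {} \<longleftrightarrow> z < K \<and> \<tau> \<le> real (common F (r z) v)"
      unfolding inbox_empty inbox_Name by auto
    then show ?thesis using 1 by (auto simp: matching_slots_0)
  next
    case 2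
    define l where "l = t - (6 + 3 * h)"
    have l: "Suc t - (6 + 3 * h) = Suc l" using 2 by (simp add: l_def)
    let ?Z = "{z'. z' div b = z \<and> matching_slots l v z' \<noteq> {}}"
    have I: "inbox t (Name v z) = (\<lambda>z'. (Name v z', Min (matching_slots l v z'))) ` ?Z"
      using inbox_Name_image[OF 2] by (simp add: l_def)
    have ne: "inbox t (Name v z) = {} \<longleftrightarrow> matching_slots (Suc l) v z = {}"
      unfolding I matching_slots_Suc by blast
    have "snd ` inbox t (Name v z) = (\<lambda>z'. Min (matching_slots l v z')) ` ?Z"
      unfolding I image_image by simp
    then have mn: "matching_slots (Suc l) v z \<noteq> {} \<Longrightarrow> Min (snd ` inbox t (Name v z)) = Min (matching_slots (Suc l) v z)"
      using Min_matching_slots_Suc by simp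
    show ?thesis unfolding st.simps upd.simps ne l using 2 mn assms by auto
  next
    case 3
    then have "inbox t (Name v z) = {}" unfolding inbox_empty inbox_Name by auto
    then show ?thesis using 3 by auto
  qed
qed

lemma st_Suc: "1 \<le> t \<Longrightarrow> t < T \<Longrightarrow> st (Suc t) x = upd (Suc t) x (inbox t x)"
proof (cases x)
  case (Edge u v z)
  then show "1 \<le> t \<Longrightarrow> ?thesis" using st_Suc_Edge by simp
next
  case (Ref j u z)
  then show "1 \<le> t \<Longrightarrow> ?thesis" using st_Suc_Ref by simp
next
  case (Join j u v)
  then show "1 \<le> t \<Longrightarrow> ?thesis" using st_Suc_Join by simp
next
  case (Wedge j w z)
  then show "1 \<le> t \<Longrightarrow> ?thesis" using st_Suc_Wedge by simp
next
  case (Count j v z)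
  then show "1 \<le> t \<Longrightarrow> ?thesis" using st_Suc_Count by simp
next
  case (Name v z)
  then show "1 \<le> t \<Longrightarrow> t < T \<Longrightarrow> ?thesis" using st_Suc_Name by simp
qed auto

lemma partial_count_pos: "0 < partial_count l j v y \<Longrightarrow> \<exists>w. adj F (r j) w \<and> adj F w v \<and> y = w div b ^ l"
  unfolding partial_count_def card_gt_0_iff by auto

lemma partial_count_le: "partial_count l j v y \<le> N"
proof -
  have "partial_count l j v y \<le> card {..<N}"
    unfolding partial_count_def by (rule card_mono) (auto dest: adjF)
  then show ?thesis by simp
qed

lemma st_Count_pos: "st t (Count j v y) = Some a \<Longrightarrow>
    j < K \<and> v < N \<and> y < N \<and> a \<le> N \<and> (\<exists>w. adj F (r j) w \<and> adj F w v \<and> y = w div b ^ (t - (5 + 2 * h)))"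
proof -
  assume "st t (Count j v y) = Some a"
  then have j: "j < K" and p: "0 < partial_count (t - (5 + 2 * h)) j v y" and a: "a = partial_count (t - (5 + 2 * h)) j v y"
    by (auto split: if_splits)
  obtain w where w: "adj F (r j) w" "adj F w v" "y = w div b ^ (t - (5 + 2 * h))"
    using partial_count_pos[OF p] by blast
  have "y \<le> w" unfolding w(3) by (rule div_le_dividend)
  moreover have "w < N" "v < N" using adjF w by auto
  ultimately have "y < N" "v < N" by simp_all
  then show ?thesis using w j a partial_count_le by blast
qed

lemma st_Name_ex: "st t (Name v y) = Some a \<Longrightarrow>
    v < N \<and> y < K \<and> a < K \<and> (\<exists>j<K. y = j div b ^ (t - (6 + 3 * h)))"
proof -
  assume st: "st t (Name v y) = Some a"
  define S where "S = matching_slots (t - (6 + 3 * h)) v y"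
  have S: "S \<noteq> {}" "a = Min S" using st by (auto simp: S_def split: if_splits)
  have "Min S \<in> S" using S by (intro Min_in) (auto simp: S_def)
  then have a: "a \<in> S" using S by simp
  then have "v < N" using matching_common_pos common_pos_less unfolding S_def by blast
  moreover have "a < K" "y = a div b ^ (t - (6 + 3 * h))" using a by (auto simp: S_def matching_slots_def)
  moreover have "a div b ^ (t - (6 + 3 * h)) \<le> a" by (rule div_le_dividend)
  ultimately show ?thesis by (metis le_less_trans)
qed

lemma F_less: "(u, v) \<in> F \<Longrightarrow> u < N \<and> v < N"
  using F by (auto simp: vertex_pairs_def)

lemma less_R: "x < N \<Longrightarrow> x < R" "x < K \<Longrightarrow> x < R"
  by simp_all

lemma st_nodes: "st t x = Some a \<Longrightarrow> x \<in> nodes"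
proof (cases x)
  case (Input u v)
  then show "st t x = Some a \<Longrightarrow> ?thesis" using F_less[of u v] by (auto simp: node_set_def split: if_splits)
next
  case (Slot j)
  then show "st t x = Some a \<Longrightarrow> ?thesis" by (auto simp: node_set_def split: if_splits)
next
  case (Edge u v y)
  then show "st t x = Some a \<Longrightarrow> ?thesis" using adjF[of u v] by (auto simp: node_set_def split: if_splits)
next
  case (Ref j u y)
  then show "st t x = Some a \<Longrightarrow> ?thesis" using r[of j] by (auto simp: node_set_def split: if_splits)
next
  case (Join j u v)
  then show "st t x = Some a \<Longrightarrow> ?thesis" using adjF[of u v] by (auto simp: node_set_def split: if_splits)
next
  case (Wedge j w y)
  then show "st t x = Some a \<Longrightarrow> ?thesis" using adjF[of "r j" w] by (auto simp: node_set_def split: if_splits)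
next
  case (Count j v y)
  then show "st t x = Some a \<Longrightarrow> ?thesis" using st_Count_pos[of t j v y a] by (auto simp: node_set_def simp del: st.simps)
next
  case (Name v y)
  then show "st t x = Some a \<Longrightarrow> ?thesis" using st_Name_ex[of t v y a] by (auto simp: node_set_def simp del: st.simps)
qed

lemma st_value: "st t x = Some a \<Longrightarrow> a < Suc R"
proof (cases x)
  case (Count j v y)
  then show "st t x = Some a \<Longrightarrow> ?thesis" using st_Count_pos[of t j v y a] by (auto simp del: st.simps)
next
  case (Name v y)
  then show "st t x = Some a \<Longrightarrow> ?thesis" using st_Name_ex[of t v y a] by (auto simp del: st.simps)
next
  case (Slot j)
  then show "st t x = Some a \<Longrightarrow> ?thesis" using r[of j] by (auto split: if_splits)
qed (use N(1) in \<open>auto split: if_splits\<close>)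

lemma out_nodes: "st t x = Some a \<Longrightarrow> out t x a \<subseteq> nodes"
proof -
  assume st: "st t x = Some a"
  then have x: "arguments_below R x" using st_nodes by (simp add: node_set_def)
  have R0: "0 < R" using N(1) by simp
  have ch: "z \<in> children b K y \<Longrightarrow> z < R" "z \<in> children b N y \<Longrightarrow> z < R" for y z
    by (auto simp: children_def less_R)
  have d: "y div b < R" if "y < R" for y using that div_le_dividend[of y b] by linarith
  show ?thesis
  proof (cases x)
    case (Slot j)
    then have "j < K" "a = r j" using st by (auto split: if_splits)
    then show ?thesis using Slot r[of j] R0 by (auto simp: node_set_def)
  qed (use x R0 ch d in \<open>auto simp: node_set_def simp del: max_less_iff_conj less_max_iff_disj split: if_splits\<close>)
qed

lemma card_children: "finite (children b X y)" "card (children b X y) \<le> b"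
proof -
  have sub: "children b X y \<subseteq> {y * b..<y * b + b}"
    unfolding div_eq_interval[OF b0, symmetric] by (auto simp: children_def)
  then show "finite (children b X y)" by (rule finite_subset) simp
  have "card (children b X y) \<le> card {y * b..<y * b + b}" by (rule card_mono[OF _ sub]) simp
  then show "card (children b X y) \<le> b" by simp
qed

lemma outdegree: "card (out t x a) \<le> b"
proof -
  have img: "card (f ` children b X y) \<le> b" for f :: "nat \<Rightarrow> node" and X y
    using card_image_le[OF card_children(1)] card_children(2) le_trans by blast
  have two: "card {y, z} \<le> b" for y z :: node
  proof -
    have "card {y, z} \<le> 2" by (simp add: card_insert_if)
    then show ?thesis using b by simp
  qed
  have one: "card {y} \<le> b" for y :: node using b by simp
  show ?thesis
    using img two one by (cases x) (simp_all del: card.insert)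
qed

lemma card_inbox_le: "fst ` inbox t x \<subseteq> P \<Longrightarrow> finite P \<Longrightarrow> card (inbox t x) \<le> card P"
proof -
  assume P: "fst ` inbox t x \<subseteq> P" "finite P"
  have "inj_on fst (inbox t x)" by (auto simp: inj_on_def inbox_def)
  then have "card (inbox t x) = card (fst ` inbox t x)" by (rule card_image[symmetric])
  then show ?thesis using card_mono[OF P(2,1)] by simp
qed

lemma indegree: "card (inbox t x) \<le> b"
proof -
  have two: "card (inbox t x) \<le> b" if "fst ` inbox t x \<subseteq> {y, y'}" for y y'
  proof -
    have "card (inbox t x) \<le> card {y, y'}" using that by (rule card_inbox_le) simp
    also have "\<dots> \<le> 2" by (simp add: card_insert_if)
    finally show ?thesis using b by simp
  qed
  have fib: "card (inbox t x) \<le> b" if "fst ` inbox t x \<subseteq> f ` {z'. z' div b = z}" for f z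
  proof -
    have "card (inbox t x) \<le> card (f ` {z'. z' div b = z})"
      using that by (rule card_inbox_le) (simp add: finite_div_eq)
    also have "\<dots> \<le> card {z'. z' div b = z}" by (rule card_image_le[OF finite_div_eq])
    also have "\<dots> = b" by (simp add: div_eq_interval[OF b0])
    finally show ?thesis .
  qed
  show ?thesis
  proof (cases x)
    case (Input u v)
    then show ?thesis by (simp add: inbox_Input)
  next
    case (Slot j)
    then show ?thesis by (simp add: inbox_Slot)
  next
    case (Edge u v z)
    show ?thesis
    proof (cases "t = 1")
      case True
      show ?thesis by (rule two[of "Input u v" "Input v u"]) (use Edge True in \<open>auto simp: inbox_Edge\<close>)
    next
      case False
      show ?thesis by (rule two[of "Edge u v (z div b)" "Edge u v (z div b)"]) (use Edge False in \<open>auto simp: inbox_Edge\<close>)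
    qed
  next
    case (Ref j u z)
    show ?thesis by (rule two[of "Slot j" "Ref j u (z div b)"]) (use Ref in \<open>auto simp: inbox_Ref\<close>)
  next
    case (Join j u v)
    show ?thesis
    proof (cases "t = 2 + h")
      case True
      show ?thesis by (rule two[of "Edge u v j" "Ref j u v"]) (use Join True in \<open>auto simp: inbox_Join\<close>)
    next
      case False
      show ?thesis by (rule two[of "Join j u v" "Join j u v"]) (use Join False in \<open>auto simp: inbox_Join\<close>)
    qed
  next
    case (Wedge j w z)
    show ?thesis by (rule two[of "Join j (r j) w" "Wedge j w (z div b)"]) (use Wedge in \<open>auto simp: inbox_Wedge\<close>)
  next
    case (Count j v z)
    show ?thesis
    proof (cases "t = 4 + 2 * h")
      case True
      show ?thesis by (rule two[of "Join j z v" "Wedge j z v"]) (use Count True in \<open>auto simp: inbox_Count\<close>)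
    next
      case False
      show ?thesis by (rule fib[of "Count j v" z]) (use Count False in \<open>auto simp: inbox_Count\<close>)
    qed
  next
    case (Name v z)
    show ?thesis
    proof (cases "t = 5 + 3 * h")
      case True
      show ?thesis by (rule two[of "Count z v 0" "Count z v 0"]) (use Name True in \<open>auto simp: inbox_Name\<close>)
    next
      case False
      show ?thesis by (rule fib[of "Name v" z]) (use Name False in \<open>auto simp: inbox_Name\<close>)
    qed
  qed
qed

lemma messages:
  assumes \<Delta>: "1 \<le> \<Delta>" "\<And>u. vertex_degree F u \<le> \<Delta>"
  shows "card {(x, y). \<exists>a. st t x = Some a \<and> y \<in> out t x a} \<le> 15 * (K * N * \<Delta>)"
proof -
  let ?A = "{(u, v). adj F u v}"
  let ?W = "{(j, w). j < K \<and> adj F (r j) w}"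
  define l where "l = t - (5 + 2 * h)"
  define l' where "l' = t - (6 + 3 * h)"
  define L where "L =
    [(\<lambda>(u, v). (Input u v, Edge u v 0)) ` ?A,
     (\<lambda>(u, v). (Input u v, Edge v u 0)) ` ?A,
     (\<lambda>j. (Slot j, Ref j (r j) 0)) ` {..<K},
     (\<lambda>((u, v), z). (Edge u v (z div b), Edge u v z)) ` (?A \<times> {..<K}),
     (\<lambda>((u, v), z). (Edge u v z, Join z u v)) ` (?A \<times> {..<K}),
     (\<lambda>(j, z). (Ref j (r j) (z div b), Ref j (r j) z)) ` ({..<K} \<times> {..<N}),
     (\<lambda>(j, z). (Ref j (r j) z, Join j (r j) z)) ` ({..<K} \<times> {..<N}),
     (\<lambda>((u, v), j). (Join j u v, Join j u v)) ` (?A \<times> {..<K}),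
     (\<lambda>((u, v), j). (Join j u v, Wedge j v 0)) ` (?A \<times> {..<K}),
     (\<lambda>((u, v), j). (Join j u v, Count j v u)) ` (?A \<times> {..<K}),
     (\<lambda>((j, w), z). (Wedge j w (z div b), Wedge j w z)) ` (?W \<times> {..<N}),
     (\<lambda>((j, w), z). (Wedge j w z, Count j z w)) ` (?W \<times> {..<N}),
     (\<lambda>((j, w), v). (Count j v (w div b ^ l), Count j v (w div b ^ l div b))) ` (?W \<times> {..<N}),
     (\<lambda>((j, w), v). (Count j v (w div b ^ l), Name v j)) ` (?W \<times> {..<N}),
     (\<lambda>(j, v). (Name v (j div b ^ l'), Name v (j div b ^ l' div b))) ` ({..<K} \<times> {..<N})]"
  have finA: "finite ?A" by (rule finite_subset[of _ "{..<N} \<times> {..<N}"]) (auto dest: adjF)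
  have finW: "finite ?W" by (rule finite_subset[of _ "{..<K} \<times> {..<N}"]) (auto dest: adjF)
  have cA: "card ?A \<le> N * \<Delta>"
  proof -
    have "?A = (SIGMA u:{..<N}. {v. adj F u v})" by (auto dest: adjF)
    then have "card ?A = (\<Sum>u<N. vertex_degree F u)"
      using finite_adj[OF F] by (simp add: vertex_degree_def)
    also have "\<dots> \<le> N * \<Delta>" using sum_bounded_above[of "{..<N}" "vertex_degree F" \<Delta>] \<Delta>(2) by simp
    finally show ?thesis .
  qed
  have cW: "card ?W \<le> K * \<Delta>"
  proof -
    have "?W = (SIGMA j:{..<K}. {v. adj F (r j) v})" by auto
    then have "card ?W = (\<Sum>j<K. vertex_degree F (r j))"
      using finite_adj[OF F] by (simp add: vertex_degree_def)
    also have "\<dots> \<le> K * \<Delta>" using sum_bounded_above[of "{..<K}" "\<lambda>j. vertex_degree F (r j)" \<Delta>] \<Delta>(2) by simp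
    finally show ?thesis .
  qed
  have K1: "x \<le> K * x" and N1: "x \<le> N * x" and D1: "x \<le> \<Delta> * x" for x
    using mult_right_mono[OF K(1), of x] mult_right_mono[OF N(1), of x] mult_right_mono[OF \<Delta>(1), of x] by simp_all
  have bounds: "card ?A \<le> K * N * \<Delta>" "card {..<K} \<le> K * N * \<Delta>" "card (?A \<times> {..<K}) \<le> K * N * \<Delta>"
    "card ({..<K} \<times> {..<N}) \<le> K * N * \<Delta>" "card (?W \<times> {..<N}) \<le> K * N * \<Delta>"
  proof -
    show "card ?A \<le> K * N * \<Delta>" unfolding mult.assoc using cA K1[of "N * \<Delta>"] by (rule le_trans)
    show "card {..<K} \<le> K * N * \<Delta>" using le_trans[OF N1[of K] D1[of "N * K"]] by (simp only: card_lessThan ac_simps)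
    show "card (?A \<times> {..<K}) \<le> K * N * \<Delta>"
      using mult_right_mono[OF cA, of K] by (simp add: card_cartesian_product ac_simps)
    show "card ({..<K} \<times> {..<N}) \<le> K * N * \<Delta>"
      using D1[of "N * K"] by (simp add: card_cartesian_product ac_simps)
    show "card (?W \<times> {..<N}) \<le> K * N * \<Delta>"
      using mult_right_mono[OF cW, of N] by (simp add: card_cartesian_product ac_simps)
  qed
  have small: "card S \<le> K * N * \<Delta>" if "S \<in> set L" for S
  proof -
    have img: "card (f ` X) \<le> K * N * \<Delta>" if "finite X" "card X \<le> K * N * \<Delta>" for f :: "'x \<Rightarrow> node \<times> node" and X
      using card_image_le[OF that(1), of f] that(2) by simp
    have fins: "finite (?A \<times> {..<K})" "finite ({..<K} \<times> {..<N})" "finite (?W \<times> {..<N})" "finite {..<K}"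
      using finA finW by simp_all
    show ?thesis using that unfolding L_def list.set insert_iff empty_iff
      by (elim disjE FalseE; (simp only:)?; intro img fins finA bounds)
  qed
  have in_L: "p \<in> \<Union>(set L)" if "p \<in> S" "S \<in> set L" for p S using that by blast
  have "(x, y) \<in> \<Union>(set L)" if xa: "st t x = Some a" and y: "y \<in> out t x a" for x y a
  proof (cases x)
    case (Input u v)
    then have "(u, v) \<in> ?A" using xa by (auto simp: adj_def split: if_splits)
    moreover have "y = Edge u v 0 \<or> y = Edge v u 0" using y Input by simp
    ultimately have "(x, y) \<in> (\<lambda>(u, v). (Input u v, Edge u v 0)) ` ?A \<or> (x, y) \<in> (\<lambda>(u, v). (Input u v, Edge v u 0)) ` ?A"
      using Input by (auto intro!: image_eqI[of _ _ "(u, v)"])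
    then show ?thesis by (auto simp only: L_def list.set Union_insert Un_iff)
  next
    case (Slot j)
    then have "(x, y) \<in> (\<lambda>j. (Slot j, Ref j (r j) 0)) ` {..<K}" using xa y by (auto split: if_splits)
    then show ?thesis by (auto simp only: L_def list.set Union_insert Un_iff)
  next
    case (Edge u v z)
    then have "adj F u v" "z < K" using xa by (auto split: if_splits)
    then have uv: "(u, v) \<in> ?A" and z: "z < K" by auto
    have "(x, y) \<in> (\<lambda>((u, v), z). (Edge u v (z div b), Edge u v z)) ` (?A \<times> {..<K}) \<or>
        (x, y) \<in> (\<lambda>((u, v), z). (Edge u v z, Join z u v)) ` (?A \<times> {..<K})"
    proof (cases "t < 2 + h")
      case True
      then obtain z' where z': "y = Edge u v z'" "z' < K" "z' div b = z" using y Edge by (auto simp: children_def)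
      show ?thesis by (rule disjI1, rule image_eqI[of _ _ "((u, v), z')"]) (use z' uv Edge in simp_all)
    next
      case False
      then have "y = Join z u v" using y Edge by simp
      then show ?thesis by (intro disjI2 image_eqI[of _ _ "((u, v), z)"]) (use z uv Edge in simp_all)
    qed
    then show ?thesis by (auto simp only: L_def list.set Union_insert Un_iff)
  next
    case (Ref j u z)
    then have "u = r j" "j < K" "z < N" using xa by (auto split: if_splits)
    then have "(x, y) \<in> (\<lambda>(j, z). (Ref j (r j) (z div b), Ref j (r j) z)) ` ({..<K} \<times> {..<N}) \<or>
        (x, y) \<in> (\<lambda>(j, z). (Ref j (r j) z, Join j (r j) z)) ` ({..<K} \<times> {..<N})"
      using Ref y by (fastforce simp: children_def split: if_splits)
    then show ?thesis by (auto simp only: L_def list.set Union_insert Un_iff)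
  next
    case (Join j u v)
    then have "((u, v), j) \<in> ?A \<times> {..<K}" using xa by (auto split: if_splits)
    moreover have "y = Join j u v \<or> y = Wedge j v 0 \<or> y = Count j v u" using y Join by (auto split: if_splits)
    ultimately have "(x, y) \<in> (\<lambda>((u, v), j). (Join j u v, Join j u v)) ` (?A \<times> {..<K}) \<or>
        (x, y) \<in> (\<lambda>((u, v), j). (Join j u v, Wedge j v 0)) ` (?A \<times> {..<K}) \<or>
        (x, y) \<in> (\<lambda>((u, v), j). (Join j u v, Count j v u)) ` (?A \<times> {..<K})"
      unfolding Join by (elim disjE) (simp_all add: image_iff Bex_def)
    then show ?thesis by (auto simp only: L_def list.set Union_insert Un_iff)
  next
    case (Wedge j w z)
    then have "j < K" "adj F (r j) w" "z < N" using xa by (auto split: if_splits)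
    then have jw: "(j, w) \<in> ?W" and z: "z < N" by auto
    have "(x, y) \<in> (\<lambda>((j, w), z). (Wedge j w (z div b), Wedge j w z)) ` (?W \<times> {..<N}) \<or>
        (x, y) \<in> (\<lambda>((j, w), z). (Wedge j w z, Count j z w)) ` (?W \<times> {..<N})"
    proof (cases "t < 4 + 2 * h")
      case True
      then obtain z' where z': "y = Wedge j w z'" "z' < N" "z' div b = z" using y Wedge by (auto simp: children_def)
      show ?thesis by (rule disjI1, rule image_eqI[of _ _ "((j, w), z')"]) (use z' jw Wedge in simp_all)
    next
      case False
      then have "y = Count j z w" using y Wedge by simp
      then show ?thesis by (intro disjI2 image_eqI[of _ _ "((j, w), z)"]) (use z jw Wedge in simp_all)
    qed
    then show ?thesis by (auto simp only: L_def list.set Union_insert Un_iff)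
  next
    case (Count j v z)
    then obtain w where w: "j < K" "v < N" "adj F (r j) w" "z = w div b ^ l"
      using st_Count_pos[of t j v z a] xa unfolding l_def by blast
    then have W: "((j, w), v) \<in> ?W \<times> {..<N}" by simp
    have "y = Count j v (z div b) \<or> y = Name v j" using y Count by (auto split: if_splits)
    then have "(x, y) = (\<lambda>((j, w), v). (Count j v (w div b ^ l), Count j v (w div b ^ l div b))) ((j, w), v) \<or>
        (x, y) = (\<lambda>((j, w), v). (Count j v (w div b ^ l), Name v j)) ((j, w), v)"
      unfolding Count w(4) by simp
    with W have "(x, y) \<in> (\<lambda>((j, w), v). (Count j v (w div b ^ l), Count j v (w div b ^ l div b))) ` (?W \<times> {..<N}) \<or>
        (x, y) \<in> (\<lambda>((j, w), v). (Count j v (w div b ^ l), Name v j)) ` (?W \<times> {..<N})"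
      by (metis (no_types, lifting) image_eqI)
    then show ?thesis by (auto simp only: L_def list.set Union_insert Un_iff)
  next
    case (Name v z)
    then obtain j where j: "v < N" "j < K" "z = j div b ^ l'"
      using st_Name_ex[of t v z a] xa unfolding l'_def by blast
    have "(x, y) \<in> (\<lambda>(j, v). (Name v (j div b ^ l'), Name v (j div b ^ l' div b))) ` ({..<K} \<times> {..<N})"
      by (rule image_eqI[of _ _ "(j, v)"]) (use j y Name in simp_all)
    then show ?thesis by (auto simp only: L_def list.set Union_insert Un_iff)
  qed
  then have sub: "{(x, y). \<exists>a. st t x = Some a \<and> y \<in> out t x a} \<subseteq> \<Union>(set L)" by blast
  have fin: "finite (\<Union>(set L))" unfolding L_def using finA finW by simp
  have "card {(x, y). \<exists>a. st t x = Some a \<and> y \<in> out t x a} \<le> card (\<Union>(set L))"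
    by (rule card_mono[OF fin sub])
  also have "\<dots> \<le> length L * (K * N * \<Delta>)" by (rule card_Union_list_le[OF small])
  also have "length L = 15" by (simp add: L_def)
  finally show ?thesis .
qed

lemma st_final_Name: "st T (Name v y) =
    (if y = 0 \<and> (\<exists>j<K. \<tau> \<le> real (common F (r j) v)) then Some (Min {j. j < K \<and> \<tau> \<le> real (common F (r j) v)}) else None)"
proof -
  have "j div b ^ h = 0" if "j < K" for j using that K(2) by simp
  then have "matching_slots h v y = (if y = 0 then {j. j < K \<and> \<tau> \<le> real (common F (r j) v)} else {})"
    by (auto simp: matching_slots_def)
  moreover have "T - (6 + 3 * h) = h" by simp
  ultimately show ?thesis by auto
qed

lemma result_total: "(\<Sum>x\<in>nodes. case st T x of None \<Rightarrow> 0 | Some a \<Rightarrow> 2 * length (result x a)) \<le> 2 * N"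
proof -
  let ?X = "(\<lambda>v. Name v 0) ` {..<N}"
  have zero: "(case st T x of None \<Rightarrow> 0 | Some a \<Rightarrow> 2 * length (result x a)) = 0" if "x \<notin> ?X" for x
  proof (cases x)
    case (Name v y)
    have "st T x = None"
    proof (rule ccontr)
      assume "st T x \<noteq> None"
      then obtain a where a: "st T (Name v y) = Some a" using Name by auto
      then have "y = 0" by (auto simp: st_final_Name simp del: st.simps split: if_splits)
      moreover have "v < N" using st_Name_ex[OF a] by blast
      ultimately show False using that Name by auto
    qed
    then show ?thesis by simp
  qed (auto split: option.split)
  have "(\<Sum>x\<in>nodes. case st T x of None \<Rightarrow> 0 | Some a \<Rightarrow> 2 * length (result x a))
      = (\<Sum>x\<in>nodes \<inter> ?X. case st T x of None \<Rightarrow> 0 | Some a \<Rightarrow> 2 * length (result x a))"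
    using node_set_finite_card zero by (intro sum.mono_neutral_right) auto
  also have "\<dots> \<le> (\<Sum>x\<in>nodes \<inter> ?X. 2)"
    by (intro sum_mono) (auto split: option.split)
  also have "\<dots> = 2 * card (nodes \<inter> ?X)" by simp
  also have "\<dots> \<le> 2 * card ?X" by (intro mult_left_mono card_mono) auto
  also have "\<dots> \<le> 2 * N" using card_image_le[of "{..<N}" "\<lambda>v. Name v 0"] by simp
  finally show ?thesis .
qed

end

lemma outputs_clusters_names:
  assumes part: "hidden_partition n k V" and n: "1 \<le> n"
    and name: "\<And>u v. u < k * n \<Longrightarrow> v < k * n \<Longrightarrow> name u = name v \<longleftrightarrow> same_cluster k V u v"
    and c: "\<And>i. i < M \<Longrightarrow> c i = pair_words (L i)"
    and L: "(\<Union>i<M. set (L i)) = {(v, name v) | v. v < k * n}"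
  shows "outputs_clusters M c (V ` {..<k})"
proof -
  note disj = hidden_partition_unique[OF part] and cover = hidden_partition_cover[OF part]
    and less = hidden_partition_less[OF part]
  have ne: "\<exists>u. u \<in> V i" if "i < k" for i
    using part that n unfolding hidden_partition_def by (metis all_not_in_conv card.empty not_one_le_zero)
  have cl: "{v. v < k * n \<and> name v = name u} = V i" if "i < k" "u \<in> V i" for i u
  proof (intro set_eqI iffI)
    fix v assume "v \<in> {v. v < k * n \<and> name v = name u}"
    then have "v < k * n" "name v = name u" by auto
    then have "same_cluster k V v u" using name[OF _ less[OF that]] by simp
    then show "v \<in> V i" using disj that unfolding same_cluster_def by metis
  next
    fix v assume v: "v \<in> V i"
    have "same_cluster k V v u" using v that by (auto simp: same_cluster_def)
    then have "name v = name u" using name[OF less[OF that(1) v] less[OF that]] by simp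
    then show "v \<in> {v. v < k * n \<and> name v = name u}" using less[OF that(1) v] by simp
  qed
  let ?S = "{(v, name v) | v. v < k * n}"
  have R: "Range ?S = name ` {..<k * n}" by auto
  have "(\<lambda>a. {v. (v, a) \<in> ?S}) ` Range ?S = (\<lambda>u. {v. v < k * n \<and> name v = name u}) ` {..<k * n}"
    unfolding R image_image by (intro image_cong) auto
  also have "\<dots> = V ` {..<k}"
  proof
    show "(\<lambda>u. {v. v < k * n \<and> name v = name u}) ` {..<k * n} \<subseteq> V ` {..<k}"
    proof (rule image_subsetI)
      fix u assume "u \<in> {..<k * n}"
      then obtain i where i: "i < k" "u \<in> V i" using cover by auto
      show "{v. v < k * n \<and> name v = name u} \<in> V ` {..<k}"
        unfolding cl[OF i] using i(1) by simp
    qed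
    show "V ` {..<k} \<subseteq> (\<lambda>u. {v. v < k * n \<and> name v = name u}) ` {..<k * n}"
    proof (rule image_subsetI)
      fix i assume i: "i \<in> {..<k}"
      then obtain u where u: "u \<in> V i" using ne by auto
      show "V i \<in> (\<lambda>u. {v. v < k * n \<and> name v = name u}) ` {..<k * n}"
        by (rule image_eqI[of _ _ u]) (use cl[of i u] less[of i u] u i in auto)
    qed
  qed
  finally have im: "(\<lambda>a. {v. (v, a) \<in> ?S}) ` Range ?S = V ` {..<k}" .
  have sv: "single_valued ?S" by (auto simp: single_valued_def)
  show ?thesis unfolding outputs_clusters_def
  proof (intro exI[of _ L] conjI allI impI)
    show "c i = pair_words (L i)" if "i < M" for i using that by (rule c)
    show "single_valued (\<Union>i<M. set (L i))" unfolding L by (rule sv)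
    show "(\<lambda>a. {v. (v, a) \<in> (\<Union>i<M. set (L i))}) ` Range (\<Union>i<M. set (L i)) = V ` {..<k}"
      unfolding L by (rule im)
  qed
qed

lemma least_slot_names:
  fixes r :: "nat \<Rightarrow> nat" and K :: nat
  assumes part: "hidden_partition n k V" and n: "2 \<le> n" and F: "F \<subseteq> vertex_pairs (k * n)"
    and sep: "separates (k * n) k V \<tau> F" and r: "\<And>j. j < K \<Longrightarrow> r j < k * n"
    and hit: "\<And>i. i < k \<Longrightarrow> \<exists>j<K. r j \<in> V i"
  defines "S \<equiv> \<lambda>v. {j. j < K \<and> \<tau> \<le> real (common F (r j) v)}"
  shows "v < k * n \<Longrightarrow> S v \<noteq> {}"
    and "u < k * n \<Longrightarrow> v < k * n \<Longrightarrow> Min (S u) = Min (S v) \<longleftrightarrow> same_cluster k V u v"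
proof -
  note disj = hidden_partition_unique[OF part] and cover = hidden_partition_cover[OF part]
    and less = hidden_partition_less[OF part]
  have eq: "\<tau> \<le> real (common F u v) \<longleftrightarrow> same_cluster k V u v" if uv: "u < k * n" "v < k * n" for u v
  proof (cases "u = v")
    case True
    obtain i where i: "i < k" "u \<in> V i" using cover uv by blast
    have "card (V i) = n" using part i by (simp add: hidden_partition_def)
    then have "\<not> V i \<subseteq> {u}" using n card_mono[of "{u}" "V i"] by auto
    then obtain w where w: "w \<in> V i" "w \<noteq> u" by blast
    have "\<tau> \<le> real (common F u w)"
      using sep uv(1) less[OF i(1) w(1)] w i unfolding separates_def same_cluster_def by metis
    also have "common F u w \<le> common F u u"
      unfolding common_def using F finite_adj[OF F, of u] by (intro card_mono) (auto simp: adj_sym)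
    finally show ?thesis using True i by (auto simp: same_cluster_def)
  next
    case False
    then show ?thesis using sep uv unfolding separates_def by blast
  qed
  have S: "S v = {j. j < K \<and> same_cluster k V (r j) v}" if "v < k * n" for v
    using eq r that by (auto simp: S_def)
  have ne: "S v \<noteq> {}" if "v < k * n" for v
  proof -
    obtain i where "i < k" "v \<in> V i" using cover[OF \<open>v < k * n\<close>] by blast
    then show ?thesis using hit[of i] S[OF that] by (auto simp: same_cluster_def)
  qed
  have trans: "same_cluster k V w u \<Longrightarrow> same_cluster k V w v \<longleftrightarrow> same_cluster k V u v" for u v w
    using disj unfolding same_cluster_def by metis
  have symm: "same_cluster k V u v = same_cluster k V v u" for u v by (auto simp: same_cluster_def)
  show "v < k * n \<Longrightarrow> S v \<noteq> {}" by (rule ne)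
  assume uv: "u < k * n" "v < k * n"
  have mem: "Min (S w) \<in> S w" if "w < k * n" for w
  proof (rule Min_in[OF _ ne[OF that]])
    show "finite (S w)" unfolding S_def by (rule finite_subset[of _ "{..<K}"]) auto
  qed
  show "Min (S u) = Min (S v) \<longleftrightarrow> same_cluster k V u v"
  proof
    assume "Min (S u) = Min (S v)"
    then have "Min (S u) \<in> S u" "Min (S u) \<in> S v" using mem[OF uv(1)] mem[OF uv(2)] by simp_all
    then show "same_cluster k V u v" unfolding S[OF uv(1)] S[OF uv(2)] using trans by blast
  next
    assume "same_cluster k V u v"
    then have "S u = S v" unfolding S[OF uv(1)] S[OF uv(2)]
      using trans symm by (intro Collect_cong conj_cong refl) metis
    then show "Min (S u) = Min (S v)" by simp
  qed
qed

definition edge_target :: "nat \<times> nat \<Rightarrow> node" where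
  "edge_target e = Input (fst e) (snd e)"

definition node_coin :: "nat \<Rightarrow> real \<Rightarrow> node \<Rightarrow> nat pmf" where
  "node_coin N f x = (case x of
      Input u v \<Rightarrow> map_pmf (\<lambda>c. if c then 1 else 0) (bernoulli_pmf f)
    | Slot j \<Rightarrow> pmf_of_set {..<N}
    | _ \<Rightarrow> return_pmf 0)"

context clustering begin

lemma clustering_protocol:
  assumes "bij_betw code nodes {..<M}"
  shows "protocol nodes code M T"
  by standard (use assms node_set_finite_card in auto)

lemma clustering_succeeds:
  fixes f :: real and V :: "nat \<Rightarrow> nat set"
  assumes part: "hidden_partition n k V" and Nkn: "N = k * n" and n: "2 \<le> n"
    and code: "bij_betw code nodes {..<M}"
    and E: "E \<subseteq> vertex_pairs N" and D: "distributes M s E D"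
    and F: "F = {e \<in> E. \<omega> (code (edge_target e)) = 1}"
    and r: "\<And>j. j < K \<Longrightarrow> r j = \<omega> (code (Slot j))" "\<And>j. j < K \<Longrightarrow> r j < N"
    and \<Delta>: "1 \<le> \<Delta>" "\<And>u. vertex_degree F u \<le> \<Delta>"
    and s: "b \<le> s" and wb: "M * Suc R \<le> 2 ^ wb" "R \<le> 2 ^ wb"
    and B: "15 * (K * N * \<Delta>) \<le> B" "2 * card E \<le> B" "2 * N \<le> B"
    and sep: "separates N k V \<tau> F" and hit: "\<And>i. i < k \<Longrightarrow> \<exists>j<K. r j \<in> V i"
  defines "A \<equiv> protocol.algorithm nodes code M (Suc R) T wb edge_target start upd out (node_coin N f) result"
    and "H \<equiv> protocol.run nodes code M (Suc R) T edge_target start upd out result (\<lambda>i. pair_words (D i)) \<omega>"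
  shows "within_memory A s H" and "total_space A H \<le> (2 * T + 2) * B"
    and "outputs_clusters M (last H) (V ` {..<k})"
proof -
  have FE: "F \<subseteq> E" using F by auto
  interpret run: clustering_run N K b h \<tau> F r
    by standard (use FE E r in auto)
  have rec: "{(y, a). y \<in> nodes \<and> run.st t y = Some a \<and> x \<in> out t y a} = run.inbox t x" for t x
    using run.st_nodes by (auto simp: run.inbox_def)
  have msg: "{(x, y). x \<in> nodes \<and> (\<exists>a. run.st t x = Some a \<and> y \<in> out t x a)} = {(x, y). \<exists>a. run.st t x = Some a \<and> y \<in> out t x a}" for t
    using run.st_nodes by auto
  have EN: "u < N \<and> v < N \<and> u < v" if "(u, v) \<in> E" for u v using E that by (auto simp: vertex_pairs_def)
  interpret pr: protocol_run nodes code M "Suc R" T wb edge_target start upd out "node_coin N f" result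
    E D s B \<omega> run.st
  proof
    show "finite nodes" using node_set_finite_card by blast
    show "bij_betw code nodes {..<M}" by (rule code)
    show "distributes M s E D" by (rule D)
    show "finite E" using E finite_subset finite_vertex_pairs by blast
    show "edge_target ` E \<subseteq> nodes" using EN by (auto simp: edge_target_def node_set_def less_max_iff_disj)
    show "inj_on edge_target E" by (auto simp: inj_on_def edge_target_def)
    show "run.st 1 x = start x (\<omega> (code x)) (x \<in> edge_target ` E)" if "x \<in> nodes" for x
    proof (cases x)
      case (Input u v)
      have "(u, v) \<in> F \<longleftrightarrow> \<omega> (code (Input u v)) = 1 \<and> (u, v) \<in> E"
        unfolding F by (auto simp: edge_target_def)
      moreover have "Input u v \<in> edge_target ` E \<longleftrightarrow> (u, v) \<in> E"
        by (force simp: edge_target_def)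
      ultimately show ?thesis by (simp add: Input)
    qed (use r in auto)
    show "run.st (Suc t) x = upd (Suc t) x {(y, a). y \<in> nodes \<and> run.st t y = Some a \<and> x \<in> out t y a}"
      if "1 \<le> t" "t < T" for t x unfolding rec using that by (rule run.st_Suc)
    show "out t x a \<subseteq> nodes" if "run.st t x = Some a" for t x a using that by (rule run.out_nodes)
    show "a < Suc R" if "run.st t x = Some a" for t x a using that by (rule run.st_value)
    show "card (out t x a) \<le> s" for t x a using run.outdegree[of t x a] s by simp
    show "card {(y, a). y \<in> nodes \<and> run.st t y = Some a \<and> x \<in> out t y a} \<le> s" for t x
      unfolding rec using run.indegree[of t x] s by simp
    show "card {(x, y). x \<in> nodes \<and> (\<exists>a. run.st t x = Some a \<and> y \<in> out t x a)} \<le> B" for t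
      unfolding msg using run.messages[OF \<Delta>, of t] B(1) by simp
    show "2 * card E \<le> B" by (rule B(2))
    show "M * Suc R \<le> 2 ^ wb" by (rule wb(1))
    show "E \<subseteq> {..<2 ^ wb} \<times> {..<2 ^ wb}" using EN wb(2) by fastforce
    show "1 \<le> s" using b s by simp
    show "2 * length (result x a) \<le> s \<and> set (result x a) \<subseteq> {..<2 ^ wb} \<times> {..<2 ^ wb}"
      if "run.st T x = Some a" for x a
    proof (cases x)
      case (Name v y)
      then have "v < N" "a < K" using run.st_Name_ex[of T v y a] that by auto
      then show ?thesis using Name b s wb(2) by auto
    qed auto
    show "(\<Sum>x\<in>nodes. case run.st T x of None \<Rightarrow> 0 | Some a \<Rightarrow> 2 * length (result x a)) \<le> B"
      using run.result_total B(3) by simp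
  qed simp_all
  show "within_memory A s H" unfolding A_def H_def by (rule pr.within_memory_run)
  show "total_space A H \<le> (2 * T + 2) * B" unfolding A_def H_def by (rule pr.total_space_run)
  let ?S = "\<lambda>v. {j. j < K \<and> \<tau> \<le> real (common F (r j) v)}"
  define L where "L x = (case run.st T x of None \<Rightarrow> [] | Some a \<Rightarrow> result x a)" for x
  have FN: "F \<subseteq> vertex_pairs (k * n)" using FE E Nkn by auto
  have sep': "separates (k * n) k V \<tau> F" using sep unfolding Nkn .
  have r': "r j < k * n" if "j < K" for j using r(2)[OF that] unfolding Nkn .
  have ne: "?S v \<noteq> {}" if "v < k * n" for v
    by (rule least_slot_names(1)[OF part n FN sep' _ _ that]) (use r' hit in \<open>blast+\<close>)
  have names: "Min (?S u) = Min (?S v) \<longleftrightarrow> same_cluster k V u v" if "u < k * n" "v < k * n" for u v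
    by (rule least_slot_names(2)[OF part n FN sep' _ _ that]) (use r' hit in \<open>blast+\<close>)
  have img: "pr.node ` {..<M} = nodes" using pr.bij_node by (simp add: bij_betw_def)
  have "(\<Union>i<M. set (L (pr.node i))) = (\<Union>x\<in>pr.node ` {..<M}. set (L x))"
    unfolding image_image ..
  also have "\<dots> = (\<Union>x\<in>nodes. set (L x))" by (simp only: img)
  also have "\<dots> = {(v, Min (?S v)) | v. v < k * n}"
  proof (intro set_eqI iffI)
    fix e assume "e \<in> (\<Union>x\<in>nodes. set (L x))"
    then obtain x where "e \<in> set (L x)" by blast
    then obtain a where x: "run.st T x = Some a" "e \<in> set (result x a)"
      by (cases "run.st T x") (simp_all only: L_def option.case list.set empty_iff simp_thms)
    then obtain v y where v: "x = Name v y" "e = (v, a)" by (cases x) auto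
    have "v < N" using run.st_Name_ex[of T v y a] x v by blast
    moreover have "a = Min (?S v)"
      using x(1) unfolding v run.st_final_Name by (simp only: option.inject option.distinct split: if_splits)
    ultimately show "e \<in> {(v, Min (?S v)) | v. v < k * n}" using v Nkn by auto
  next
    fix e assume "e \<in> {(v, Min (?S v)) | v. v < k * n}"
    then obtain v where v: "v < k * n" "e = (v, Min (?S v))" by auto
    have "run.st T (Name v 0) = Some (Min (?S v))"
    proof -
      have "\<exists>j<K. \<tau> \<le> real (common F (r j) v)" using ne[OF v(1)] by blast
      then show ?thesis unfolding run.st_final_Name by (simp only: simp_thms if_True)
    qed
    then have "e \<in> set (L (Name v 0))"
      unfolding L_def v(2) by (simp only: option.case result.simps list.set insert_iff simp_thms)
    moreover have "Name v 0 \<in> nodes"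
    proof -
      have "v < N" using v(1) Nkn by simp
      then show ?thesis by (auto simp: node_set_def less_max_iff_disj)
    qed
    ultimately show "e \<in> (\<Union>x\<in>nodes. set (L x))" by blast
  qed
  finally have L: "(\<Union>i<M. set (L (pr.node i))) = {(v, Min (?S v)) | v. v < k * n}" .
  have final: "last H i = pair_words (L (pr.node i))" if "i < M" for i
    unfolding H_def pr.final_configuration[OF that] L_def by (cases "run.st T (pr.node i)") simp_all
  show "outputs_clusters M (last H) (V ` {..<k})"
  proof (rule outputs_clusters_names[OF part])
    show "1 \<le> n" using n by simp
  qed (fact names final L)+
qed

end

section \<open>Clustering on a single machine\<close>

lemma Pi_pmf_reindex:
  assumes fin: "finite I" and g: "inj_on g A" "g ` A \<subseteq> I"
  shows "map_pmf (\<lambda>\<omega> a. if a \<in> A then \<phi> (\<omega> (g a)) else d) (Pi_pmf I d0 p)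
    = Pi_pmf A d (\<lambda>a. map_pmf \<phi> (p (g a)))"
proof (rule pmf_eqI)
  fix x
  have finA: "finite A" using g fin finite_imageD finite_subset by blast
  let ?h = "\<lambda>\<omega> a. if a \<in> A then \<phi> (\<omega> (g a)) else d"
  have "pmf (map_pmf ?h (Pi_pmf I d0 p)) x = measure_pmf.prob (Pi_pmf I d0 p) (?h -` {x})"
    by (simp add: pmf_map)
  also have "\<dots> = pmf (Pi_pmf A d (\<lambda>a. map_pmf \<phi> (p (g a)))) x"
  proof (cases "\<forall>a. a \<notin> A \<longrightarrow> x a = d")
    case True
    define S where "S i = (if i \<in> g ` A then \<phi> -` {x (inv_into A g i)} else UNIV)" for i
    have "?h -` {x} = Pi I S"
    proof (intro set_eqI iffI)
      fix \<omega> assume "\<omega> \<in> ?h -` {x}"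
      then have h: "?h \<omega> a = x a" for a by (auto simp: fun_eq_iff)
      have "\<phi> (\<omega> (g a)) = x a" if "a \<in> A" for a using h[of a] that by simp
      then show "\<omega> \<in> Pi I S" using g(1) by (auto simp: S_def Pi_def)
    next
      fix \<omega> assume *: "\<omega> \<in> Pi I S"
      have "\<phi> (\<omega> (g a)) = x a" if "a \<in> A" for a
      proof -
        have "\<omega> (g a) \<in> S (g a)" using * g(2) that by (auto simp: Pi_def)
        then show ?thesis using that g(1) by (simp add: S_def)
      qed
      then have "?h \<omega> = x" using True by (auto simp: fun_eq_iff)
      then show "\<omega> \<in> ?h -` {x}" by simp
    qed
    then have "measure_pmf.prob (Pi_pmf I d0 p) (?h -` {x}) = (\<Prod>i\<in>I. measure_pmf.prob (p i) (S i))"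
      using measure_Pi_pmf_Pi[OF fin] by simp
    also have "\<dots> = (\<Prod>i\<in>g ` A. measure_pmf.prob (p i) (S i))"
      using fin g(2) by (intro prod.mono_neutral_right) (auto simp: S_def)
    also have "\<dots> = (\<Prod>a\<in>A. measure_pmf.prob (p (g a)) (S (g a)))"
      using g(1) by (simp add: prod.reindex)
    also have "\<dots> = (\<Prod>a\<in>A. pmf (map_pmf \<phi> (p (g a))) (x a))"
      using g(1) by (intro prod.cong) (auto simp: S_def pmf_map)
    finally show ?thesis using True by (simp add: pmf_Pi finA)
  next
    case False
    then have "?h -` {x} = {}" by (auto simp: fun_eq_iff)
    moreover have "pmf (Pi_pmf A d (\<lambda>a. map_pmf \<phi> (p (g a)))) x = 0"
      using False finA by (intro pmf_Pi_outside) auto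
    ultimately show ?thesis by simp
  qed
  finally show "pmf (map_pmf ?h (Pi_pmf I d0 p)) x = pmf (Pi_pmf A d (\<lambda>a. map_pmf \<phi> (p (g a)))) x" .
qed

lemma prob_ge_1_minus:
  assumes "\<And>x. x \<in> set_pmf P \<Longrightarrow> x \<notin> S \<Longrightarrow> x \<in> B1 \<union> B2 \<union> B3 \<union> B4"
    and "measure_pmf.prob P B1 \<le> c" "measure_pmf.prob P B2 \<le> c" "measure_pmf.prob P B3 \<le> c" "measure_pmf.prob P B4 \<le> c"
  shows "1 - 4 * c \<le> measure_pmf.prob P S"
proof -
  have "measure_pmf.prob P (- S) = measure_pmf.prob P ((- S) \<inter> set_pmf P)"
    by (simp add: measure_Int_set_pmf)
  also have "\<dots> \<le> measure_pmf.prob P (B1 \<union> B2 \<union> B3 \<union> B4)"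
    using assms(1) by (intro measure_pmf.finite_measure_mono) auto
  also have "\<dots> \<le> measure_pmf.prob P B1 + measure_pmf.prob P B2 + measure_pmf.prob P B3 + measure_pmf.prob P B4"
  proof -
    have "measure_pmf.prob P (B1 \<union> B2 \<union> B3 \<union> B4) \<le> measure_pmf.prob P (B1 \<union> B2 \<union> B3) + measure_pmf.prob P B4"
      by (intro measure_Un_le) auto
    also have "measure_pmf.prob P (B1 \<union> B2 \<union> B3) \<le> measure_pmf.prob P (B1 \<union> B2) + measure_pmf.prob P B3"
      by (intro measure_Un_le) auto
    also have "measure_pmf.prob P (B1 \<union> B2) \<le> measure_pmf.prob P B1 + measure_pmf.prob P B2"
      by (intro measure_Un_le) auto
    finally show ?thesis by simp
  qed
  also have "\<dots> \<le> 4 * c" using assms(2-5) by simp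
  finally show ?thesis using measure_pmf.prob_compl[of S P] by (simp add: Compl_eq_Diff_UNIV)
qed

lemma sum_vertex_degree:
  assumes E: "E \<subseteq> vertex_pairs N"
  shows "(\<Sum>u<N. vertex_degree E u) = 2 * card E"
proof -
  have fin: "finite E" using E finite_subset finite_vertex_pairs by blast
  have "(\<Sum>u<N. vertex_degree E u) = card (SIGMA u:{..<N}. {v. adj E u v})"
    using finite_adj[OF E] by (simp add: vertex_degree_def)
  also have "(SIGMA u:{..<N}. {v. adj E u v}) = E \<union> E\<inverse>"
    using adj_less[OF E] by (auto simp: adj_def)
  also have "card (E \<union> E\<inverse>) = card E + card (E\<inverse>)"
  proof (rule card_Un_disjoint[OF fin])
    have "(v, u) \<notin> E" if "(u, v) \<in> E" for u v
    proof
      assume "(v, u) \<in> E"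
      then show False using subsetD[OF E that] subsetD[OF E, of "(v, u)"] by (simp add: vertex_pairs_def)
    qed
    then show "E \<inter> E\<inverse> = {}" by auto
  qed (use fin in simp)
  finally show ?thesis by (simp add: card_inverse)
qed

lemma sqrt_div_power4: "0 < p \<Longrightarrow> (x / sqrt p) ^ 4 = x ^ 4 / p\<^sup>2"
  by (simp add: power_divide power4_eq_xxxx power2_eq_square mult.assoc[symmetric] real_sqrt_mult_self)

lemma gap_consequences:
  fixes n k :: nat and p q :: real
  assumes n: "3 \<le> n" and k: "1 \<le> k" and pq: "0 < q" "q < p" "p < 1"
    and gap: "(p - q) / sqrt p \<ge> 5 * real k powr (3/4) * real n powr (- (1/4)) * ln (real n) powr (1/4)"
  shows "625 * real k ^ 3 * ln n * p\<^sup>2 \<le> real n * (p - q) ^ 4"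
    and "625 * real k ^ 3 * ln n \<le> real n" and "625 * real k ^ 3 * ln n \<le> real n * p" and "1 \<le> ln n"
proof -
  have L: "1 \<le> ln n"
  proof -
    have "exp 1 \<le> real n" using exp_le n by (metis le_trans numeral_le_real_of_nat_iff order_trans)
    then show ?thesis using n by (simp add: ln_ge_iff)
  qed
  show "1 \<le> ln n" by (rule L)
  have n0: "0 < real n" and k0: "0 < real k" and L0: "0 < ln n" using n k L by auto
  let ?g = "5 * real k powr (3/4) * real n powr (- (1/4)) * ln n powr (1/4)"
  have p4: "(x powr a) ^ 4 = x powr (4 * a)" if "0 < x" for x a :: real
    using powr_powr[of x a 4] that by (simp add: mult.commute)
  have "?g ^ 4 = 625 * real k ^ 3 * ln n / real n"
    using n0 k0 L0 by (simp add: power_mult_distrib p4 powr_minus field_simps powr_numeral)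
  moreover have "?g ^ 4 \<le> ((p - q) / sqrt p) ^ 4"
    using gap n0 k0 L by (intro power_mono) auto
  ultimately have 1: "625 * real k ^ 3 * ln n / real n \<le> (p - q) ^ 4 / p\<^sup>2"
    using pq by (simp add: sqrt_div_power4)
  then show g: "625 * real k ^ 3 * ln n * p\<^sup>2 \<le> real n * (p - q) ^ 4"
    using n0 pq by (simp add: field_simps)
  have "(p - q) ^ 4 \<le> p ^ 4" using pq by (intro power_mono) auto
  then have "real n * (p - q) ^ 4 \<le> real n * p ^ 4" using n0 by simp
  with g have "625 * real k ^ 3 * ln n * p\<^sup>2 \<le> (real n * p\<^sup>2) * p\<^sup>2"
    by (simp add: power4_eq_xxxx power2_eq_square mult.assoc)
  then have g2: "625 * real k ^ 3 * ln n \<le> real n * p\<^sup>2" using pq by simp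
  have "p\<^sup>2 \<le> p" "p \<le> 1" using pq by (auto simp: power2_eq_square mult_left_le)
  then have "real n * p\<^sup>2 \<le> real n * p" "real n * p \<le> real n" using n0 by (auto simp: mult_left_le)
  then show "625 * real k ^ 3 * ln n \<le> real n" "625 * real k ^ 3 * ln n \<le> real n * p"
    using g2 by linarith+
qed

definition central_algorithm :: "nat \<Rightarrow> real \<Rightarrow> nat \<Rightarrow> mpc_algorithm" where
  "central_algorithm N \<tau> wb = \<lparr> num_machines = 1, word_bits = wb, num_rounds = 0,
     local_step = (\<lambda>_ _ _. return_pmf ([], [])),
     local_output = (\<lambda>_ x. return_pmf (pair_words (map (\<lambda>v.
       (v, Min {j. j < N \<and> \<tau> \<le> real (common (set (unpair_words x)) j v)})) [0..<N]))) \<rparr>"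

lemma central_succeeds:
  fixes V :: "nat \<Rightarrow> nat set"
  assumes part: "hidden_partition n k V" and N: "N = k * n" and n: "2 \<le> n" "1 \<le> k"
    and E: "E \<subseteq> vertex_pairs N" and sep: "separates N k V \<tau> E"
    and D: "input_distribution 1 s D" and s: "4 * N\<^sup>2 \<le> s" and wb: "N \<le> 2 ^ wb"
    and B: "real (2 * (2 * card E + 2 * N)) \<le> B (card E)"
    and h: "h \<in> set_pmf (mpc_execution (central_algorithm N \<tau> wb) (\<lambda>i. pair_words (D E i)))"
  shows "succeeds (central_algorithm N \<tau> wb) s D (V ` {..<k}) B E h"
proof -
  let ?A = "central_algorithm N \<tau> wb"
  let ?S = "\<lambda>v. {j. j < N \<and> \<tau> \<le> real (common E j v)}"
  have fin: "finite E" using E finite_subset finite_vertex_pairs by blast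
  have N1: "1 \<le> N" using n N by simp
  have "E \<subseteq> {..<N} \<times> {..<N}" using E by (auto simp: vertex_pairs_def)
  then have "card E \<le> card ({..<N} \<times> {..<N})" by (intro card_mono) auto
  then have cE: "card E \<le> N\<^sup>2" by (simp add: card_cartesian_product power2_eq_square)
  obtain xs where xs: "set xs = E" "distinct xs" using finite_distinct_list[OF fin] by blast
  have "length xs = card E" using distinct_card[OF xs(2)] xs(1) by simp
  then have "distributes 1 s E (\<lambda>_. xs)" using xs cE s by (simp add: distributes_def)
  then have "\<exists>D'. distributes 1 s E D'" by (intro exI[of _ "\<lambda>_. xs"])
  then have dist: "distributes 1 s E (D E)" using D unfolding input_distribution_def by simp
  then have DE: "set (D E 0) = E" "distinct (D E 0)" "length (pair_words (D E 0)) \<le> s" by (auto simp: distributes_def)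
  have lD: "length (D E 0) = card E" using distinct_card[OF DE(2)] DE(1) by simp
  define c where "c = (\<lambda>i. pair_words (D E i))"
  define m where "m v = Min (?S v)" for v
  define out where "out = (\<lambda>i. if i < (1::nat) then pair_words (map (\<lambda>v. (v, m v)) [0..<N]) else [])"
  have h: "h = [c, out]"
  proof -
    have "local_output ?A 0 (c 0) = return_pmf (out 0)"
      by (simp add: central_algorithm_def out_def c_def DE(1) m_def)
    then have "Pi_pmf {..<1} [] (\<lambda>i. local_output ?A i (c i)) = Pi_pmf {..<1} [] (\<lambda>i. return_pmf (out i))"
      by (intro Pi_pmf_cong refl) simp
    also have "\<dots> = return_pmf out" by (simp add: out_def fun_eq_iff)
    finally have P: "Pi_pmf {..<1} [] (\<lambda>i. local_output ?A i (c i)) = return_pmf out" .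
    have m: "mpc_rounds ?A c (num_rounds ?A) = return_pmf [c]" "num_machines ?A = 1"
      by (simp_all add: central_algorithm_def)
    have "mpc_execution ?A c = return_pmf [c, out]"
      unfolding mpc_execution_def m bind_return_pmf by (simp add: P del: One_nat_def)
    then show ?thesis using h by (simp add: c_def[symmetric])
  qed
  have sep': "separates (k * n) k V \<tau> E" and E': "E \<subseteq> vertex_pairs (k * n)" using sep E N by simp_all
  have hit: "\<exists>j<N. j \<in> V i" if "i < k" for i
  proof -
    have "V i \<noteq> {}" using part that n unfolding hidden_partition_def by (metis card.empty not_numeral_le_zero)
    moreover have "V i \<subseteq> {..<N}" using part that N unfolding hidden_partition_def by blast
    ultimately show ?thesis by blast
  qed
  have ne: "?S v \<noteq> {}" if "v < k * n" for v
    by (rule least_slot_names(1)[where r="\<lambda>j. j" and K=N, OF part n(1) E' sep' _ hit that]) (simp add: N)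
  have names: "m u = m v \<longleftrightarrow> same_cluster k V u v" if "u < k * n" "v < k * n" for u v
    unfolding m_def by (rule least_slot_names(2)[where r="\<lambda>j. j" and K=N, OF part n(1) E' sep' _ hit that]) (simp add: N)
  have Mn: "m v < N" if "v < N" for v
  proof -
    have "m v \<in> ?S v" unfolding m_def
      by (rule Min_in) (use ne[of v] that N in \<open>simp_all only: finite_Collect_conjI finite_Collect_less_nat simp_thms\<close>)
    then show ?thesis by simp
  qed
  have clusters: "outputs_clusters 1 out (V ` {..<k})"
  proof (rule outputs_clusters_names[OF part])
    show "1 \<le> n" using n by simp
    show "m u = m v \<longleftrightarrow> same_cluster k V u v" if "u < k * n" "v < k * n" for u v
      using that by (rule names)
    show "out i = pair_words (map (\<lambda>v. (v, m v)) [0..<N])" if "i < 1" for i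
      using that by (simp add: out_def)
    show "(\<Union>i<(1::nat). set (map (\<lambda>v. (v, m v)) [0..<N])) = {(v, m v) |v. v < k * n}"
      by (auto simp: N)
  qed
  have N2: "2 * N \<le> 4 * N\<^sup>2"
  proof -
    have "N * 1 \<le> N * N" using N1 by (intro mult_left_mono) auto
    then show ?thesis by (simp add: power2_eq_square)
  qed
  have wm: "within_memory ?A s h"
  proof -
    have "length (c 0) \<le> s" using DE(3) by (simp add: c_def)
    moreover have "x < 2 ^ wb" if "x \<in> set (c 0)" for x
      using that E wb unfolding c_def set_pair_words DE(1) by (fastforce simp: vertex_pairs_def)
    moreover have "length (out 0) \<le> s" using N2 s by (simp add: out_def)
    moreover have "x < 2 ^ wb" if "x \<in> set (out 0)" for x
      using that Mn wb by (fastforce simp: out_def set_pair_words image_image)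
    ultimately show ?thesis by (simp add: within_memory_def h central_algorithm_def)
  qed
  have "total_space ?A h \<le> length h * (2 * card E + 2 * N)"
    by (rule total_space_le) (auto simp: h central_algorithm_def c_def out_def lD)
  then have "real (total_space ?A h) \<le> B (card E)"
  proof -
    assume "total_space ?A h \<le> length h * (2 * card E + 2 * N)"
    then have "total_space ?A h \<le> 2 * (2 * card E + 2 * N)" by (simp add: h)
    then have "real (total_space ?A h) \<le> real (2 * (2 * card E + 2 * N))" by (rule of_nat_mono)
    then show ?thesis using B by (rule order_trans)
  qed
  moreover have "last h = out" by (simp add: h)
  moreover have "num_machines ?A = 1" by (simp add: central_algorithm_def)
  ultimately show ?thesis using wm dist clusters unfolding succeeds_def by simp
qed

section \<open>Success probabilities\<close>

lemma prob_pair_pmf_fst: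
  "measure_pmf.prob (pair_pmf P Q) {(x, y). A x} = measure_pmf.prob P {x. A x}"
proof -
  have "measure_pmf.prob P {x. A x} = measure_pmf.prob (map_pmf fst (pair_pmf P Q)) {x. A x}"
    by (simp add: map_fst_pair_pmf)
  then show ?thesis by (simp add: vimage_def case_prod_unfold)
qed

lemma prob_pair_pmf_snd:
  "measure_pmf.prob (pair_pmf P Q) {(x, y). A y} = measure_pmf.prob Q {y. A y}"
proof -
  have "measure_pmf.prob Q {y. A y} = measure_pmf.prob (map_pmf snd (pair_pmf P Q)) {y. A y}"
    by (simp add: map_snd_pair_pmf)
  then show ?thesis by (simp add: vimage_def case_prod_unfold)
qed

locale sbm_gap = sbm +
  assumes n3: "3 \<le> n"
    and gap4: "625 * real k ^ 3 * ln n * p\<^sup>2 \<le> real n * (p - q) ^ 4"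
    and gap_n: "625 * real k ^ 3 * ln n \<le> real n"
    and gap_np: "625 * real k ^ 3 * ln n \<le> real n * p"
    and ln1: "1 \<le> ln n"
begin

lemma k3: "real k \<le> real k ^ 3" "1 \<le> real k ^ 3"
  using k1 by (auto simp: self_le_power)

lemma k_le_n: "k \<le> n"
proof -
  have "real k * 1 \<le> real k ^ 3 * ln n" using k3 ln1 by (intro mult_mono) auto
  then have "real k \<le> real n" using gap_n k3 ln1 by simp
  then show ?thesis by simp
qed

lemma N_le: "real N \<le> real n ^ 2"
  using k_le_n by (simp add: power2_eq_square mult_right_mono)

lemma exp_9_ln: "exp (- 9 * ln n) = 1 / real n ^ 9"
proof -
  have "exp (- 9 * ln n) = inverse (exp (real 9 * ln n))" by (simp add: exp_minus[symmetric])
  also have "exp (real 9 * ln n) = real n ^ 9" using n3 by (subst exp_of_nat_mult) simp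
  finally show ?thesis by (simp add: divide_inverse)
qed

lemma N_exp_le: "(real N)\<^sup>2 * exp (- 9 * ln n) \<le> 1 / real n"
proof -
  have n0: "1 \<le> real n" using n3 by simp
  have "(real N)\<^sup>2 \<le> (real n ^ 2)\<^sup>2" using N_le by (intro power_mono) auto
  then have "(real N)\<^sup>2 * exp (- 9 * ln n) \<le> real n ^ 4 * (1 / real n ^ 9)"
    unfolding exp_9_ln by (intro mult_mono) (auto simp: power_mult[symmetric])
  also have "\<dots> = 1 / real n ^ 5" using n0 by (simp add: field_simps power_add[symmetric])
  also have "\<dots> \<le> 1 / real n" using n0 self_le_power[OF n0, of 5] by (intro divide_left_mono) auto
  finally show ?thesis .
qed

lemma N_exp_le': "real N * exp (- 9 * ln n) \<le> 1 / real n"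
proof -
  have "1 \<le> real N" using n2 k1 by (metis N_ge_n le_trans of_nat_1 of_nat_mono one_le_numeral)
  then have "real N \<le> (real N)\<^sup>2" by (simp add: self_le_power)
  then have "real N * exp (- 9 * ln n) \<le> (real N)\<^sup>2 * exp (- 9 * ln n)" by (intro mult_right_mono) auto
  then show ?thesis using N_exp_le by linarith
qed

lemma mean_degree_large: "625 * real k ^ 3 * ln n \<le> mean_degree"
proof -
  have "0 \<le> (real N - real n) * q"
    using of_nat_mono[OF N_ge_n, where 'a=real] q by (intro mult_nonneg_nonneg) auto
  then show ?thesis using gap_np unfolding mean_degree_def by linarith
qed

lemma degrees_not_small:
  "measure_pmf.prob G {E. \<exists>u\<in>{..<N}. real (vertex_degree E u) \<le> mean_degree / 4} \<le> 1 / real n"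
proof -
  have "9 * ln n \<le> mean_degree / 64"
  proof -
    have "1 * ln n \<le> real k ^ 3 * ln n" using k3(2) ln1 by (intro mult_right_mono) auto
    then show ?thesis using mean_degree_large ln1 by linarith
  qed
  then have "real N * exp (- mean_degree / 64) \<le> real N * exp (- 9 * ln n)"
    by (intro mult_left_mono) auto
  then show ?thesis using prob_degree_small N_exp_le' by linarith
qed

lemma sparsified_sbm: "0 < f \<Longrightarrow> f \<le> 1 \<Longrightarrow> sbm n k (f * p) (f * q) V"
  using part q qp p1 n2 k1 mult_le_one[of f p]
  by unfold_locales (auto intro: mult_less_cancel_left1 le_less_trans[OF mult_right_mono[of f 1 p]])

lemma sparsified_separates:
  assumes f: "1 / real k \<le> f" "f \<le> 1"
  defines "\<tau> \<equiv> sbm.threshold n k (f * p) (f * q)"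
  shows "measure_pmf.prob (SBM n (f * p) (f * q) k V) {E. \<not> separates N k V \<tau> E} \<le> 1 / real n"
proof -
  have "0 < 1 / real k" using k1 by simp
  then have f0: "0 < f" using f(1) by linarith
  interpret f: sbm n k "f * p" "f * q" V by (rule sparsified_sbm[OF f0 f(2)])
  have n0: "0 < real n" and k0: "0 < real k" and p0: "0 < p" using n2 k1 q qp by auto
  have fk: "1 \<le> f\<^sup>2 * (real k)\<^sup>2"
  proof -
    have "1 \<le> f * real k" using f(1) k0 by (simp add: field_simps)
    then have "1\<^sup>2 \<le> (f * real k)\<^sup>2" by (intro power_mono) auto
    then show ?thesis by (simp add: power_mult_distrib)
  qed
  have gap: "8 * p\<^sup>2 \<le> real n * (p - q)\<^sup>2"
  proof -
    have "(8 * p\<^sup>2)\<^sup>2 \<le> 625 * p\<^sup>2 * p\<^sup>2" using p0 by (simp add: power2_eq_square)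
    also have "\<dots> \<le> 625 * p\<^sup>2 * 1" using p1 p0 by (intro mult_left_mono) (auto simp: power_le_one)
    also have "\<dots> \<le> real n * (625 * p\<^sup>2 * 1)" using n3 by (simp add: mult_le_cancel_right1)
    also have "\<dots> \<le> real n * (625 * p\<^sup>2 * (real k ^ 3 * ln n))"
      using k3(2) ln1 by (intro mult_left_mono) (auto intro: order_trans[OF _ mult_mono[of 1 _ 1]])
    also have "\<dots> = real n * (625 * real k ^ 3 * ln n * p\<^sup>2)" by simp
    also have "\<dots> \<le> real n * (real n * (p - q) ^ 4)" using gap4 by (intro mult_left_mono) auto
    also have "\<dots> = (real n * (p - q)\<^sup>2)\<^sup>2" by (simp add: power2_eq_square power4_eq_xxxx)
    finally show ?thesis by (rule power2_le_imp_le) simp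
  qed
  have fpq: "f * p - f * q = f * (p - q)" by (simp add: right_diff_distrib)
  have gap_f: "8 * (f * p)\<^sup>2 \<le> real n * (f * p - f * q)\<^sup>2"
  proof -
    have "8 * (f * p)\<^sup>2 = f\<^sup>2 * (8 * p\<^sup>2)" by (simp add: power_mult_distrib)
    moreover have "real n * (f * p - f * q)\<^sup>2 = f\<^sup>2 * (real n * (p - q)\<^sup>2)"
      unfolding fpq by (simp add: power_mult_distrib)
    ultimately show ?thesis using mult_left_mono[OF gap, of "f\<^sup>2"] by (simp only: zero_le_power2)
  qed
  have ex: "9 * ln n \<le> (real n * (f * p - f * q)\<^sup>2)\<^sup>2 / (64 * (real N * (f * p)\<^sup>2))"
  proof -
    have "9 * ln n \<le> 625 / 64 * ln n" using ln1 by simp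
    also have "\<dots> \<le> f\<^sup>2 * (real k)\<^sup>2 * (625 / 64 * ln n)" using fk ln1 by (simp add: mult_le_cancel_right1)
    also have "\<dots> = f\<^sup>2 * (625 * real k ^ 3 * ln n * p\<^sup>2) / (64 * real k * p\<^sup>2)"
      using k0 p0 by (simp add: field_simps power2_eq_square power3_eq_cube)
    also have "\<dots> \<le> f\<^sup>2 * (real n * (p - q) ^ 4) / (64 * real k * p\<^sup>2)"
      using gap4 k0 p0 by (intro divide_right_mono mult_left_mono) auto
    also have "\<dots> = (real n * (f * p - f * q)\<^sup>2)\<^sup>2 / (64 * (real N * (f * p)\<^sup>2))"
    proof -
      have "(real n * (f * p - f * q)\<^sup>2)\<^sup>2 = real n * real n * (f\<^sup>2 * f\<^sup>2) * (p - q) ^ 4"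
        unfolding fpq by (simp add: power_mult_distrib power2_eq_square power4_eq_xxxx)
      then show ?thesis using n0 k0 p0 f0 by (simp add: power_mult_distrib field_simps power2_eq_square)
    qed
    finally show ?thesis .
  qed
  have "measure_pmf.prob f.G {E. \<not> separates N k V f.threshold E}
      \<le> (real N)\<^sup>2 * exp (- (real n * (f * p - f * q)\<^sup>2)\<^sup>2 / (64 * (real N * (f * p)\<^sup>2)))"
    by (rule f.prob_not_separates[OF gap_f])
  also have "\<dots> \<le> (real N)\<^sup>2 * exp (- 9 * ln n)"
    using ex by (intro mult_left_mono) auto
  also have "\<dots> \<le> 1 / real n" by (rule N_exp_le)
  finally show ?thesis unfolding \<tau>_def .
qed

lemma sparsified_degrees_not_large:
  defines "f \<equiv> 1 / real k"
  shows "measure_pmf.prob (SBM n (f * p) (f * q) k V)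
    {E. \<exists>u\<in>{..<N}. real (vertex_degree E u) \<ge> 2 * (mean_degree / real k)} \<le> 1 / real n"
proof -
  have f: "0 < f" "f \<le> 1" using k1 by (auto simp: f_def)
  interpret f: sbm n k "f * p" "f * q" V by (rule sparsified_sbm[OF f])
  have md: "f.mean_degree = mean_degree / real k"
    unfolding f.mean_degree_def unfolding mean_degree_def f_def by (simp add: add_divide_distrib)
  define x where "x = mean_degree / real k"
  have "625 * ((real k)\<^sup>2 * ln n) \<le> x"
    using mean_degree_large k1 by (simp add: x_def field_simps power2_eq_square power3_eq_cube)
  moreover have "1 * ln n \<le> (real k)\<^sup>2 * ln n" using k1 ln1 by (intro mult_right_mono) auto
  ultimately have "9 * ln n \<le> x / 4" using ln1 by linarith
  then have "9 * ln n \<le> f.mean_degree / 4" unfolding md x_def .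
  then have "real N * exp (- f.mean_degree / 4) \<le> real N * exp (- 9 * ln n)"
    by (intro mult_left_mono) auto
  then show ?thesis using f.prob_degree_large N_exp_le' unfolding md by linarith
qed

lemma edges_ge:
  assumes E: "E \<subseteq> vertex_pairs N" and deg: "\<And>u. u < N \<Longrightarrow> mean_degree / 4 \<le> real (vertex_degree E u)"
  shows "real N * mean_degree \<le> 8 * real (card E)"
proof -
  have "real N * (mean_degree / 4) = (\<Sum>u<N. mean_degree / 4)" by simp
  also have "\<dots> \<le> (\<Sum>u<N. real (vertex_degree E u))" using deg by (intro sum_mono) auto
  also have "\<dots> = real (2 * card E)" unfolding sum_vertex_degree[OF E, symmetric] by simp
  finally show ?thesis by simp
qed

lemma uniform_slots_hit:
  assumes K: "2 * real k * ln n \<le> real K"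
  shows "measure_pmf.prob (Pi_pmf {..<K} 0 (\<lambda>_. pmf_of_set {..<N})) {r. \<exists>i\<in>{..<k}. \<forall>j<K. r j \<notin> V i} \<le> 1 / real n"
proof -
  have N0: "0 < N" using n2 k1 by auto
  have n0: "0 < real n" and k0: "0 < real k" using n2 k1 by auto
  have one: "measure_pmf.prob (Pi_pmf {..<K} 0 (\<lambda>_. pmf_of_set {..<N})) {r. \<forall>j<K. r j \<notin> V i} \<le> 1 / real n ^ 2"
    if i: "i \<in> {..<k}" for i
  proof -
    have "{r. \<forall>j<K. r j \<notin> V i} = Pi {..<K} (\<lambda>_. - V i)" by auto
    then have "measure_pmf.prob (Pi_pmf {..<K} 0 (\<lambda>_. pmf_of_set {..<N})) {r. \<forall>j<K. r j \<notin> V i}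
        = measure_pmf.prob (pmf_of_set {..<N}) (- V i) ^ K"
      by (simp add: measure_Pi_pmf_Pi)
    also have "measure_pmf.prob (pmf_of_set {..<N}) (- V i) = real (card ({..<N} - V i)) / real N"
    proof -
      have "{..<N} \<noteq> {}" using N0 by (simp only: lessThan_empty_iff)
      from measure_pmf_of_set[OF this] show ?thesis by (simp add: Diff_eq)
    qed
    also have "card ({..<N} - V i) = N - n"
      using i card_cluster cluster_subset finite_cluster by (simp add: card_Diff_subset)
    also have "real (N - n) / real N = 1 - 1 / real k"
      using N_ge_n n0 k0 by (simp add: of_nat_diff field_simps)
    also have "(1 - 1 / real k) ^ K \<le> exp (- 1 / real k) ^ K"
      using k1 exp_ge_add_one_self[of "- 1 / real k"] by (intro power_mono) (auto simp: field_simps)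
    also have "\<dots> = exp (- real K / real k)" by (simp add: exp_of_nat_mult[symmetric])
    also have "\<dots> \<le> exp (- (2 * ln n))" using K k0 by (simp add: field_simps)
    also have "\<dots> = 1 / real n ^ 2" using n0 exp_of_nat_mult[of 2 "ln n"] by (simp add: exp_minus field_simps)
    finally show ?thesis .
  qed
  have "measure_pmf.prob (Pi_pmf {..<K} 0 (\<lambda>_. pmf_of_set {..<N})) {r. \<exists>i\<in>{..<k}. \<forall>j<K. r j \<notin> V i}
      \<le> real (card {..<k}) * (1 / real n ^ 2)"
    by (rule prob_union_bound[OF _ one]) auto
  also have "\<dots> \<le> real n * (1 / real n ^ 2)" using k_le_n by (intro mult_right_mono) auto
  also have "\<dots> = 1 / real n" using n0 by (simp add: power2_eq_square)
  finally show ?thesis .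
qed

end

lemma hidden_partition_blocks:
  assumes "0 < n"
  shows "hidden_partition n k (\<lambda>i. {z. z div n = i})"
proof -
  have "card {z. z div n = i} = n" for i by (simp add: div_eq_interval[OF assms])
  moreover have "z \<in> (\<Union>i<k. {z. z div n = i}) \<longleftrightarrow> z \<in> {..<k * n}" for z
    using div_less_iff_less_mult[OF assms, of z k] by auto
  ultimately show ?thesis by (auto simp: hidden_partition_def disjoint_family_on_def)
qed

lemma threshold_pos:
  assumes "0 < q" "q < p" "p < 1" "2 \<le> n" "1 \<le> k"
  shows "0 < sbm.threshold n k p q"
proof -
  interpret sbm n k p q "\<lambda>i. {z. z div n = i}"
    using assms by unfold_locales (auto intro: hidden_partition_blocks)
  show ?thesis by (rule threshold_pos)
qed

lemma distributes_singletons: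
  assumes "finite E" "card E \<le> M" "2 \<le> s"
  shows "\<exists>D. distributes M s E D"
proof -
  obtain xs where xs: "set xs = E" "distinct xs" using finite_distinct_list[OF assms(1)] by blast
  have len: "length xs \<le> M" using distinct_card[OF xs(2)] xs(1) assms(2) by simp
  define D where "D i = (if i < length xs then [xs ! i] else [])" for i
  have "[0..<M] = [0..<length xs] @ [length xs..<M]" using len by (metis le0 upt_add_eq_append le_add_diff_inverse)
  moreover have "concat (map D [0..<length xs]) = xs"
  proof -
    have "concat (map D [0..<length xs]) = concat (map (\<lambda>i. [xs ! i]) [0..<length xs])"
      by (intro arg_cong[where f=concat] map_cong) (auto simp: D_def)
    also have "\<dots> = map (\<lambda>i. xs ! i) [0..<length xs]" by (simp add: concat_map_singleton)
    finally show ?thesis by (simp add: map_nth)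
  qed
  moreover have "concat (map D [length xs..<M]) = []" by (simp add: D_def)
  ultimately have "concat (map D [0..<M]) = xs" by (simp only: map_append concat_append append_Nil2)
  then have "distributes M s E D" using xs assms(3) unfolding distributes_def by (simp add: D_def)
  then show ?thesis by blast
qed

lemma node_coin_Input: "map_pmf (\<lambda>c. c = 1) (node_coin N f (Input u v)) = bernoulli_pmf f"
proof -
  have "(\<lambda>c::bool. (if c then 1 else 0) = (1::nat)) = (\<lambda>c. c)" by auto
  then show ?thesis by (simp add: node_coin_def pmf.map_comp o_def)
qed

lemma tree_height:
  assumes "2 \<le> s" "1 \<le> N"
  shows "N \<le> s ^ nat \<lceil>log (real s) (real N)\<rceil>" and "real (nat \<lceil>log (real s) (real N)\<rceil>) \<le> log (real s) (real N) + 1"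
proof -
  define h where "h = nat \<lceil>log (real s) (real N)\<rceil>"
  have l0: "0 \<le> log (real s) (real N)" using assms by (simp add: zero_le_log_cancel_iff)
  have "real N = real s powr log (real s) (real N)" using assms by (simp add: powr_log_cancel)
  also have "\<dots> \<le> real s powr real h" using assms unfolding h_def by (intro powr_mono) linarith+
  also have "\<dots> = real (s ^ h)" using assms by (simp add: powr_realpow)
  finally show "N \<le> s ^ nat \<lceil>log (real s) (real N)\<rceil>" unfolding h_def by (simp only: of_nat_le_iff)
  show "real (nat \<lceil>log (real s) (real N)\<rceil>) \<le> log (real s) (real N) + 1" using l0 by linarith
qed

lemma word_size:
  assumes n: "3 \<le> n" "1 \<le> ln (real n)"
  shows "n ^ 12 \<le> 2 ^ nat \<lceil>12 * log 2 (real n)\<rceil>" and "real (nat \<lceil>12 * log 2 (real n)\<rceil>) \<le> 30 * ln (real n)"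
proof -
  define w where "w = nat \<lceil>12 * log 2 (real n)\<rceil>"
  have l: "log 2 (real n) \<le> 2 * ln (real n)"
  proof -
    have "ln (real n) * 1 \<le> ln (real n) * (2 * ln 2)"
      using ln2_ge_two_thirds n(2) by (intro mult_left_mono) auto
    then show ?thesis by (simp add: log_def field_simps)
  qed
  have l0: "0 \<le> log 2 (real n)" using n by simp
  have "real (n ^ 12) = real n powr 12" using n by simp
  also have "\<dots> = (2 powr log 2 (real n)) powr 12" using n by simp
  also have "\<dots> = 2 powr (12 * log 2 (real n))" unfolding powr_powr by (simp add: mult.commute)
  also have "\<dots> \<le> 2 powr real w" unfolding w_def by (intro powr_mono) linarith+
  also have "\<dots> = real (2 ^ w)" by (simp add: powr_realpow)
  finally show "n ^ 12 \<le> 2 ^ nat \<lceil>12 * log 2 (real n)\<rceil>" unfolding w_def by (simp only: of_nat_le_iff)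
  show "real (nat \<lceil>12 * log 2 (real n)\<rceil>) \<le> 30 * ln (real n)" using l l0 n by linarith
qed

context sbm_gap begin

definition slots :: nat where
  "slots = nat \<lceil>2 * real k * ln n\<rceil>"

lemma slots_bounds: "2 * real k * ln n \<le> real slots" "real slots \<le> 3 * real k * ln n" "1 \<le> slots" "slots \<le> n"
proof -
  have kL: "1 * 1 \<le> real k * ln n" using k1 ln1 by (intro mult_mono) auto
  show a: "2 * real k * ln n \<le> real slots" unfolding slots_def by linarith
  show b: "real slots \<le> 3 * real k * ln n" unfolding slots_def using kL by linarith
  show "1 \<le> slots" using a kL by (cases slots) auto
  have "real k * ln n \<le> real k ^ 3 * ln n" using k3 ln1 by (intro mult_right_mono) auto
  then have "3 * real k * ln n \<le> real n" using gap_n kL by linarith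
  then show "slots \<le> n" using b by linarith
qed

definition max_degree :: nat where
  "max_degree = nat \<lfloor>2 * mean_degree / real k\<rfloor>"

lemma mean_degree_k: "real k \<le> mean_degree"
proof -
  have "real k * 1 \<le> real k ^ 3 * ln n" using k3 ln1 by (intro mult_mono) auto
  then show ?thesis using mean_degree_large k3 ln1 by linarith
qed

lemma max_degree_bounds: "1 \<le> max_degree" "real max_degree \<le> 2 * mean_degree / real k"
   "real x < 2 * (mean_degree / real k) \<Longrightarrow> x \<le> max_degree"
proof -
  have "1 \<le> mean_degree / real k" using mean_degree_k k1 by simp
  then have *: "1 \<le> 2 * mean_degree / real k" by simp
  show "1 \<le> max_degree" using * unfolding max_degree_def by linarith
  show "real max_degree \<le> 2 * mean_degree / real k" using * unfolding max_degree_def by linarith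
  show "real x < 2 * (mean_degree / real k) \<Longrightarrow> x \<le> max_degree" unfolding max_degree_def by (simp add: le_nat_floor)
qed

lemma space_bound:
  assumes m: "real N * mean_degree \<le> 8 * m"
  shows "real (15 * (slots * N * max_degree) + 2 * N) + 2 * m \<le> 738 * m * ln n"
proof -
  have k0: "0 < real k" using k1 by simp
  have md: "1 \<le> mean_degree" using mean_degree_k k1 by linarith
  have "real slots * real max_degree \<le> (3 * real k * ln n) * (2 * mean_degree / real k)"
    using slots_bounds(2) max_degree_bounds(2) ln1 by (intro mult_mono) auto
  also have "\<dots> = 6 * ln n * mean_degree" using k0 by simp
  finally have "real slots * real max_degree * real N \<le> 6 * ln n * mean_degree * real N"
    by (intro mult_right_mono) auto
  also have "\<dots> = 6 * ln n * (real N * mean_degree)" by simp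
  also have "\<dots> \<le> 6 * ln n * (8 * m)" using m ln1 by (intro mult_left_mono) auto
  finally have a: "real (slots * N * max_degree) \<le> 48 * (m * ln n)" by (simp add: ac_simps)
  have "real N * 1 \<le> real N * mean_degree" using md by (intro mult_left_mono) auto
  then have b: "real N \<le> 8 * m" using m by simp
  then have "0 \<le> m" by (smt (verit) of_nat_0_le_iff)
  then have "m * 1 \<le> m * ln n" using ln1 by (intro mult_left_mono) auto
  then show ?thesis using a b by simp
qed

lemma slots_le: "slots \<le> N"
  using slots_bounds(4) N_ge_n by linarith

lemma parallel_succeeds:
  fixes s M wb h :: nat and code :: "node \<Rightarrow> nat"
  defines "f \<equiv> 1 / real k" and "K \<equiv> slots"
  defines "\<tau> \<equiv> sbm.threshold n k (f * p) (f * q)"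
  defines "A \<equiv> protocol.algorithm (node_set N) code M (Suc N) (6 + 4 * h) wb edge_target (clustering.start K)
      (clustering.upd h) (clustering.out N K s h \<tau>) (node_coin N f) clustering.result"
  assumes s: "2 \<le> s" and h: "N \<le> s ^ h" and code: "bij_betw code (node_set N) {..<M}"
    and wb: "M * Suc N \<le> 2 ^ wb" "N \<le> 2 ^ wb"
    and D: "input_distribution M s D"
    and B: "\<And>m. real N * mean_degree \<le> 8 * real m \<Longrightarrow> real ((2 * (6 + 4 * h) + 2) * (15 * (K * N * max_degree) + 2 * m + 2 * N)) \<le> B m"
  shows "1 - 4 / real n \<le> measure_pmf.prob (SBM_execution A D G) {(E, H). succeeds A s D (V ` {..<k}) B E H}"
proof -
  have f: "0 < f" "f \<le> 1" "1 / real k \<le> f" using k1 by (auto simp: f_def)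
  interpret f: sbm n k "f * p" "f * q" V by (rule sparsified_sbm[OF f(1,2)])
  have N1: "1 \<le> N" using n2 k1 by simp
  have KN: "K \<le> N" unfolding K_def by (rule slots_le)
  have R: "max N K = N" using KN by simp
  interpret clustering N K s h \<tau>
    using s h N1 KN slots_bounds(3) f.threshold_pos by unfold_locales (auto simp: K_def \<tau>_def)
  have code': "bij_betw code (node_set (max N K)) {..<M}" unfolding R by (rule code)
  interpret protocol "node_set N" code M "Suc N" "6 + 4 * h" wb edge_target start upd out "node_coin N f" result
    using clustering_protocol[OF code'] unfolding R .
  let ?C = "Pi_pmf {..<M} 0 (\<lambda>i. node_coin N f (node i))"
  let ?H = "\<lambda>E \<omega>. run (\<lambda>i. pair_words (D E i)) \<omega>"
  let ?F = "\<lambda>E \<omega>. {e \<in> E. \<omega> (code (edge_target e)) = (1::nat)}"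
  let ?r = "\<lambda>\<omega> j. \<omega> (code (Slot j))"
  have A: "A = algorithm" unfolding A_def ..
  have exec: "SBM_execution A D G = map_pmf (\<lambda>(E, \<omega>). (E, ?H E \<omega>)) (pair_pmf G ?C)"
    unfolding SBM_execution_def A mpc_execution_algorithm pair_pmf_def
    by (simp add: map_pmf_def bind_assoc_pmf bind_return_pmf)
  have inj: "inj_on code (node_set N)" using code by (simp add: bij_betw_def)
  have target_in: "edge_target e \<in> node_set N" if "e \<in> vertex_pairs N" for e
    using that by (auto simp: vertex_pairs_def edge_target_def node_set_def)
  have slot_in: "Slot j \<in> node_set N" if "j < K" for j using that KN by (simp add: node_set_def)
  have law_F: "map_pmf (\<lambda>(E, \<omega>). ?F E \<omega>) (pair_pmf G ?C) = f.G"
  proof -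
    let ?c = "\<lambda>\<omega> e. if e \<in> vertex_pairs N then \<omega> (code (edge_target e)) = (1::nat) else False"
    have "inj_on (\<lambda>e. code (edge_target e)) (vertex_pairs N)"
      using inj target_in by (auto simp: inj_on_def edge_target_def prod_eq_iff)
    moreover have "(\<lambda>e. code (edge_target e)) ` vertex_pairs N \<subseteq> {..<M}" using target_in by auto
    ultimately have "map_pmf ?c ?C = Pi_pmf (vertex_pairs N) False
        (\<lambda>e. map_pmf (\<lambda>c. c = 1) (node_coin N f (node (code (edge_target e)))))"
      by (intro Pi_pmf_reindex) auto
    also have "\<dots> = Pi_pmf (vertex_pairs N) False (\<lambda>_. bernoulli_pmf f)"
    proof (intro Pi_pmf_cong refl)
      fix e assume "e \<in> vertex_pairs N"
      then have "node (code (edge_target e)) = Input (fst e) (snd e)" using target_in by (simp add: edge_target_def)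
      then show "map_pmf (\<lambda>c. c = 1) (node_coin N f (node (code (edge_target e)))) = bernoulli_pmf f"
        by (simp only: node_coin_Input)
    qed
    finally have c: "map_pmf ?c ?C = Pi_pmf (vertex_pairs N) False (\<lambda>_. bernoulli_pmf f)" .
    have "map_pmf (\<lambda>(E, \<omega>). ?F E \<omega>) (pair_pmf G ?C) = map_pmf (\<lambda>(E, \<omega>). {e \<in> E. ?c \<omega> e}) (pair_pmf G ?C)"
      using set_G by (intro map_pmf_cong refl) fastforce
    also have "\<dots> = map_pmf (\<lambda>(E, c). {e \<in> E. c e}) (pair_pmf G (map_pmf ?c ?C))"
      unfolding pair_map_pmf2 pmf.map_comp by (intro map_pmf_cong refl) (auto simp: apsnd_def)
    also have "\<dots> = f.G"
      unfolding c using f q qp p1 by (intro SBM_sparsify) auto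
    finally show ?thesis .
  qed
  have law_r: "map_pmf (\<lambda>\<omega> j. if j \<in> {..<K} then ?r \<omega> j else 0) ?C = Pi_pmf {..<K} 0 (\<lambda>_. pmf_of_set {..<N})"
  proof -
    have "inj_on (\<lambda>j. code (Slot j)) {..<K}" using inj slot_in by (auto simp: inj_on_def)
    moreover have "(\<lambda>j. code (Slot j)) ` {..<K} \<subseteq> {..<M}" using slot_in by auto
    ultimately have "map_pmf (\<lambda>\<omega> j. if j \<in> {..<K} then (\<lambda>x. x) (\<omega> (code (Slot j))) else 0) ?C
        = Pi_pmf {..<K} 0 (\<lambda>j. map_pmf (\<lambda>x. x) (node_coin N f (node (code (Slot j)))))"
      by (intro Pi_pmf_reindex) auto
    also have "\<dots> = Pi_pmf {..<K} 0 (\<lambda>_. pmf_of_set {..<N})"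
      using slot_in by (intro Pi_pmf_cong refl) (simp add: node_coin_def)
    finally show ?thesis by simp
  qed
  have prob_F: "measure_pmf.prob (pair_pmf G ?C) {(E, \<omega>). P (?F E \<omega>)} = measure_pmf.prob f.G {F. P F}" for P
    unfolding law_F[symmetric] by (simp add: vimage_def case_prod_unfold)
  have prob_r: "measure_pmf.prob ?C {\<omega>. \<exists>i\<in>{..<k}. \<forall>j<K. ?r \<omega> j \<notin> V i}
      = measure_pmf.prob (Pi_pmf {..<K} 0 (\<lambda>_. pmf_of_set {..<N})) {r. \<exists>i\<in>{..<k}. \<forall>j<K. r j \<notin> V i}"
    unfolding law_r[symmetric] by (simp add: vimage_def)
  have succ: "succeeds A s D (V ` {..<k}) B E (?H E \<omega>)"
    if supp: "(E, \<omega>) \<in> set_pmf (pair_pmf G ?C)"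
      and deg: "\<not> (\<exists>u\<in>{..<N}. real (vertex_degree E u) \<le> mean_degree / 4)"
      and degF: "\<not> (\<exists>u\<in>{..<N}. real (vertex_degree (?F E \<omega>) u) \<ge> 2 * (mean_degree / real k))"
      and sep: "separates N k V \<tau> (?F E \<omega>)"
      and hit: "\<not> (\<exists>i\<in>{..<k}. \<forall>j<K. ?r \<omega> j \<notin> V i)" for E \<omega>
  proof -
    have E: "E \<subseteq> vertex_pairs N" using supp set_G by simp
    have finE: "finite E" using E finite_subset finite_vertex_pairs by blast
    have FE: "?F E \<omega> \<subseteq> vertex_pairs N" using E by auto
    have "E \<subseteq> {..<N} \<times> {..<N}" using E by (auto simp: vertex_pairs_def)
    then have "card E \<le> card ({..<N} \<times> {..<N})" by (intro card_mono) auto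
    also have "\<dots> = N ^ 2" by (simp add: card_cartesian_product power2_eq_square)
    also have "\<dots> \<le> card (node_set N)" using node_set_finite_card[of N] by blast
    also have "\<dots> = M" using bij_betw_same_card[OF code] by simp
    finally have cE: "card E \<le> M" .
    have dist: "distributes M s E (D E)"
      using D distributes_singletons[OF finE cE s] unfolding input_distribution_def by blast
    have r: "?r \<omega> j < N" if j: "j < K" for j
    proof -
      have "\<omega> \<in> set_pmf ?C" using supp by simp
      then have "\<omega> i \<in> set_pmf (node_coin N f (node i))" if "i < M" for i
        using that by (auto simp: set_Pi_pmf PiE_dflt_def)
      then have "?r \<omega> j \<in> set_pmf (node_coin N f (node (code (Slot j))))"
        using code_less[OF slot_in[OF j]] by blast
      also have "set_pmf (node_coin N f (node (code (Slot j)))) = {..<N}"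
      proof -
        have "{..<N} \<noteq> {}" using N1 by (simp only: lessThan_empty_iff)
        then show ?thesis using slot_in[OF j] by (simp add: node_coin_def set_pmf_of_set)
      qed
      finally show ?thesis by simp
    qed
    have dF: "vertex_degree (?F E \<omega>) u \<le> max_degree" for u
    proof (cases "u < N")
      case True
      then show ?thesis using degF max_degree_bounds(3) by (meson lessThan_iff not_le)
    next
      case False
      then have "{w. adj (?F E \<omega>) u w} = {}" using adj_less[OF FE] by blast
      then show ?thesis by (simp add: vertex_degree_def)
    qed
    have hit': "\<exists>j<K. ?r \<omega> j \<in> V i" if "i < k" for i using hit that by blast
    let ?B = "15 * (K * N * max_degree) + 2 * card E + 2 * N"
    note result = clustering_succeeds[where r="?r \<omega>" and \<omega>=\<omega> and \<Delta>=max_degree and B="?B" and wb=wb and M=M and code=code and s=s,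
      OF part refl n2 code' E dist refl refl r max_degree_bounds(1) dF order_refl _ _ _ _ _ sep hit', unfolded R]
    have *: "within_memory algorithm s (?H E \<omega>)" "total_space algorithm (?H E \<omega>) \<le> (2 * (6 + 4 * h) + 2) * ?B"
      "outputs_clusters M (last (?H E \<omega>)) (V ` {..<k})"
      by (rule result; use wb in simp)+
    have "real N * mean_degree \<le> 8 * real (card E)"
      using deg by (intro edges_ge[OF E]) (auto simp: not_le intro: less_imp_le)
    then have "real (total_space algorithm (?H E \<omega>)) \<le> B (card E)"
      using B[of "card E"] *(2) by (meson of_nat_mono order_trans)
    then show ?thesis unfolding succeeds_def A using dist * by simp
  qed
  have "1 - 4 * (1 / real n) \<le> measure_pmf.prob (pair_pmf G ?C) {(E, \<omega>). succeeds A s D (V ` {..<k}) B E (?H E \<omega>)}"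
  proof (rule prob_ge_1_minus)
    show "measure_pmf.prob (pair_pmf G ?C) {(E, \<omega>). \<exists>u\<in>{..<N}. real (vertex_degree E u) \<le> mean_degree / 4} \<le> 1 / real n"
      unfolding prob_pair_pmf_fst by (rule degrees_not_small)
    show "measure_pmf.prob (pair_pmf G ?C) {(E, \<omega>). \<exists>u\<in>{..<N}. real (vertex_degree (?F E \<omega>) u) \<ge> 2 * (mean_degree / real k)} \<le> 1 / real n"
      unfolding prob_F[of "\<lambda>F. \<exists>u\<in>{..<N}. real (vertex_degree F u) \<ge> 2 * (mean_degree / real k)"]
      unfolding f_def by (rule sparsified_degrees_not_large)
    show "measure_pmf.prob (pair_pmf G ?C) {(E, \<omega>). \<not> separates N k V \<tau> (?F E \<omega>)} \<le> 1 / real n"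
      unfolding prob_F[of "\<lambda>F. \<not> separates N k V \<tau> F"]
      unfolding \<tau>_def by (rule sparsified_separates[OF f(3,2)])
    show "measure_pmf.prob (pair_pmf G ?C) {(E, \<omega>). \<exists>i\<in>{..<k}. \<forall>j<K. ?r \<omega> j \<notin> V i} \<le> 1 / real n"
      unfolding prob_pair_pmf_snd prob_r using slots_bounds(1) unfolding K_def by (rule uniform_slots_hit)
  qed (use succ in auto)
  then show ?thesis unfolding exec by (simp add: vimage_def case_prod_unfold)
qed

end

definition trivial_algorithm :: mpc_algorithm where
  "trivial_algorithm = \<lparr> num_machines = 1, word_bits = 0, num_rounds = 0,
     local_step = (\<lambda>_ _ _. return_pmf ([], [])), local_output = (\<lambda>_ _. return_pmf []) \<rparr>"

lemma log_nat_nonneg: "1 \<le> n \<Longrightarrow> 0 \<le> log (real s) (real n)"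
  by (cases "s = 0") (auto simp: log_def)

lemma central_case:
  fixes n k s :: nat and p q :: real
  assumes n: "3 \<le> n" and k: "1 \<le> k" and pq: "0 < q" "q < p" "p < 1"
    and gap: "625 * real k ^ 3 * ln n * p\<^sup>2 \<le> real n * (p - q) ^ 4"
      "625 * real k ^ 3 * ln n \<le> real n" "625 * real k ^ 3 * ln n \<le> real n * p" "1 \<le> ln n"
    and s: "4 * (k * n)\<^sup>2 \<le> s" and wb: "k * n \<le> 2 ^ wb"
    and part: "hidden_partition n k V" and D: "input_distribution 1 s D"
  shows "1 - 4 / real n \<le> measure_pmf.prob
      (SBM_execution (central_algorithm (k * n) (sbm.threshold n k p q) wb) D (SBM n p q k V))
      {(E, H). succeeds (central_algorithm (k * n) (sbm.threshold n k p q) wb) s D (V ` {..<k})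
         (\<lambda>m. 40000 * real m * ln (real (k * n)) ^ 2) E H}"
proof -
  interpret sbm_gap n k p q V
    using assms by unfold_locales auto
  let ?A = "central_algorithm N threshold wb"
  let ?B = "\<lambda>m. 40000 * real m * ln (real N) ^ 2"
  have LN: "1 \<le> ln (real N)"
  proof -
    have "ln n \<le> ln (real N)" using n k by (intro ln_mono) (auto simp: mult_le_cancel_right1)
    then show ?thesis using ln1 by linarith
  qed
  have succ: "succeeds ?A s D (V ` {..<k}) ?B E h"
    if E: "E \<in> set_pmf G" and h: "h \<in> set_pmf (mpc_execution ?A (\<lambda>i. pair_words (D E i)))"
      and deg: "\<not> (\<exists>u\<in>{..<N}. real (vertex_degree E u) \<le> mean_degree / 4)"
      and sep: "separates N k V threshold E" for E h
  proof (rule central_succeeds[OF part refl _ k set_G[OF E] sep D s wb _ h])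
    show "2 \<le> n" using n by simp
    have "real N * mean_degree \<le> 8 * real (card E)"
      using deg by (intro edges_ge[OF set_G[OF E]]) (auto simp: not_le intro: less_imp_le)
    moreover have "real N * 1 \<le> real N * mean_degree"
      using mean_degree_k k by (intro mult_left_mono) auto
    ultimately have "real N \<le> 8 * real (card E)" by simp
    moreover have "36 * real (card E) * 1 \<le> 40000 * real (card E) * ln (real N) ^ 2"
      using LN by (intro mult_mono) auto
    ultimately show "real (2 * (2 * card E + 2 * N)) \<le> ?B (card E)" by simp
  qed
  let ?P = "SBM_execution ?A D G"
  have fst_P: "map_pmf fst ?P = G"
    by (simp add: SBM_execution_def map_bind_pmf pmf.map_comp o_def map_pmf_const bind_return_pmf')
  have prob_P: "measure_pmf.prob ?P {(E, h). X E} = measure_pmf.prob G {E. X E}" for X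
  proof -
    have "measure_pmf.prob G {E. X E} = measure_pmf.prob (map_pmf fst ?P) {E. X E}" by (simp only: fst_P)
    also have "\<dots> = measure_pmf.prob ?P {(E, h). X E}"
      unfolding measure_map_pmf by (simp add: vimage_def case_prod_unfold)
    finally show ?thesis by (rule sym)
  qed
  have "1 - 4 * (1 / real n) \<le> measure_pmf.prob ?P {(E, H). succeeds ?A s D (V ` {..<k}) ?B E H}"
  proof (rule prob_ge_1_minus[where ?B3.0="{}" and ?B4.0="{}"])
    show "measure_pmf.prob ?P {(E, h). \<exists>u\<in>{..<N}. real (vertex_degree E u) \<le> mean_degree / 4} \<le> 1 / real n"
      unfolding prob_P by (rule degrees_not_small)
    show "measure_pmf.prob ?P {(E, h). \<not> separates N k V threshold E} \<le> 1 / real n"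
      unfolding prob_P using sparsified_separates[of 1] k by simp
  qed (use succ in \<open>auto simp: SBM_execution_def\<close>)
  then show ?thesis by simp
qed

lemma parallel_case:
  fixes n k s :: nat and p q :: real
  assumes n: "3 \<le> n" and k: "1 \<le> k" and pq: "0 < q" "q < p" "p < 1"
    and gap: "625 * real k ^ 3 * ln n * p\<^sup>2 \<le> real n * (p - q) ^ 4"
      "625 * real k ^ 3 * ln n \<le> real n" "625 * real k ^ 3 * ln n \<le> real n * p" "1 \<le> ln n"
    and s: "2 \<le> s" "s < 4 * (k * n)\<^sup>2"
  shows "\<exists>A. real (word_bits A) \<le> 30 * ln (real n) \<and> num_machines A \<le> 2 ^ word_bits A \<and>
      real (num_rounds A) \<le> 68 * log (real s) (real n) \<and>
      (\<forall>V D. hidden_partition n k V \<and> input_distribution (num_machines A) s D \<longrightarrow>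
         measure_pmf.prob (SBM_execution A D (SBM n p q k V))
           {(E, h). succeeds A s D (V ` {..<k}) (\<lambda>m. 40000 * real m * ln (real (k * n)) ^ 2) E h}
         \<ge> 1 - 4 / real n)"
proof -
  interpret base: sbm_gap n k p q "\<lambda>i. {z. z div n = i}"
    using assms by unfold_locales (auto intro: hidden_partition_blocks)
  let ?N = "k * n"
  define f where "f = 1 / real k"
  define \<tau> where "\<tau> = sbm.threshold n k (f * p) (f * q)"
  define h where "h = nat \<lceil>log (real s) (real ?N)\<rceil>"
  define wb where "wb = nat \<lceil>12 * log 2 (real n)\<rceil>"
  define M where "M = card (node_set ?N)"
  have N1: "1 \<le> ?N" using n k by simp
  have Nn: "?N \<le> n\<^sup>2" using base.k_le_n by (simp add: power2_eq_square)
  have n12: "n ^ 12 \<le> 2 ^ wb" and wb30: "real wb \<le> 30 * ln (real n)"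
    using word_size[OF n gap(4)] by (simp_all add: wb_def)
  obtain code where code: "bij_betw code (node_set ?N) {..<M}"
    using ex_bij_betw_finite_nat[of "node_set ?N"] node_set_finite_card[of ?N] by (auto simp: M_def atLeast0LessThan)
  have NM: "M * Suc ?N \<le> 2 ^ wb"
  proof -
    have "M * Suc ?N \<le> (8 * ?N ^ 3) * (2 * ?N)"
      using node_set_finite_card[of ?N] N1 unfolding M_def by (intro mult_mono) auto
    also have "\<dots> = 16 * ?N ^ 4" by (simp add: power4_eq_xxxx power3_eq_cube)
    also have "\<dots> \<le> n ^ 4 * (n\<^sup>2) ^ 4"
    proof (intro mult_mono power_mono Nn)
      have "3 ^ 4 \<le> n ^ 4" using n by (intro power_mono) auto
      then show "16 \<le> n ^ 4" by simp
    qed auto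
    also have "\<dots> = n ^ 12" by (simp add: power_mult[symmetric] power_add[symmetric])
    finally show ?thesis using n12 by simp
  qed
  have M1: "M \<le> 2 ^ wb" using NM by simp
  have N_wb: "?N \<le> 2 ^ wb"
  proof -
    have "n\<^sup>2 \<le> n ^ 12" using n by (intro power_increasing) auto
    then show ?thesis using Nn n12 by simp
  qed
  have lns: "0 < ln (real s)" using s(1) by simp
  have n0: "0 < real n" using n by simp
  have log_N: "log (real s) (real ?N) \<le> 2 * log (real s) (real n)"
  proof -
    have "log (real s) (real ?N) \<le> log (real s) (real (n\<^sup>2))"
    proof (rule log_mono)
      show "real ?N \<le> real (n\<^sup>2)" using Nn by (simp only: of_nat_le_iff)
    qed (use s n k in auto)
    also have "\<dots> = 2 * log (real s) (real n)" using n0 by (simp add: log_nat_power)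
    finally show ?thesis .
  qed
  have log_1: "1 \<le> 6 * log (real s) (real n)"
  proof -
    have "4 * ?N\<^sup>2 \<le> n\<^sup>2 * (n\<^sup>2)\<^sup>2"
    proof (intro mult_mono power_mono Nn)
      have "2\<^sup>2 \<le> n\<^sup>2" using n by (intro power_mono) auto
      then show "4 \<le> n\<^sup>2" by simp
    qed auto
    also have "\<dots> = n ^ 6" by (simp add: power_mult[symmetric] power_add[symmetric])
    finally have "real s \<le> real (n ^ 6)" using s(2) by (simp only: of_nat_le_iff)
    then have "ln (real s) \<le> ln (real n ^ 6)" using s(1) n0 by (subst ln_le_cancel_iff) auto
    also have "\<dots> = 6 * ln (real n)" using n0 by (simp add: ln_realpow)
    finally show ?thesis using lns by (simp add: log_def field_simps)
  qed
  have h: "?N \<le> s ^ h" "real h \<le> 2 * log (real s) (real n) + 1"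
    using tree_height[OF s(1) N1] log_N unfolding h_def by auto
  have h_ln: "real h \<le> 4 * ln n"
  proof -
    have "ln 2 \<le> ln (real s)" using s(1) by simp
    then have l: "2 / 3 \<le> ln (real s)" using ln2_ge_two_thirds by linarith
    have "ln (real n) * 1 \<le> ln (real n) * (3 / 2 * ln (real s))"
      using l gap(4) by (intro mult_left_mono) auto
    then have "log (real s) (real n) \<le> 3 / 2 * ln n" using lns by (simp add: log_def field_simps)
    then show ?thesis using h(2) gap(4) by linarith
  qed
  define A where "A = protocol.algorithm (node_set ?N) code M (Suc ?N) (6 + 4 * h) wb edge_target
      (clustering.start base.slots) (clustering.upd h) (clustering.out ?N base.slots s h \<tau>) (node_coin ?N f) clustering.result"
  have prot: "protocol (node_set ?N) code M (6 + 4 * h)"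
    using node_set_finite_card[of ?N] code by unfold_locales auto
  have A: "num_machines A = M" "word_bits A = wb" "num_rounds A = 6 + 4 * h"
    unfolding A_def by (simp_all add: protocol.algorithm_simps[OF prot])
  have rounds: "real (6 + 4 * h) \<le> 68 * log (real s) (real n)"
    using h(2) log_1 by simp
  have LN: "ln n \<le> ln (real ?N)" using n k by (intro ln_mono) (auto simp: mult_le_cancel_right1)
  have "1 - 4 / real n \<le> measure_pmf.prob (SBM_execution A D (SBM n p q k V))
      {(E, h). succeeds A s D (V ` {..<k}) (\<lambda>m. 40000 * real m * ln (real ?N) ^ 2) E h}"
    if V: "hidden_partition n k V" and D: "input_distribution M s D" for V D
  proof -
    interpret sbm_gap n k p q V
      using assms V by unfold_locales auto
    have space: "real ((2 * (6 + 4 * h) + 2) * (15 * (slots * N * max_degree) + 2 * m + 2 * N)) \<le> 40000 * real m * ln (real N) ^ 2"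
      if m: "real N * mean_degree \<le> 8 * real m" for m :: nat
    proof -
      have "real (15 * (slots * N * max_degree) + 2 * m + 2 * N) \<le> 738 * real m * ln n"
        using space_bound[OF m] by simp
      moreover have "real (2 * (6 + 4 * h) + 2) \<le> 46 * ln n" using h_ln gap(4) by simp
      ultimately have "real ((2 * (6 + 4 * h) + 2) * (15 * (slots * N * max_degree) + 2 * m + 2 * N))
          \<le> (46 * ln n) * (738 * real m * ln n)"
        unfolding of_nat_mult[of "2 * (6 + 4 * h) + 2"] using gap(4) by (intro mult_mono) auto
      also have "\<dots> = 33948 * real m * (ln n) ^ 2" by (simp add: power2_eq_square)
      also have "\<dots> \<le> 40000 * real m * ln (real N) ^ 2"
        using LN gap(4) by (intro mult_mono power_mono) auto
      finally show ?thesis .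
    qed
    show ?thesis
      unfolding A_def \<tau>_def f_def
      by (rule parallel_succeeds[OF s(1) h(1) code NM N_wb D]) (rule space)
  qed
  then show ?thesis using A wb30 M1 rounds by (intro exI[of _ A]) auto
qed

theorem theorem3:
  "\<exists>C_gap>0. \<forall>c_mem>0. \<exists>C_word>0. \<exists>C_rounds>0. \<exists>C_space>0. \<exists>d::nat. \<exists>C_fail>0.
     \<forall>(n::nat) (k::nat) (p::real) (q::real) (s::nat).
       n \<ge> 1 \<and> k \<ge> 1 \<and> 0 < q \<and> q < p \<and> p < 1 \<and>
       (p - q) / sqrt p \<ge>
         C_gap * real k powr (3/4) * real n powr (- (1/4)) * ln (real n) powr (1/4) \<and>
       real s \<ge> c_mem * ln (real n) \<longrightarrow>
       (\<exists>A :: mpc_algorithm.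
          real (word_bits A) \<le> C_word * ln (real n) \<and>
          num_machines A \<le> 2 ^ word_bits A \<and>
          real (num_rounds A) \<le> C_rounds * log (real s) (real n) \<and>
          (\<forall>V D. hidden_partition n k V \<and> input_distribution (num_machines A) s D \<longrightarrow>
             measure_pmf.prob (SBM_execution A D (SBM n p q k V))
               {(E, h). succeeds A s D (V ` {..<k})
                  (\<lambda>m. C_space * real m * ln (real (k * n)) ^ d) E h}
             \<ge> 1 - C_fail / real n))"
proof (rule exI[of _ 5], intro conjI allI impI)
  fix c_mem :: real assume c: "0 < c_mem"
  define n0 where "n0 = max 4 (exp (2 / c_mem))"
  have n0: "4 \<le> n0" by (simp add: n0_def)
  let ?goal = "\<lambda>n k p q s. \<exists>A :: mpc_algorithm.
          real (word_bits A) \<le> 30 * ln (real n) \<and>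
          num_machines A \<le> 2 ^ word_bits A \<and>
          real (num_rounds A) \<le> 68 * log (real s) (real n) \<and>
          (\<forall>V D. hidden_partition n k V \<and> input_distribution (num_machines A) s D \<longrightarrow>
             measure_pmf.prob (SBM_execution A D (SBM n p q k V))
               {(E, h). succeeds A s D (V ` {..<k})
                  (\<lambda>m. 40000 * real m * ln (real (k * n)) ^ 2) E h}
             \<ge> 1 - n0 / real n)"
  have main: "?goal n k p q s"
    if n1: "n \<ge> 1" and k: "k \<ge> 1" and pq: "0 < q" "q < p" "p < 1"
      and gap: "(p - q) / sqrt p \<ge> 5 * real k powr (3/4) * real n powr (- (1/4)) * ln (real n) powr (1/4)"
      and s: "real s \<ge> c_mem * ln (real n)" for n k s :: nat and p q :: real
  proof (cases "real n < n0")
    case True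
    then have "1 - n0 / real n \<le> 0" using n1 by simp
    then have "1 - n0 / real n \<le> measure_pmf.prob P X" for P :: "((nat \<times> nat) set \<times> configuration list) pmf" and X
      by (rule order_trans) simp
    moreover have "0 \<le> ln (real n)" using n1 by simp
    ultimately show ?thesis using log_nat_nonneg[OF n1, of s]
      by (intro exI[of _ trivial_algorithm]) (simp add: trivial_algorithm_def)
  next
    case False
    then have big: "4 \<le> real n" "exp (2 / c_mem) \<le> real n" by (auto simp: n0_def)
    then have n3: "3 \<le> n" by simp
    note cons = gap_consequences[OF n3 k pq gap]
    have "2 / c_mem \<le> ln (real n)" using big by (simp add: ln_ge_iff)
    then have "2 \<le> c_mem * ln (real n)" using c by (simp add: field_simps)
    then have s2: "2 \<le> s" using s by linarith
    have weaken: "1 - n0 / real n \<le> x" if "1 - 4 / real n \<le> x" for x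
    proof -
      have "4 / real n \<le> n0 / real n" using n0 by (intro divide_right_mono) auto
      then show ?thesis using that by linarith
    qed
    show ?thesis
    proof (cases "s < 4 * (k * n)\<^sup>2")
      case True
      obtain A where A: "real (word_bits A) \<le> 30 * ln (real n)" "num_machines A \<le> 2 ^ word_bits A"
          "real (num_rounds A) \<le> 68 * log (real s) (real n)"
        and succ: "\<forall>V D. hidden_partition n k V \<and> input_distribution (num_machines A) s D \<longrightarrow>
         1 - 4 / real n \<le> measure_pmf.prob (SBM_execution A D (SBM n p q k V))
           {(E, h). succeeds A s D (V ` {..<k}) (\<lambda>m. 40000 * real m * ln (real (k * n)) ^ 2) E h}"
        using parallel_case[OF n3 k pq cons s2 True] by (elim exE conjE)
      show ?thesis
      proof (intro exI[of _ A] conjI A allI impI)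
        fix V D assume "hidden_partition n k V \<and> input_distribution (num_machines A) s D"
        then show "1 - n0 / real n \<le> measure_pmf.prob (SBM_execution A D (SBM n p q k V))
           {(E, h). succeeds A s D (V ` {..<k}) (\<lambda>m. 40000 * real m * ln (real (k * n)) ^ 2) E h}"
          by (intro weaken succ[rule_format])
      qed
    next
      case False
      define wb where "wb = nat \<lceil>12 * log 2 (real n)\<rceil>"
      define A where "A = central_algorithm (k * n) (sbm.threshold n k p q) wb"
      have wb: "n ^ 12 \<le> 2 ^ wb" "real wb \<le> 30 * ln (real n)"
        using word_size[OF n3 cons(4)] by (simp_all add: wb_def)
      have "k \<le> n"
      proof -
        interpret sbm_gap n k p q "\<lambda>i. {z. z div n = i}"
          using n3 k pq cons by unfold_locales (auto intro: hidden_partition_blocks)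
        show ?thesis by (rule k_le_n)
      qed
      then have "k * n \<le> n ^ 2" by (simp add: power2_eq_square)
      also have "\<dots> \<le> n ^ 12" using n3 by (intro power_increasing) auto
      finally have N: "k * n \<le> 2 ^ wb" using wb(1) by simp
      have A: "num_machines A = 1" "word_bits A = wb" "num_rounds A = 0"
        by (simp_all add: A_def central_algorithm_def)
      have "1 - n0 / real n \<le> measure_pmf.prob (SBM_execution A D (SBM n p q k V))
          {(E, h). succeeds A s D (V ` {..<k}) (\<lambda>m. 40000 * real m * ln (real (k * n)) ^ 2) E h}"
        if "hidden_partition n k V" "input_distribution 1 s D" for V D
        using False central_case[OF n3 k pq cons _ N that] unfolding A_def by (intro weaken) simp
      then show ?thesis using A wb(2) log_nat_nonneg[OF n1, of s] by (intro exI[of _ A]) simp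
    qed
  qed
  show "\<exists>C_word>0. \<exists>C_rounds>0. \<exists>C_space>0. \<exists>d::nat. \<exists>C_fail>0.
     \<forall>(n::nat) (k::nat) (p::real) (q::real) (s::nat).
       n \<ge> 1 \<and> k \<ge> 1 \<and> 0 < q \<and> q < p \<and> p < 1 \<and>
       (p - q) / sqrt p \<ge>
         5 * real k powr (3/4) * real n powr (- (1/4)) * ln (real n) powr (1/4) \<and>
       real s \<ge> c_mem * ln (real n) \<longrightarrow>
       (\<exists>A :: mpc_algorithm.
          real (word_bits A) \<le> C_word * ln (real n) \<and>
          num_machines A \<le> 2 ^ word_bits A \<and>
          real (num_rounds A) \<le> C_rounds * log (real s) (real n) \<and>
          (\<forall>V D. hidden_partition n k V \<and> input_distribution (num_machines A) s D \<longrightarrow>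
             measure_pmf.prob (SBM_execution A D (SBM n p q k V))
               {(E, h). succeeds A s D (V ` {..<k})
                  (\<lambda>m. C_space * real m * ln (real (k * n)) ^ d) E h}
             \<ge> 1 - C_fail / real n))"
  proof (rule exI[of _ 30], rule conjI, simp, rule exI[of _ 68], rule conjI, simp,
      rule exI[of _ 40000], rule conjI, simp, rule exI[of _ 2], rule exI[of _ n0], rule conjI)
    show "0 < n0" using n0 by simp
  qed (intro allI impI, elim conjE, rule main)
qed simp

end
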